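(* Let $\Omega\subset\mathbb{H}^n$ be open and bounded, $1<p\le q<\infty$, $0<s\le t<1$, let $a$ satisfy (A1) and (A2) with exponent $\alpha\in(0,1]$, and assume $tq\le sp+\alpha$. Let $u\in\mathcal{A}(\Omega)\cap L^{q-1}_{sp}(\mathbb{H}^n)$ be a weak solution (of the equation in the context) which is locally bounded in $\Omega$. Then for every open $\Omega'\Subset\Omega$, $u$ is locally Hölder continuous in $\Omega'$: $u\in C^{0,\beta}_{loc}(\Omega')$ for some $\beta\in(0,\frac{sp}{q-1})$ depending only on $n,p,q,s,t,\alpha,[a]_\alpha,\|a\|_{L^\infty}$ and $\|u\|_{L^\infty(\Omega')}$ (Hölder continuity measured with respect to $\|\eta^{-1}\circ\xi\|_{\mathbb{H}^n}$).
   Context: The Heisenberg group $\mathbb{H}^n$ ($n\ge1$) is $\mathbb{R}^{2n+1}$ with the group law $\xi\circ\eta=(x_1+y_1,\dots,x_{2n}+y_{2n},\tau+\tau'+\frac12\sum_{i=1}^n(x_iy_{n+i}-x_{n+i}y_i))$; measure is Lebesgue measure. Homogeneous norm $\|\xi\|_{\mathbb{H}^n}=((\sum_{i=1}^{2n}x_i^2)^2+\tau^2)^{1/4}$, $Q=2n+2$. Balls are taken with respect to the Carnot–Carathéodory distance, equivalent to $\|\xi^{-1}\circ\eta\|_{\mathbb{H}^n}$. (A1): $a:\mathbb{H}^n\times\mathbb{H}^n\to[0,\infty)$ measurable, $0\le a(\xi,\eta)=a(\eta,\xi)\le\|a\|_{L^\infty}<\infty$. (A2): $|a(\xi,\eta)-a(\xi',\eta')|\le[a]_\alpha(\|\xi'^{-1}\circ\xi\|_{\mathbb{H}^n}+\|\eta'^{-1}\circ\eta\|_{\mathbb{H}^n})^\alpha$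 for all $\xi,\eta,\xi',\eta'$. $J_l(\tau)=|\tau|^{l-2}\tau$; $H(\xi,\eta,\tau)=\frac{\tau^p}{\|\eta^{-1}\circ\xi\|^{sp}_{\mathbb{H}^n}}+a(\xi,\eta)\frac{\tau^q}{\|\eta^{-1}\circ\xi\|^{tq}_{\mathbb{H}^n}}$; $\mathcal{C}_\Omega=(\mathbb{H}^n\times\mathbb{H}^n)\setminus((\mathbb{H}^n\setminus\Omega)\times(\mathbb{H}^n\setminus\Omega))$; $\mathcal{A}(\Omega)=\{u$ measurable: $u|_\Omega\in L^p(\Omega)$, $\iint_{\mathcal{C}_\Omega}H(\xi,\eta,|u(\xi)-u(\eta)|)\|\eta^{-1}\circ\xi\|^{-Q}_{\mathbb{H}^n}d\xi d\eta<\infty\}$; $L^{q-1}_{sp}(\mathbb{H}^n)=\{u\in L^{q-1}_{loc}:\int|u|^{q-1}(1+\|\xi\|_{\mathbb{H}^n})^{-Q-sp}d\xi<\infty\}$. A weak solution is $u\in\mathcal{A}(\Omega)$ with $\iint_{\mathcal{C}_\Omega}\Big[\frac{J_p(u(\xi)-u(\eta))(\varphi(\xi)-\varphi(\eta))}{\|\eta^{-1}\circ\xi\|^{Q+sp}_{\mathbb{H}^n}}+a(\xi,\eta)\frac{J_q(u(\xi)-u(\eta))(\varphi(\xi)-\varphi(\eta))}{\|\eta^{-1}\circ\xi\|^{Q+tq}_{\mathbb{H}^n}}\Big]d\xi d\eta=0$ for all $\varphi\in\mathcal{A}(\Omega)$ vanishing a.e. outside $\Omega$. *)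

theory Defs
  imports "HOL-Analysis.Analysis"
begin

text \<open>Heisenberg group H^n realised on (R^n) x (R^n) x R; the first block holds
  x_1..x_n, the second x_{n+1}..x_{2n}, the last coordinate is tau.
  The dimension n = CARD('n) is given by a finite type.\<close>

type_synonym 'n heis = "(real^'n) \<times> (real^'n) \<times> real"

definition hmult :: "'n::finite heis \<Rightarrow> 'n heis \<Rightarrow> 'n heis" where
  "hmult \<xi> \<eta> = (case \<xi> of (x, y, \<tau>) \<Rightarrow> case \<eta> of (x', y', \<tau>') \<Rightarrow>
      (x + x', y + y', \<tau> + \<tau>' + (x \<bullet> y' - y \<bullet> x') / 2))"

definition hinv :: "'n::finite heis \<Rightarrow> 'n heis" where
  "hinv \<xi> = (case \<xi> of (x, y, \<tau>) \<Rightarrow> (-x, -y, -\<tau>))"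

definition hnorm :: "'n::finite heis \<Rightarrow> real" where
  "hnorm \<xi> = (case \<xi> of (x, y, \<tau>) \<Rightarrow> ((norm x ^ 2 + norm y ^ 2) ^ 2 + \<tau> ^ 2) powr (1/4))"

definition hd :: "'n::finite heis \<Rightarrow> 'n heis \<Rightarrow> real" where
  "hd \<xi> \<eta> = hnorm (hmult (hinv \<eta>) \<xi>)"

definition homdim :: "'n::finite itself \<Rightarrow> real" where
  "homdim _ = 2 * real CARD('n) + 2"

definition Jpow :: "real \<Rightarrow> real \<Rightarrow> real" where
  "Jpow l r = \<bar>r\<bar> powr (l - 2) * r"

definition Hfun :: "real \<Rightarrow> real \<Rightarrow> real \<Rightarrow> real \<Rightarrow> ('n::finite heis \<Rightarrow> 'n heis \<Rightarrow> real)
    \<Rightarrow> 'n heis \<Rightarrow> 'n heis \<Rightarrow> real \<Rightarrow> real" where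
  "Hfun p q s t a \<xi> \<eta> r = r powr p / hd \<xi> \<eta> powr (s * p)
      + a \<xi> \<eta> * r powr q / hd \<xi> \<eta> powr (t * q)"

definition Cset :: "'n::finite heis set \<Rightarrow> ('n heis \<times> 'n heis) set" where
  "Cset \<Omega> = UNIV - ((- \<Omega>) \<times> (- \<Omega>))"

definition admissible :: "real \<Rightarrow> real \<Rightarrow> real \<Rightarrow> real \<Rightarrow> ('n::finite heis \<Rightarrow> 'n heis \<Rightarrow> real)
    \<Rightarrow> 'n heis set \<Rightarrow> ('n heis \<Rightarrow> real) \<Rightarrow> bool" where
  "admissible p q s t a \<Omega> u \<longleftrightarrow>
     u \<in> borel_measurable lebesgue \<and>
     (\<integral>\<^sup>+ x. ennreal (indicator \<Omega> x * \<bar>u x\<bar> powr p) \<partial>lebesgue) < \<infinity> \<and>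
     (\<integral>\<^sup>+ z. ennreal (indicator (Cset \<Omega>) z *
          (Hfun p q s t a (fst z) (snd z) \<bar>u (fst z) - u (snd z)\<bar>
           / hd (fst z) (snd z) powr homdim TYPE('n))) \<partial>(lebesgue \<Otimes>\<^sub>M lebesgue)) < \<infinity>"

definition tail_space :: "real \<Rightarrow> real \<Rightarrow> real \<Rightarrow> ('n::finite heis \<Rightarrow> real) \<Rightarrow> bool" where
  "tail_space q s p u \<longleftrightarrow>
     u \<in> borel_measurable lebesgue \<and>
     (\<forall>K. compact K \<longrightarrow>
        (\<integral>\<^sup>+ x. ennreal (indicator K x * \<bar>u x\<bar> powr (q - 1)) \<partial>lebesgue) < \<infinity>) \<and>
     (\<integral>\<^sup>+ x. ennreal (\<bar>u x\<bar> powr (q - 1) * (1 + hnorm x) powr (- homdim TYPE('n) - s * p))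
        \<partial>lebesgue) < \<infinity>"

definition weak_solution :: "real \<Rightarrow> real \<Rightarrow> real \<Rightarrow> real \<Rightarrow> ('n::finite heis \<Rightarrow> 'n heis \<Rightarrow> real)
    \<Rightarrow> 'n heis set \<Rightarrow> ('n heis \<Rightarrow> real) \<Rightarrow> bool" where
  "weak_solution p q s t a \<Omega> u \<longleftrightarrow>
     admissible p q s t a \<Omega> u \<and>
     (\<forall>\<phi>. admissible p q s t a \<Omega> \<phi> \<and> (AE x in lebesgue. x \<notin> \<Omega> \<longrightarrow> \<phi> x = 0) \<longrightarrow>
        (\<integral> z. indicator (Cset \<Omega>) z *
            (Jpow p (u (fst z) - u (snd z)) * (\<phi> (fst z) - \<phi> (snd z))
               / hd (fst z) (snd z) powr (homdim TYPE('n) + s * p)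
             + a (fst z) (snd z) * Jpow q (u (fst z) - u (snd z)) * (\<phi> (fst z) - \<phi> (snd z))
               / hd (fst z) (snd z) powr (homdim TYPE('n) + t * q))
          \<partial>(lebesgue \<Otimes>\<^sub>M lebesgue)) = 0)"

definition locally_bounded_in :: "'n::finite heis set \<Rightarrow> ('n heis \<Rightarrow> real) \<Rightarrow> bool" where
  "locally_bounded_in \<Omega> u \<longleftrightarrow>
     (\<forall>K. compact K \<and> K \<subseteq> \<Omega> \<longrightarrow> (\<exists>M. AE x in lebesgue. x \<in> K \<longrightarrow> \<bar>u x\<bar> \<le> M))"

definition loc_holder_on :: "real \<Rightarrow> 'n::finite heis set \<Rightarrow> ('n heis \<Rightarrow> real) \<Rightarrow> bool" where
  "loc_holder_on \<beta> U v \<longleftrightarrow>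
     (\<forall>K. compact K \<and> K \<subseteq> U \<longrightarrow>
        (\<exists>C. \<forall>\<xi>\<in>K. \<forall>\<eta>\<in>K. \<bar>v \<xi> - v \<eta>\<bar> \<le> C * hd \<xi> \<eta> powr \<beta>))"

end

theory Submission
  imports Defs
begin

text \<open>
  The proof is a De Giorgi scheme in which the cross term of the nonlocal energy replaces both the
  Sobolev and the logarithmic estimate. Test the equation with the positive part of
  \<open>u - \<psi>\<close>, where \<open>\<psi>\<close> is a truncated cone around \<open>x\<^sub>0\<close> that dominates
  \<open>u\<close> outside a ball. The negative part of the integrand is controlled by the slope of
  \<open>\<psi>\<close> and by the tail of \<open>u\<close>; the positive part contains the interaction of
  \<open>{u > \<psi> + h}\<close> with \<open>{u \<le> \<psi> - h}\<close>. If \<open>{u > \<psi> - h}\<close> is small,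
  then most of a ball of comparable measure around each point of \<open>{u > \<psi> + h}\<close> lies in
  \<open>{u \<le> \<psi> - h}\<close>, and the singular kernel turns this into a superlinear decay of the
  measures of superlevel sets. The condition \<open>t q \<le> s p + \<alpha>\<close> makes the oscillation
  of the modulating coefficient on a ball an error absorbed by the \<open>p\<close>-phase, because
  \<open>u\<close> is bounded there. Since only the group norm, being a genuine left-invariant metric,
  and the volume \<open>c r\<^sup>Q\<close> of balls enter, the argument is carried out in a metric measure space.
\<close>

subsection \<open>Ahlfors regular spaces\<close>

text \<open>A cut-off function would leave powers of the excess in the loss; subtracting a cone does
  not: where the increments of \<open>u\<close> and of the positive part of
  \<open>u - \<psi>\<close> have opposite signs, both are bounded by the increment of
  \<open>\<psi>\<close>, so the loss is an explicit kernel integral over the superlevel set. The two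
  phases scale differently and neither can be discarded, so heights are compared through one gauge,
  \<open>phase_scale\<close>, whose coefficient is frozen at the centre; only its scaling between
  the powers \<open>p\<close> and \<open>q\<close> is used. Uniformity dictates the order of
  choices. The growth constant \<open>\<delta>\<close> and the ratio of radii depend on the
  numerical data alone, and the exponent comes after them. The tail of \<open>u\<close> far away is
  merely finite and is absorbed by shrinking the starting radius, which may depend on
  \<open>u\<close>. The tail at intermediate distances is bounded by the oscillation estimates
  already obtained on larger balls. Everything is known only almost everywhere, so the continuous
  object is a representative, recovered from oscillation bounds on countably many balls.\<close>

lemma term_le_suminf: "f k \<le> (\<Sum>k. f k)" for f :: "nat \<Rightarrow> ennreal"
  using sum_le_suminf[of f "{k}"] by simp

lemma ennreal_affine:
  "0 \<le> c \<Longrightarrow> 0 \<le> x \<Longrightarrow> 0 \<le> y \<Longrightarrow> ennreal c * ennreal x + ennreal c * ennreal y = ennreal (c * x + c * y)"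
  by (simp add: ennreal_mult ennreal_plus)

lemma nn_integral_affine:
  assumes [measurable]: "f \<in> borel_measurable N" "g \<in> borel_measurable N"
  shows "(\<integral>\<^sup>+ x. c * ennreal (f x) + c * ennreal (g x) \<partial>N)
    = c * (\<integral>\<^sup>+ x. ennreal (f x) \<partial>N) + c * (\<integral>\<^sup>+ x. ennreal (g x) \<partial>N)"
  by (simp add: nn_integral_add nn_integral_cmult)

text \<open>The exceptional pairs lie in the union of two null strips; this carries the a.e. bound
  of \<open>u\<close> under the double integral.\<close>

lemma AE_pair_fst_snd:
  assumes "sigma_finite_measure M" "AE x in M. P x"
  shows "AE z in M \<Otimes>\<^sub>M M. P (fst z) \<and> P (snd z)"
proof -
  interpret sigma_finite_measure M by fact
  obtain N where N: "{x \<in> space M. \<not> P x} \<subseteq> N" "N \<in> null_sets M"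
    using assms(2) by (auto elim!: AE_E simp: null_sets_def)
  have "N \<times> space M \<in> null_sets (M \<Otimes>\<^sub>M M)" "space M \<times> N \<in> null_sets (M \<Otimes>\<^sub>M M)"
    using N by (auto intro: times_in_null_sets1 times_in_null_sets2)
  then have "N \<times> space M \<union> space M \<times> N \<in> null_sets (M \<Otimes>\<^sub>M M)" by auto
  then show ?thesis
    by (rule AE_I') (use N in \<open>auto simp: space_pair_measure\<close>)
qed

text \<open>The exact power law for balls makes every kernel integral an explicit power of the
  radius. Joint measurability of the distance is an axiom because the sigma-algebra, later that of
  the Lebesgue sets, is not generated by the balls of \<open>d\<close>.\<close>

locale ahlfors_space = sigma_finite_measure \<mu> for \<mu> :: "'a measure" +
  fixes d :: "'a \<Rightarrow> 'a \<Rightarrow> real" and Q c :: real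
  assumes space_UNIV: "space \<mu> = UNIV"
    and measurable_dist: "(\<lambda>z. d (fst z) (snd z)) \<in> borel_measurable (\<mu> \<Otimes>\<^sub>M \<mu>)"
    and dist_nonneg: "0 \<le> d x y"
    and dist_refl: "d x x = 0"
    and dist_sym: "d x y = d y x"
    and dist_triangle: "d x z \<le> d x y + d y z"
    and Q_pos: "0 < Q" and c_pos: "0 < c"
    and emeasure_ball: "0 < r \<Longrightarrow> emeasure \<mu> {y. d x y < r} = ennreal (c * r powr Q)"
begin

sublocale pair: pair_sigma_finite \<mu> \<mu> ..

lemma measurable_dist2 [measurable (raw)]:
  assumes "f \<in> M \<rightarrow>\<^sub>M \<mu>" "g \<in> M \<rightarrow>\<^sub>M \<mu>"
  shows "(\<lambda>z. d (f z) (g z)) \<in> borel_measurable M"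
  using measurable_compose[OF measurable_Pair[OF assms] measurable_dist] by simp

lemma measurable_const_space [measurable]: "(\<lambda>_. x) \<in> M \<rightarrow>\<^sub>M \<mu>"
  by (simp add: space_UNIV)

lemma sets_Collect_mu:
  assumes "Measurable.pred \<mu> P" shows "{y. P y} \<in> sets \<mu>"
  using assms by (simp add: pred_def space_UNIV)

lemma ball_sets [measurable]: "{y. d x y < r} \<in> sets \<mu>"
  by (rule sets_Collect_mu) measurable

text \<open>The measure of the \<open>k\<close>-th ball cancels the exponent \<open>-Q\<close> and
  leaves a geometric series of ratio \<open>b powr \<gamma>\<close>. With \<open>b = 1/2\<close> it
  sums the dyadic shells around a singularity, with \<open>b = 2\<close> and a negative exponent the
  shells towards infinity.\<close>

lemma nn_integral_geometric_balls:
  assumes "0 < r" "0 < b" "0 \<le> K" "0 < N" "0 < b powr \<gamma>" "b powr \<gamma> < 1"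
  shows "(\<integral>\<^sup>+ y. (\<Sum>k::nat. ennreal (K * (r * b ^ k) powr (\<gamma> - Q))
      * indicator {y. d x y < N * r * b ^ k} y) \<partial>\<mu>)
    \<le> ennreal (K * c * N powr Q * (1 / (1 - b powr \<gamma>)) * r powr \<gamma>)"
proof -
  have "(\<integral>\<^sup>+ y. (\<Sum>k::nat. ennreal (K * (r * b ^ k) powr (\<gamma> - Q))
      * indicator {y. d x y < N * r * b ^ k} y) \<partial>\<mu>)
    = (\<Sum>k::nat. ennreal (K * (r * b ^ k) powr (\<gamma> - Q)) * emeasure \<mu> {y. d x y < N * r * b ^ k})"
    by (subst nn_integral_suminf) (auto simp: nn_integral_cmult_indicator)
  also have "\<dots> = (\<Sum>k::nat. ennreal (K * c * N powr Q * r powr \<gamma> * (b powr \<gamma>) ^ k))"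
  proof (rule suminf_cong)
    fix k :: nat
    have pos: "0 < r * b ^ k" using assms by simp
    have "K * (r * b ^ k) powr (\<gamma> - Q) * (c * (N * (r * b ^ k)) powr Q)
      = K * c * N powr Q * ((r * b ^ k) powr (\<gamma> - Q) * (r * b ^ k) powr Q)"
      using pos assms by (simp add: powr_mult)
    also have "(r * b ^ k) powr (\<gamma> - Q) * (r * b ^ k) powr Q = (r * b ^ k) powr \<gamma>"
      by (simp add: powr_add[symmetric])
    also have "\<dots> = r powr \<gamma> * (b powr \<gamma>) ^ k"
      using assms by (simp add: powr_mult powr_powr powr_realpow[symmetric] mult.commute)
    finally show "ennreal (K * (r * b ^ k) powr (\<gamma> - Q)) * emeasure \<mu> {y. d x y < N * r * b ^ k}
        = ennreal (K * c * N powr Q * r powr \<gamma> * (b powr \<gamma>) ^ k)"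
      using emeasure_ball[of "N * r * b ^ k" x] pos assms c_pos
      by (simp add: ennreal_mult[symmetric] mult.assoc)
  qed
  also have "\<dots> = ennreal (K * c * N powr Q * r powr \<gamma> * (1 / (1 - b powr \<gamma>)))"
    using assms c_pos by (intro suminf_ennreal_eq sums_mult geometric_sums) auto
  finally show ?thesis by (simp add: mult_ac)
qed

lemma kernel_near:
  assumes "0 < \<gamma>"
  obtains C where "0 \<le> C" "\<And>x r. 0 < r \<Longrightarrow>
    (\<integral>\<^sup>+ y. ennreal (d x y powr (\<gamma> - Q)) * indicator {y. d x y < r} y \<partial>\<mu>) \<le> ennreal (C * r powr \<gamma>)"
proof
  define b :: real where "b = 1/2"
  \<comment> \<open>The price for replacing the distance by the outer radius of its dyadic shell:
    \<open>2 powr (Q - \<gamma>)\<close> where the power decreases, nothing where it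
    increases.\<close>
  define K where "K = 2 powr Q"
  have b: "0 < b powr \<gamma>" "b powr \<gamma> < 1" using assms powr_less_one[of 2 "-\<gamma>"]
    by (auto simp: b_def powr_divide powr_minus_divide)
  show "0 \<le> K * c * 1 powr Q * (1 / (1 - b powr \<gamma>))"
    using b c_pos by (simp add: K_def)
  fix x r assume r: "(0::real) < r"
  have "(\<integral>\<^sup>+ y. ennreal (d x y powr (\<gamma> - Q)) * indicator {y. d x y < r} y \<partial>\<mu>)
    \<le> (\<integral>\<^sup>+ y. (\<Sum>k::nat. ennreal (K * (r * b ^ k) powr (\<gamma> - Q))
      * indicator {y. d x y < 1 * r * b ^ k} y) \<partial>\<mu>)"
  proof (intro nn_integral_mono)
    fix y
    show "ennreal (d x y powr (\<gamma> - Q)) * indicator {y. d x y < r} y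
      \<le> (\<Sum>k::nat. ennreal (K * (r * b ^ k) powr (\<gamma> - Q)) * indicator {y. d x y < 1 * r * b ^ k} y)"
    proof (cases "0 < d x y \<and> d x y < r")
      case False
      then show ?thesis using dist_nonneg[of x y] by (auto simp: indicator_def)
    next
      case True
      obtain n0 where n0: "b ^ n0 < d x y / r"
        using real_arch_pow_inv[of "d x y / r" b] True r by (auto simp: b_def)
      \<comment> \<open>\<open>n\<close> is positive because \<open>d x y < r\<close>; its
        predecessor \<open>k\<close> labels the shell
        \<open>r * b ^ (k + 1) \<le> d x y < r * b ^ k\<close>.\<close>
      define n where "n = (LEAST n. r * b ^ n \<le> d x y)"
      have n: "r * b ^ n \<le> d x y"
        unfolding n_def by (rule LeastI[of _ n0]) (use n0 r in \<open>simp add: field_simps\<close>)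
      have "n \<noteq> 0" using n True by (cases n) auto
      then obtain k where k: "n = Suc k" by (cases n) auto
      have dk: "d x y < r * b ^ k"
        using not_less_Least[of k "\<lambda>n. r * b ^ n \<le> d x y"] k by (auto simp: n_def)
      have pos: "0 < r * b ^ k" using r by (simp add: b_def)
      have lo: "r * b ^ k / 2 \<le> d x y" using n k by (simp add: b_def)
      have "d x y powr (\<gamma> - Q) \<le> K * (r * b ^ k) powr (\<gamma> - Q)"
      proof (cases "\<gamma> \<ge> Q")
        case True2: True
        have "d x y powr (\<gamma> - Q) \<le> (r * b ^ k) powr (\<gamma> - Q)"
          using dk True True2 by (intro powr_mono2) auto
        also have "\<dots> \<le> K * (r * b ^ k) powr (\<gamma> - Q)"
          using mult_right_mono[of 1 K "(r * b ^ k) powr (\<gamma> - Q)"] Q_pos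
          by (simp add: K_def ge_one_powr_ge_zero)
        finally show ?thesis .
      next
        case False2: False
        have "d x y powr (\<gamma> - Q) \<le> (r * b ^ k / 2) powr (\<gamma> - Q)"
          using lo pos False2 by (intro powr_mono2') auto
        also have "\<dots> = 2 powr (Q - \<gamma>) * (r * b ^ k) powr (\<gamma> - Q)"
          using pos powr_minus[of 2 "Q-\<gamma>"] by (simp add: powr_divide field_simps)
        also have "\<dots> \<le> K * (r * b ^ k) powr (\<gamma> - Q)"
          using assms unfolding K_def by (intro mult_right_mono powr_mono) auto
        finally show ?thesis .
      qed
      then have "ennreal (d x y powr (\<gamma> - Q)) * indicator {y. d x y < r} y
        \<le> ennreal (K * (r * b ^ k) powr (\<gamma> - Q)) * indicator {y. d x y < 1 * r * b ^ k} y"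
        using True dk by (simp add: ennreal_leI)
      also have "\<dots> \<le> (\<Sum>k::nat. ennreal (K * (r * b ^ k) powr (\<gamma> - Q)) * indicator {y. d x y < 1 * r * b ^ k} y)"
        by (rule term_le_suminf[where k=k])
      finally show ?thesis .
    qed
  qed
  also have "\<dots> \<le> ennreal (K * c * 1 powr Q * (1 / (1 - b powr \<gamma>)) * r powr \<gamma>)"
    using nn_integral_geometric_balls[of r b K 1 \<gamma> x] r b by (simp add: b_def K_def)
  finally show "(\<integral>\<^sup>+ y. ennreal (d x y powr (\<gamma> - Q)) * indicator {y. d x y < r} y \<partial>\<mu>)
    \<le> ennreal (K * c * 1 powr Q * (1 / (1 - b powr \<gamma>)) * r powr \<gamma>)" .
qed

lemma kernel_far:
  assumes "0 < \<gamma>"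
  obtains C where "0 \<le> C" "\<And>x r. 0 < r \<Longrightarrow>
    (\<integral>\<^sup>+ y. ennreal (d x y powr (- (Q + \<gamma>))) * indicator {y. r \<le> d x y} y \<partial>\<mu>) \<le> ennreal (C * r powr (- \<gamma>))"
proof
  define b :: real where "b = 2"
  have b: "0 < b powr (-\<gamma>)" "b powr (-\<gamma>) < 1" using assms
    by (auto simp: b_def powr_less_one)
  show "0 \<le> 1 * c * 2 powr Q * (1 / (1 - b powr (-\<gamma>)))"
    using b c_pos by simp
  fix x r assume r: "(0::real) < r"
  have "(\<integral>\<^sup>+ y. ennreal (d x y powr (- (Q + \<gamma>))) * indicator {y. r \<le> d x y} y \<partial>\<mu>)
    \<le> (\<integral>\<^sup>+ y. (\<Sum>k::nat. ennreal (1 * (r * b ^ k) powr (-\<gamma> - Q))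
      * indicator {y. d x y < 2 * r * b ^ k} y) \<partial>\<mu>)"
  proof (intro nn_integral_mono)
    fix y
    show "ennreal (d x y powr (- (Q + \<gamma>))) * indicator {y. r \<le> d x y} y
      \<le> (\<Sum>k::nat. ennreal (1 * (r * b ^ k) powr (-\<gamma> - Q)) * indicator {y. d x y < 2 * r * b ^ k} y)"
    proof (cases "r \<le> d x y")
      case False
      then show ?thesis by (auto simp: indicator_def)
    next
      case True
      obtain n0 where n0: "d x y / r < b ^ n0"
        using real_arch_pow[of b "d x y / r"] by (auto simp: b_def)
      define n where "n = (LEAST n. d x y < r * b ^ n)"
      have n: "d x y < r * b ^ n"
        unfolding n_def by (rule LeastI[of _ n0]) (use n0 r in \<open>simp add: field_simps\<close>)
      have "n \<noteq> 0" using n True by (cases n) auto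
      then obtain k where k: "n = Suc k" by (cases n) auto
      have dk: "r * b ^ k \<le> d x y"
        using not_less_Least[of k "\<lambda>n. d x y < r * b ^ n"] k by (auto simp: n_def)
      have pos: "0 < r * b ^ k" using r by (simp add: b_def)
      have up: "d x y < 2 * r * b ^ k" using n k by (simp add: b_def)
      have "d x y powr (- (Q + \<gamma>)) \<le> (r * b ^ k) powr (- \<gamma> - Q)"
        unfolding minus_add_distrib diff_conv_add_uminus add.commute[of "-Q"]
        using dk pos assms Q_pos by (intro powr_mono2') auto
      then have "ennreal (d x y powr (- (Q + \<gamma>))) * indicator {y. r \<le> d x y} y
        \<le> ennreal (1 * (r * b ^ k) powr (-\<gamma> - Q)) * indicator {y. d x y < 2 * r * b ^ k} y"
        using True up by (simp add: ennreal_leI)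
      also have "\<dots> \<le> (\<Sum>k::nat. ennreal (1 * (r * b ^ k) powr (-\<gamma> - Q)) * indicator {y. d x y < 2 * r * b ^ k} y)"
        by (rule term_le_suminf[where k=k])
      finally show ?thesis .
    qed
  qed
  also have "\<dots> \<le> ennreal (1 * c * 2 powr Q * (1 / (1 - b powr (-\<gamma>))) * r powr (-\<gamma>))"
    using nn_integral_geometric_balls[of r b 1 2 "-\<gamma>" x] r b by (simp add: b_def)
  finally show "(\<integral>\<^sup>+ y. ennreal (d x y powr (- (Q + \<gamma>))) * indicator {y. r \<le> d x y} y \<partial>\<mu>)
    \<le> ennreal (1 * c * 2 powr Q * (1 / (1 - b powr (-\<gamma>))) * r powr (-\<gamma>))" .
qed

text \<open>The truncated distance is the slope of the cone-shaped barrier; the singularity is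
  integrable because \<open>\<sigma> < 1\<close>.\<close>

lemma kernel_truncated:
  assumes "0 < \<sigma>" "\<sigma> < 1" "0 < l"
  obtains C where "0 \<le> C" "\<And>x r. 0 < r \<Longrightarrow>
    (\<integral>\<^sup>+ y. ennreal (min (d x y / r) 1 powr l * d x y powr (- (Q + \<sigma> * l))) \<partial>\<mu>)
      \<le> ennreal (C * r powr (- (\<sigma> * l)))"
proof -
  have g: "0 < l - \<sigma> * l" "0 < \<sigma> * l" using assms by auto
  from kernel_near[OF g(1)] obtain C1 where C1: "0 \<le> C1" "\<And>x r. 0 < r \<Longrightarrow>
    (\<integral>\<^sup>+ y. ennreal (d x y powr (l - \<sigma> * l - Q)) * indicator {y. d x y < r} y \<partial>\<mu>) \<le> ennreal (C1 * r powr (l - \<sigma> * l))"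
    by blast
  from kernel_far[OF g(2)] obtain C2 where C2: "0 \<le> C2" "\<And>x r. 0 < r \<Longrightarrow>
    (\<integral>\<^sup>+ y. ennreal (d x y powr (- (Q + \<sigma> * l))) * indicator {y. r \<le> d x y} y \<partial>\<mu>) \<le> ennreal (C2 * r powr (- (\<sigma> * l)))"
    by blast
  show ?thesis
  proof
    show "0 \<le> C1 + C2" using C1 C2 by simp
    fix x r assume r: "(0::real) < r"
    have "(\<integral>\<^sup>+ y. ennreal (min (d x y / r) 1 powr l * d x y powr (- (Q + \<sigma> * l))) \<partial>\<mu>)
      \<le> (\<integral>\<^sup>+ y. ennreal (r powr (-l)) * (ennreal (d x y powr (l - \<sigma> * l - Q)) * indicator {y. d x y < r} y)
          + ennreal (d x y powr (- (Q + \<sigma> * l))) * indicator {y. r \<le> d x y} y \<partial>\<mu>)"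
    proof (intro nn_integral_mono)
      fix y
      show "ennreal (min (d x y / r) 1 powr l * d x y powr (- (Q + \<sigma> * l)))
        \<le> ennreal (r powr (-l)) * (ennreal (d x y powr (l - \<sigma> * l - Q)) * indicator {y. d x y < r} y)
          + ennreal (d x y powr (- (Q + \<sigma> * l))) * indicator {y. r \<le> d x y} y"
      proof (cases "d x y < r")
        case True
        have "(d x y / r) powr l * d x y powr (- (Q + \<sigma> * l)) = r powr (-l) * (d x y powr l * d x y powr (- (Q + \<sigma> * l)))"
          using dist_nonneg[of x y] r by (simp add: powr_divide powr_minus field_simps)
        also have "d x y powr l * d x y powr (- (Q + \<sigma> * l)) = d x y powr (l - \<sigma> * l - Q)"
          by (simp add: powr_add[symmetric] algebra_simps)
        finally show ?thesis using True r by (simp add: min_def field_simps ennreal_mult[symmetric])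
      next
        case False
        then show ?thesis using r by (simp add: min_def field_simps)
      qed
    qed
    also have "\<dots> = ennreal (r powr (-l)) * (\<integral>\<^sup>+ y. ennreal (d x y powr (l - \<sigma> * l - Q)) * indicator {y. d x y < r} y \<partial>\<mu>)
       + (\<integral>\<^sup>+ y. ennreal (d x y powr (- (Q + \<sigma> * l))) * indicator {y. r \<le> d x y} y \<partial>\<mu>)"
      by (subst nn_integral_add) (auto simp: nn_integral_cmult space_UNIV intro!: sets_Collect_mu)
    also have "\<dots> \<le> ennreal (r powr (-l)) * ennreal (C1 * r powr (l - \<sigma> * l)) + ennreal (C2 * r powr (- (\<sigma> * l)))"
      using C1(2)[OF r] C2(2)[OF r] by (intro add_mono mult_left_mono) auto
    also have "\<dots> = ennreal (C1 * (r powr (-l) * r powr (l - \<sigma> * l)) + C2 * r powr (- (\<sigma> * l)))"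
      using C1 C2 by (simp add: ennreal_mult[symmetric] ennreal_plus[symmetric] mult_ac del: ennreal_plus)
    also have "r powr (-l) * r powr (l - \<sigma> * l) = r powr (- (\<sigma> * l))"
      by (simp add: powr_add[symmetric])
    finally show "(\<integral>\<^sup>+ y. ennreal (min (d x y / r) 1 powr l * d x y powr (- (Q + \<sigma> * l))) \<partial>\<mu>)
      \<le> ennreal ((C1 + C2) * r powr (- (\<sigma> * l)))" by (simp add: algebra_simps)
  qed
qed

section \<open>Double integrals and null sets\<close>

lemma nn_integral_pair:
  assumes "(\<lambda>z. f (fst z) (snd z)) \<in> borel_measurable (\<mu> \<Otimes>\<^sub>M \<mu>)"
  shows "(\<integral>\<^sup>+ z. f (fst z) (snd z) \<partial>(\<mu> \<Otimes>\<^sub>M \<mu>)) = (\<integral>\<^sup>+ x. \<integral>\<^sup>+ y. f x y \<partial>\<mu> \<partial>\<mu>)"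
  using nn_integral_fst[OF assms] by simp

lemma nn_integral_pair_swap:
  assumes "(\<lambda>z. f (fst z) (snd z)) \<in> borel_measurable (\<mu> \<Otimes>\<^sub>M \<mu>)"
  shows "(\<integral>\<^sup>+ z. f (snd z) (fst z) \<partial>(\<mu> \<Otimes>\<^sub>M \<mu>)) = (\<integral>\<^sup>+ x. \<integral>\<^sup>+ y. f x y \<partial>\<mu> \<partial>\<mu>)"
proof -
  have "(\<lambda>z. f (snd z) (fst z)) \<in> borel_measurable (\<mu> \<Otimes>\<^sub>M \<mu>)"
    using measurable_compose[OF measurable_Pair[OF measurable_snd measurable_fst] assms] by simp
  then show ?thesis using pair.nn_integral_snd[of "\<lambda>z. f (snd z) (fst z)"] by simp
qed

lemma nn_integral_indicator_fst_le:
  assumes meas: "(\<lambda>z. f (fst z) (snd z)) \<in> borel_measurable (\<mu> \<Otimes>\<^sub>M \<mu>)"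
    and f: "\<And>x y. 0 \<le> f x y" and B: "B \<in> sets \<mu>"
    and le: "\<And>x. x \<in> B \<Longrightarrow> (\<integral>\<^sup>+ y. ennreal (f x y) \<partial>\<mu>) \<le> E"
  shows "(\<integral>\<^sup>+ x. \<integral>\<^sup>+ y. ennreal (indicator B x * f x y) \<partial>\<mu> \<partial>\<mu>) \<le> E * emeasure \<mu> B"
proof -
  have "(\<integral>\<^sup>+ x. \<integral>\<^sup>+ y. ennreal (indicator B x * f x y) \<partial>\<mu> \<partial>\<mu>) \<le> (\<integral>\<^sup>+ x. E * indicator B x \<partial>\<mu>)"
  proof (intro nn_integral_mono)
    fix x
    show "(\<integral>\<^sup>+ y. ennreal (indicator B x * f x y) \<partial>\<mu>) \<le> E * indicator B x"
      using le[of x] by (cases "x \<in> B") auto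
  qed
  also have "\<dots> = E * emeasure \<mu> B" using B by (simp add: nn_integral_cmult_indicator)
  finally show ?thesis .
qed

text \<open>A point lies in balls of arbitrarily small measure. Since \<open>0 powr x = 0\<close>,
  the kernels vanish on the diagonal instead of being infinite, so their lower bounds hold only off
  it; the lemma makes the diagonal negligible.\<close>

lemma null_point: "AE y in \<mu>. 0 < d x y"
proof -
  have le: "emeasure \<mu> {y. d x y \<le> 0} \<le> ennreal (c * e powr Q)" if "0 < e" for e
    unfolding emeasure_ball[OF that, of x, symmetric]
    by (rule emeasure_mono) (use that in auto)
  have "emeasure \<mu> {y. d x y \<le> 0} \<le> ennreal e" if e: "0 < e" for e
  proof -
    have "c * (((e / c) powr (1 / Q)) powr Q) = e"
      using e c_pos Q_pos by (simp add: powr_powr)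
    then show ?thesis using le[of "(e / c) powr (1 / Q)"] e c_pos by simp
  qed
  then have "emeasure \<mu> {y. d x y \<le> 0} = 0"
    using ennreal_le_epsilon[of 0 "emeasure \<mu> {y. d x y \<le> 0}"] by simp
  moreover have "{y. d x y \<le> 0} \<in> sets \<mu>" by (rule sets_Collect_mu) measurable
  ultimately have "{y. d x y \<le> 0} \<in> null_sets \<mu>" by auto
  then show ?thesis by (rule AE_I') auto
qed

text \<open>\<open>ennreal\<close> truncates negative values, so the integral is that of the
  positive part and may be restricted to pairs in \<open>X \<times> Y\<close> at distance below
  \<open>\<rho>\<close>, where integrating in \<open>y\<close> and then in \<open>x\<close> gives
  the product bound.\<close>

lemma cross_integral_ge:
  assumes meas: "(\<lambda>z. f (fst z) (snd z)) \<in> borel_measurable (\<mu> \<Otimes>\<^sub>M \<mu>)"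
    and X: "X \<in> sets \<mu>" and Y: "Y \<in> sets \<mu>"
    and f: "\<And>x y. x \<in> X \<Longrightarrow> y \<in> Y \<Longrightarrow> 0 < d x y \<Longrightarrow> d x y < \<rho> \<Longrightarrow> \<Theta> \<le> f x y"
    and \<nu>: "\<And>x. x \<in> X \<Longrightarrow> \<nu> \<le> emeasure \<mu> (Y \<inter> {y. d x y < \<rho>})"
  shows "ennreal \<Theta> * \<nu> * emeasure \<mu> X \<le> (\<integral>\<^sup>+ z. ennreal (f (fst z) (snd z)) \<partial>(\<mu> \<Otimes>\<^sub>M \<mu>))"
proof -
  have "ennreal \<Theta> * \<nu> * emeasure \<mu> X = (\<integral>\<^sup>+ x. ennreal \<Theta> * \<nu> * indicator X x \<partial>\<mu>)"
    using X by (simp add: nn_integral_cmult_indicator)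
  also have "\<dots> \<le> (\<integral>\<^sup>+ x. \<integral>\<^sup>+ y. ennreal (f x y) \<partial>\<mu> \<partial>\<mu>)"
  proof (rule nn_integral_mono)
    fix x
    show "ennreal \<Theta> * \<nu> * indicator X x \<le> (\<integral>\<^sup>+ y. ennreal (f x y) \<partial>\<mu>)"
    proof (cases "x \<in> X")
      case True
      have "ennreal \<Theta> * \<nu> \<le> ennreal \<Theta> * emeasure \<mu> (Y \<inter> {y. d x y < \<rho>})"
        using \<nu>[OF True] by (intro mult_left_mono) auto
      also have "\<dots> = (\<integral>\<^sup>+ y. ennreal \<Theta> * indicator (Y \<inter> {y. d x y < \<rho>}) y \<partial>\<mu>)"
        using Y by (subst nn_integral_cmult_indicator) auto
      also have "\<dots> \<le> (\<integral>\<^sup>+ y. ennreal (f x y) \<partial>\<mu>)"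
      proof (rule nn_integral_mono_AE, use null_point[of x] in \<open>rule AE_mp, intro AE_I2 impI\<close>)
        fix y assume "0 < d x y"
        then show "ennreal \<Theta> * indicator (Y \<inter> {y. d x y < \<rho>}) y \<le> ennreal (f x y)"
          using f[OF True, of y] by (auto simp: indicator_def ennreal_leI)
      qed
      finally show ?thesis using True by simp
    qed simp
  qed
  also have "\<dots> = (\<integral>\<^sup>+ z. ennreal (f (fst z) (snd z)) \<partial>(\<mu> \<Otimes>\<^sub>M \<mu>))"
    using meas by (subst nn_integral_pair) auto
  finally show ?thesis .
qed

lemma full_measure_meets_ball:
  assumes "AE y in \<mu>. P y" "0 < e"
  obtains y where "P y" "d x y < e"
proof -
  have "\<exists>y. P y \<and> d x y < e"
  proof (rule ccontr)
    assume neg: "\<not> ?thesis"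
    from assms(1) have "AE y in \<mu>. y \<notin> {y. d x y < e}" by eventually_elim (use neg in auto)
    then have "{y. d x y < e} \<in> null_sets \<mu>" by (subst (asm) AE_iff_null) (auto simp: space_UNIV)
    then show False using emeasure_ball[OF assms(2), of x] c_pos assms(2) by (auto simp: null_sets_def)
  qed
  then show thesis using that by blast
qed

text \<open>Campanato's argument: the oscillation bounds for centres in the dense set
  \<open>Z\<close> and rational radii hold simultaneously off one null set, and any two nearby
  points share such a ball of comparable radius. This gives a Hoelder bound on a set of full
  measure, and \<open>v\<close> is the limit along that set. Passing from \<open>K n\<close> to a
  larger \<open>K m\<close> leaves room for the centre \<open>z\<close> and for the approximating
  points.\<close>

lemma holder_representative:
  fixes u :: "'a \<Rightarrow> real" and K :: "nat \<Rightarrow> 'a set"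
  assumes Z: "countable Z" "\<And>x e. 0 < e \<Longrightarrow> \<exists>z\<in>Z. d x z < e"
    and separated: "\<And>x y. d x y = 0 \<Longrightarrow> x = y"
    and \<beta>: "0 < \<beta>"
    and osc: "\<And>n. \<exists>C R0. 0 < C \<and> 0 < R0 \<and> (\<forall>x0 r. x0 \<in> K n \<and> 0 < r \<and> r \<le> R0 \<longrightarrow>
      (\<exists>S. AE y in \<mu>. d x0 y < r \<longrightarrow> \<bar>u y - S\<bar> \<le> C * r powr \<beta>))"
    and K: "\<And>n. \<exists>m e. 0 < e \<and> (\<forall>x y. x \<in> K n \<and> d x y < e \<longrightarrow> y \<in> K m)"
    and bound: "AE y in \<mu>. y \<in> (\<Union>n. K n) \<longrightarrow> \<bar>u y\<bar> \<le> M" and M: "0 \<le> M"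
  obtains v where "AE x in \<mu>. x \<in> (\<Union>n. K n) \<longrightarrow> v x = u x"
    "\<And>n. \<exists>C. \<forall>x\<in>K n. \<forall>y\<in>K n. \<bar>v x - v y\<bar> \<le> C * d x y powr \<beta>"
proof -
  have "\<forall>n. \<exists>c. 0 < fst c \<and> 0 < snd c \<and> (\<forall>x0 r. x0 \<in> K n \<and> 0 < r \<and> r \<le> snd c \<longrightarrow>
      (\<exists>S. AE y in \<mu>. d x0 y < r \<longrightarrow> \<bar>u y - S\<bar> \<le> fst c * r powr \<beta>))"
  proof
    fix n
    obtain C R0 where "0 < C \<and> 0 < R0 \<and> (\<forall>x0 r. x0 \<in> K n \<and> 0 < r \<and> r \<le> R0 \<longrightarrow>
      (\<exists>S. AE y in \<mu>. d x0 y < r \<longrightarrow> \<bar>u y - S\<bar> \<le> C * r powr \<beta>))"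
      using osc[of n] by (elim exE)
    then show "\<exists>c. 0 < fst c \<and> 0 < snd c \<and> (\<forall>x0 r. x0 \<in> K n \<and> 0 < r \<and> r \<le> snd c \<longrightarrow>
      (\<exists>S. AE y in \<mu>. d x0 y < r \<longrightarrow> \<bar>u y - S\<bar> \<le> fst c * r powr \<beta>))"
      by (intro exI[of _ "(C, R0)"]) simp
  qed
  from choice[OF this] obtain cc where cc: "\<forall>n. 0 < fst (cc n) \<and> 0 < snd (cc n) \<and> (\<forall>x0 r. x0 \<in> K n \<and> 0 < r \<and> r \<le> snd (cc n) \<longrightarrow>
      (\<exists>S. AE y in \<mu>. d x0 y < r \<longrightarrow> \<bar>u y - S\<bar> \<le> fst (cc n) * r powr \<beta>))" ..
  define C where "C n = fst (cc n)" for n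
  define R0 where "R0 n = snd (cc n)" for n
  have C: "0 < C n" and R0: "0 < R0 n" for n using cc by (auto simp: C_def R0_def)
  define S where "S n x0 r = (SOME S. AE y in \<mu>. d x0 y < r \<longrightarrow> \<bar>u y - S\<bar> \<le> C n * r powr \<beta>)" for n x0 r
  have S: "AE y in \<mu>. d x0 y < r \<longrightarrow> \<bar>u y - S n x0 r\<bar> \<le> C n * r powr \<beta>"
    if "x0 \<in> K n" "0 < r" "r \<le> R0 n" for n x0 r
    unfolding S_def using cc that by (intro someI_ex[of "\<lambda>S. AE y in \<mu>. d x0 y < r \<longrightarrow> \<bar>u y - S\<bar> \<le> C n * r powr \<beta>"])
      (simp add: C_def R0_def)
  have "\<forall>n. \<exists>c. 0 < snd c \<and> (\<forall>x y. x \<in> K n \<and> d x y < snd c \<longrightarrow> y \<in> K (fst c))"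
    using K by auto
  from choice[OF this] obtain kk where kk: "\<forall>n. 0 < snd (kk n) \<and> (\<forall>x y. x \<in> K n \<and> d x y < snd (kk n) \<longrightarrow> y \<in> K (fst (kk n)))" ..
  define mm where "mm n = fst (kk n)" for n
  define ee where "ee n = snd (kk n)" for n
  have ee: "0 < ee n" for n using kk by (simp add: ee_def)
  have mm: "y \<in> K (mm n)" if "x \<in> K n" "d x y < ee n" for n x y
    using kk that unfolding ee_def mm_def by blast
  \<comment> \<open>Quantifying over \<open>Z\<close> and the rationals only makes this a countable
    intersection of conditions of full measure.\<close>
  define D where "D x \<longleftrightarrow> (\<forall>n. \<forall>z\<in>Z. \<forall>r\<in>(\<rat> :: real set). z \<in> K n \<and> 0 < r \<and> r \<le> R0 n \<and> d z x < r \<longrightarrow> \<bar>u x - S n z r\<bar> \<le> C n * r powr \<beta>)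
     \<and> (x \<in> (\<Union>n. K n) \<longrightarrow> \<bar>u x\<bar> \<le> M)" for x
  have AED: "AE x in \<mu>. D x"
  proof -
    have "AE x in \<mu>. \<forall>n. \<forall>z\<in>Z. \<forall>r\<in>(\<rat> :: real set). z \<in> K n \<and> 0 < r \<and> r \<le> R0 n \<and> d z x < r \<longrightarrow> \<bar>u x - S n z r\<bar> \<le> C n * r powr \<beta>"
    proof (subst AE_all_countable, intro allI, subst AE_ball_countable[OF Z(1)], intro ballI,
        subst AE_ball_countable[OF countable_rat], intro ballI)
      fix n z and r :: real assume "z \<in> Z" "r \<in> \<rat>"
      show "AE x in \<mu>. z \<in> K n \<and> 0 < r \<and> r \<le> R0 n \<and> d z x < r \<longrightarrow> \<bar>u x - S n z r\<bar> \<le> C n * r powr \<beta>"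
      proof (cases "z \<in> K n \<and> 0 < r \<and> r \<le> R0 n")
        case True
        then have "AE y in \<mu>. d z y < r \<longrightarrow> \<bar>u y - S n z r\<bar> \<le> C n * r powr \<beta>" using S by blast
        then show ?thesis by eventually_elim blast
      next
        case False
        then show ?thesis by (intro AE_I2) blast
      qed
    qed
    then show ?thesis unfolding D_def using bound by eventually_elim blast
  qed
  define \<epsilon> where "\<epsilon> n = min (ee n) (R0 (mm n) / 3)" for n
  have \<epsilon>: "0 < \<epsilon> n" for n using ee R0 by (simp add: \<epsilon>_def)
  define C' where "C' n = 2 * C (mm n) * 3 powr \<beta>" for n
  have C': "0 < C' n" for n using C by (simp add: C'_def)
  have holder_D: "\<bar>u x - u y\<bar> \<le> C' n * d x y powr \<beta>" if "D x" "D y" "x \<in> K n" "d x y < \<epsilon> n" for x y n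
  proof (cases "d x y = 0")
    case True
    then have "x = y" by (rule separated)
    then show ?thesis using C'[of n] by simp
  next
    case False
    define h where "h = d x y"
    have h: "0 < h" using False dist_nonneg[of x y] by (simp add: h_def)
    have he: "h < ee n" "3 * h < R0 (mm n)" using that(4) by (auto simp: \<epsilon>_def h_def)
    \<comment> \<open>With \<open>d x z < h\<close> and \<open>2 * h < r < 3 * h\<close>, the ball
      of radius \<open>r\<close> about \<open>z\<close> contains both points while \<open>r\<close>
      stays comparable to \<open>h\<close>.\<close>
    obtain z where z: "z \<in> Z" "d x z < h" using Z(2)[OF h] by blast
    have zK: "z \<in> K (mm n)" by (rule mm[OF that(3)]) (use z he in linarith)
    obtain r where r: "r \<in> \<rat>" "2 * h < r" "r < 3 * h" using Rats_dense_in_real[of "2 * h" "3 * h"] h by auto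
    have zx: "d z x < r" using z(2) r h dist_sym[of x z] by simp
    have zy: "d z y < r" using dist_triangle[of z y x] z(2) r dist_sym[of x z] by (simp add: h_def)
    have r': "0 < r" "r \<le> R0 (mm n)" using r h he by auto
    have Dw: "\<bar>u w - S (mm n) z r\<bar> \<le> C (mm n) * r powr \<beta>" if "D w" "d z w < r" for w
      using that(1)[unfolded D_def, THEN conjunct1, rule_format, OF z(1) r(1)] zK r' that(2) by blast
    have "\<bar>u x - S (mm n) z r\<bar> \<le> C (mm n) * r powr \<beta>" "\<bar>u y - S (mm n) z r\<bar> \<le> C (mm n) * r powr \<beta>"
      using Dw[OF that(1) zx] Dw[OF that(2) zy] by auto
    then have "\<bar>u x - u y\<bar> \<le> 2 * C (mm n) * r powr \<beta>" by linarith
    also have "\<dots> \<le> 2 * C (mm n) * (3 * h) powr \<beta>"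
      using C[of "mm n"] r r' \<beta> by (intro mult_left_mono powr_mono2) auto
    also have "\<dots> = C' n * d x y powr \<beta>" using h by (simp add: C'_def h_def powr_mult)
    finally show ?thesis .
  qed
  \<comment> \<open>The approximating sequence is constant at points of \<open>D\<close>, so that
    the limit reproduces \<open>u\<close> there.\<close>
  have "\<forall>x k. \<exists>y. D y \<and> d x y < 1 / (real k + 1) \<and> (D x \<longrightarrow> y = x)"
  proof (intro allI)
    fix x and k :: nat
    show "\<exists>y. D y \<and> d x y < 1 / (real k + 1) \<and> (D x \<longrightarrow> y = x)"
    proof (cases "D x")
      case True
      then show ?thesis by (intro exI[of _ x]) (auto simp: dist_refl)
    next
      case False
      have e: "0 < 1 / (real k + 1)" by simp
      obtain y where "D y" "d x y < 1 / (real k + 1)" by (rule full_measure_meets_ball[OF AED e])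
      then show ?thesis using False by blast
    qed
  qed
  then have ex: "\<exists>y. D y \<and> d x y < 1 / (real k + 1) \<and> (D x \<longrightarrow> y = x)" for x and k :: nat by blast
  define f where "f x k = (SOME y. D y \<and> d x y < 1 / (real k + 1) \<and> (D x \<longrightarrow> y = x))" for x k
  have f: "D (f x k)" "d x (f x k) < 1 / (real k + 1)" "D x \<Longrightarrow> f x k = x" for x k
    using someI_ex[OF ex[of x k]] by (auto simp: f_def)
  define v where "v x = lim (\<lambda>k. u (f x k))" for x
  have lim0: "(\<lambda>k. 1 / (real k + 1)) \<longlonglongrightarrow> 0" 
    using LIMSEQ_inverse_real_of_nat by (simp add: inverse_eq_divide add.commute)
  have evK: "\<forall>\<^sub>F k in sequentially. f x k \<in> K (mm n)" if "x \<in> K n" for x n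
    using order_tendstoD(2)[OF lim0 ee[of n]]
  proof eventually_elim
    case (elim k)
    then show ?case using mm[OF that, of "f x k"] f(2)[of x k] by simp
  qed
  have conv: "(\<lambda>k. u (f x k)) \<longlonglongrightarrow> v x" if x: "x \<in> K n" for x n
  proof -
    have "Cauchy (\<lambda>k. u (f x k))"
      unfolding Cauchy_def dist_real_def
    proof (intro allI impI)
      fix e :: real assume e: "0 < e"
      have "(\<lambda>k. C' (mm n) * (2 * (1 / (real k + 1))) powr \<beta>) \<longlonglongrightarrow> C' (mm n) * 0"
        using \<beta> tendsto_mult_left[OF lim0, of 2]
        by (intro tendsto_mult_left tendsto_zero_powrI[OF _ tendsto_const]) auto
      then have "\<forall>\<^sub>F k in sequentially. C' (mm n) * (2 * (1 / (real k + 1))) powr \<beta> < e"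
        using e order_tendstoD(2)[of _ 0 _ e] by simp
      moreover have "\<forall>\<^sub>F k in sequentially. 1 / (real k + 1) < \<epsilon> (mm n) / 2"
        using order_tendstoD(2)[OF lim0, of "\<epsilon> (mm n) / 2"] \<epsilon> by simp
      moreover note evK[OF x]
      ultimately have "\<forall>\<^sub>F k in sequentially. C' (mm n) * (2 * (1 / (real k + 1))) powr \<beta> < e
          \<and> 1 / (real k + 1) < \<epsilon> (mm n) / 2 \<and> f x k \<in> K (mm n)"
        by eventually_elim blast
      then obtain N where N: "\<And>k. k \<ge> N \<Longrightarrow> f x k \<in> K (mm n)"
        "C' (mm n) * (2 * (1 / (real N + 1))) powr \<beta> < e" "1 / (real N + 1) < \<epsilon> (mm n) / 2"
        unfolding eventually_sequentially by blast
      show "\<exists>N. \<forall>k\<ge>N. \<forall>l\<ge>N. \<bar>u (f x k) - u (f x l)\<bar> < e"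
      proof (intro exI[of _ N] allI impI)
        fix k l assume kl: "N \<le> k" "N \<le> l"
        have near: "d x (f x k) < 1 / (real N + 1)" if "N \<le> k" for k
        proof -
          have "1 / (real k + 1) \<le> 1 / (real N + 1)" using that by (intro divide_left_mono) auto
          then show ?thesis using f(2)[of x k] by linarith
        qed
        have dd: "d (f x k) (f x l) \<le> 2 * (1 / (real N + 1))"
          using dist_triangle[of "f x k" "f x l" x] near[OF kl(1)] near[OF kl(2)] dist_sym[of x "f x k"] by simp
        then have "\<bar>u (f x k) - u (f x l)\<bar> \<le> C' (mm n) * d (f x k) (f x l) powr \<beta>"
          using N(3) by (intro holder_D f(1) N(1) kl) linarith
        also have "\<dots> \<le> C' (mm n) * (2 * (1 / (real N + 1))) powr \<beta>"
          using dd C'[of "mm n"] \<beta> dist_nonneg by (intro mult_left_mono powr_mono2) auto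
        finally show "\<bar>u (f x k) - u (f x l)\<bar> < e" using N(2) by linarith
      qed
    qed
    then show ?thesis unfolding v_def by (simp add: Cauchy_convergent_iff convergent_LIMSEQ_iff)
  qed
  have vD: "v x = u x" if "D x" for x using f(3)[OF that] by (simp add: v_def)
  show thesis
  proof
    show "AE x in \<mu>. x \<in> (\<Union>n. K n) \<longrightarrow> v x = u x" using AED by eventually_elim (simp add: vD)
    fix n
    define \<rho> where "\<rho> = \<epsilon> (mm n)"
    have \<rho>: "0 < \<rho>" using \<epsilon> by (simp add: \<rho>_def)
    have v_bd: "\<bar>v x\<bar> \<le> M" if x: "x \<in> K n" for x
    proof (rule tendsto_upperbound[OF tendsto_rabs[OF conv[OF x]]])
      show "\<forall>\<^sub>F k in sequentially. \<bar>u (f x k)\<bar> \<le> M"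
        using evK[OF x]
      proof eventually_elim
        case (elim k)
        then show ?case using f(1)[of x k] unfolding D_def by blast
      qed
    qed simp
    have v_near: "\<bar>v x - v y\<bar> \<le> C' (mm n) * d x y powr \<beta>" if x: "x \<in> K n" and y: "y \<in> K n" and xy: "d x y < \<rho>" for x y
    proof -
      have lim2: "(\<lambda>k. d x y + 2 * (1 / (real k + 1))) \<longlonglongrightarrow> d x y"
        using tendsto_add[OF tendsto_const tendsto_mult_left[OF lim0, of 2], of "d x y"] by simp
      have rhs: "(\<lambda>k. C' (mm n) * (d x y + 2 * (1 / (real k + 1))) powr \<beta>) \<longlonglongrightarrow> C' (mm n) * d x y powr \<beta>"
        using \<beta> dist_nonneg[of x y]
        by (intro tendsto_mult_left tendsto_powr'[OF lim2 tendsto_const]) (auto intro!: always_eventually)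
      have lhs: "(\<lambda>k. \<bar>u (f x k) - u (f y k)\<bar>) \<longlonglongrightarrow> \<bar>v x - v y\<bar>"
        by (intro tendsto_rabs tendsto_diff conv[OF x] conv[OF y])
      have "\<forall>\<^sub>F k in sequentially. \<bar>u (f x k) - u (f y k)\<bar> \<le> C' (mm n) * (d x y + 2 * (1 / (real k + 1))) powr \<beta>"
        using evK[OF x] order_tendstoD(2)[OF lim2 xy]
      proof eventually_elim
        case (elim k)
        have dd: "d (f x k) (f y k) \<le> d x y + 2 * (1 / (real k + 1))"
          using dist_triangle[of "f x k" "f y k" x] dist_triangle[of x "f y k" y] f(2)[of x k] f(2)[of y k]
            dist_sym[of x "f x k"] by linarith
        then have "\<bar>u (f x k) - u (f y k)\<bar> \<le> C' (mm n) * d (f x k) (f y k) powr \<beta>"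
          using elim by (intro holder_D f(1)) (auto simp: \<rho>_def)
        also have "\<dots> \<le> C' (mm n) * (d x y + 2 * (1 / (real k + 1))) powr \<beta>"
          using dd C'[of "mm n"] \<beta> dist_nonneg by (intro mult_left_mono powr_mono2) auto
        finally show ?case .
      qed
      then show ?thesis by (rule tendsto_le[OF sequentially_bot rhs lhs])
    qed
    \<comment> \<open>Points further apart than \<open>\<rho>\<close> are handled by the sup bound,
      at the price of dividing \<open>2 * M\<close> by \<open>\<rho> powr \<beta>\<close>.\<close>
    define B where "B = C' (mm n) + 2 * M / \<rho> powr \<beta>"
    show "\<exists>C. \<forall>x\<in>K n. \<forall>y\<in>K n. \<bar>v x - v y\<bar> \<le> C * d x y powr \<beta>"
    proof (intro exI[of _ B] ballI)
      fix x y assume xy: "x \<in> K n" "y \<in> K n"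
      have c2: "0 \<le> 2 * M / \<rho> powr \<beta> * d x y powr \<beta>" "0 \<le> C' (mm n) * d x y powr \<beta>"
        using M C'[of "mm n"] by auto
      show "\<bar>v x - v y\<bar> \<le> B * d x y powr \<beta>"
      proof (cases "d x y < \<rho>")
        case True
        then show ?thesis using v_near[OF xy] c2 by (simp add: B_def distrib_right)
      next
        case False
        have "1 \<le> d x y powr \<beta> / \<rho> powr \<beta>"
          using False \<rho> \<beta> powr_mono2[of \<beta> \<rho> "d x y"] by simp
        then have "2 * M * 1 \<le> 2 * M * (d x y powr \<beta> / \<rho> powr \<beta>)" using M by (intro mult_left_mono) auto
        then have "\<bar>v x - v y\<bar> \<le> 2 * M / \<rho> powr \<beta> * d x y powr \<beta>"
          using v_bd[OF xy(1)] v_bd[OF xy(2)] by simp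
        then show ?thesis using c2 by (simp add: B_def distrib_right)
      qed
    qed
  qed
qed

end

subsection \<open>The double phase energy\<close>

lemma abs_Jpow: "\<bar>Jpow l a\<bar> = \<bar>a\<bar> powr (l - 1)"
proof (cases "a = 0")
  case False
  have "\<bar>a\<bar> powr (l - 2) * \<bar>a\<bar> powr 1 = \<bar>a\<bar> powr (l - 1)"
    unfolding powr_add[symmetric] by simp
  then show ?thesis using False by (simp add: Jpow_def abs_mult)
qed (simp add: Jpow_def)

lemma Jpow_minus: "Jpow l (- a) = - Jpow l a"
  by (simp add: Jpow_def)

lemma Jpow_nonneg: "0 \<le> a \<Longrightarrow> 0 \<le> Jpow l a"
  by (simp add: Jpow_def)

lemma powr_diff_one_mult: "0 \<le> x \<Longrightarrow> x powr (l - 1) * x = x powr l" for x :: real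
  by (cases "x = 0") (simp_all add: powr_diff)

text \<open>Here \<open>a\<close> and \<open>b\<close> are the increments of \<open>u\<close> and of
  the barrier, \<open>wx\<close> and \<open>wy\<close> the values of their difference. If
  \<open>a\<close> and the increment of the positive part have opposite signs, then
  \<open>\<bar>b\<bar> = \<bar>a\<bar> + \<bar>wx - wy\<bar>\<close>, so the slope of the barrier
  bounds both factors and no power of \<open>u\<close> survives.\<close>

lemma Jpow_barrier:
  assumes l: "1 < l" and eq: "a - b = wx - wy"
  shows "- (Jpow l a * (max 0 wx - max 0 wy)) \<le> \<bar>b\<bar> powr l"
proof (cases "0 \<le> a * (max 0 wx - max 0 wy)")
  case True
  have "0 \<le> \<bar>a\<bar> powr (l - 2) * (a * (max 0 wx - max 0 wy))"
    by (rule mult_nonneg_nonneg[OF powr_ge_zero True])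
  then have "0 \<le> Jpow l a * (max 0 wx - max 0 wy)" by (simp add: Jpow_def mult.assoc)
  then show ?thesis by (smt (verit) powr_ge_zero)
next
  case False
  let ?e = "max 0 wx - max 0 wy"
  have "\<bar>a\<bar> \<le> \<bar>b\<bar> \<and> \<bar>?e\<bar> \<le> \<bar>b\<bar>"
  proof (cases "0 < a")
    case True
    then have "?e < 0" using False by (simp add: zero_le_mult_iff not_le)
    then show ?thesis using eq True by (simp add: max_def split: if_splits)
  next
    case False2: False
    then have "a < 0" "0 < ?e" using False by (auto simp: zero_le_mult_iff not_le)
    then show ?thesis using eq by (simp add: max_def split: if_splits)
  qed
  then have b: "\<bar>a\<bar> \<le> \<bar>b\<bar>" "\<bar>?e\<bar> \<le> \<bar>b\<bar>" by auto
  have "- (Jpow l a * ?e) \<le> \<bar>Jpow l a\<bar> * \<bar>?e\<bar>" by (simp add: abs_mult[symmetric] abs_ge_minus_self)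
  also have "\<dots> \<le> \<bar>b\<bar> powr (l - 1) * \<bar>b\<bar>"
    unfolding abs_Jpow using b l by (intro mult_mono powr_mono2) auto
  also have "\<dots> = \<bar>b\<bar> powr l" by (simp add: powr_diff_one_mult)
  finally show ?thesis .
qed

text \<open>For a far point \<open>y\<close> only \<open>u y > u x\<close> is harmful, and then
  \<open>V\<close> dominates the jump. The power drops to \<open>l - 1\<close> because the test
  function stays below \<open>k\<close>; this is the growth that a tail space can control.\<close>

lemma Jpow_tail:
  assumes "1 < l" "- a \<le> V" "0 \<le> V" "0 \<le> e" "e \<le> k"
  shows "- (Jpow l a * e) \<le> k * V powr (l - 1)"
proof (cases "0 \<le> a")
  case True
  then have "0 \<le> Jpow l a * e" using assms by (simp add: Jpow_nonneg)
  moreover have "0 \<le> k * V powr (l - 1)" using assms by simp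
  ultimately show ?thesis by linarith
next
  case False
  have "- (Jpow l a * e) \<le> \<bar>Jpow l a\<bar> * \<bar>e\<bar>" by (simp add: abs_mult[symmetric] abs_ge_minus_self)
  also have "\<dots> \<le> V powr (l - 1) * k"
    unfolding abs_Jpow using assms False by (intro mult_mono powr_mono2) auto
  finally show ?thesis by (simp add: mult.commute)
qed

text \<open>A crude Young inequality, by comparing the two factors; it makes the flux integrable for
  functions of finite energy.\<close>

lemma abs_Jpow_mult_le:
  assumes "1 < l" shows "\<bar>Jpow l a * e\<bar> \<le> \<bar>a\<bar> powr l + \<bar>e\<bar> powr l"
proof (cases "\<bar>a\<bar> \<le> \<bar>e\<bar>")
  case True
  have "\<bar>Jpow l a * e\<bar> \<le> \<bar>e\<bar> powr (l - 1) * \<bar>e\<bar>"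
    unfolding abs_mult abs_Jpow using assms True by (intro mult_mono powr_mono2) auto
  then show ?thesis by (simp add: powr_diff_one_mult add_increasing)
next
  case False
  have "\<bar>Jpow l a * e\<bar> \<le> \<bar>a\<bar> powr (l - 1) * \<bar>a\<bar>"
    unfolding abs_mult abs_Jpow using assms False by (intro mult_mono powr_mono2) auto
  then show ?thesis by (simp add: powr_diff_one_mult add_increasing2)
qed

lemma powr_sum_le:
  fixes x y :: real
  assumes "0 \<le> x" "0 \<le> y" "0 \<le> l" "\<bar>e\<bar> \<le> x + y"
  shows "\<bar>e\<bar> powr l \<le> 2 powr l * (x powr l + y powr l)"
proof -
  have "\<bar>e\<bar> powr l \<le> (2 * max x y) powr l" using assms by (intro powr_mono2) auto
  also have "\<dots> = 2 powr l * max x y powr l" using assms by (simp add: powr_mult)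
  also have "\<dots> \<le> 2 powr l * (x powr l + y powr l)"
    by (intro mult_left_mono) (auto simp: max_def)
  finally show ?thesis .
qed

text \<open>This is how the equation is used: a bound on the negative part of the tested integrand
  becomes a bound on its positive part.\<close>

lemma ennreal_pos_eq_neg_part:
  assumes "integrable M f" "integral\<^sup>L M f = 0"
  shows "(\<integral>\<^sup>+ x. ennreal (f x) \<partial>M) = (\<integral>\<^sup>+ x. ennreal (- f x) \<partial>M)"
proof -
  have "enn2real (\<integral>\<^sup>+ x. ennreal (f x) \<partial>M) = enn2real (\<integral>\<^sup>+ x. ennreal (- f x) \<partial>M)"
    using assms real_lebesgue_integral_def[OF assms(1)] by simp
  moreover have "(\<integral>\<^sup>+ x. ennreal (f x) \<partial>M) \<noteq> \<infinity>" "(\<integral>\<^sup>+ x. ennreal (- f x) \<partial>M) \<noteq> \<infinity>"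
    using assms(1) by (auto simp: real_integrable_def)
  ultimately show ?thesis
    by (metis ennreal_enn2real infinity_ennreal_def less_top)
qed

text \<open>\<open>A\<close>, \<open>L\<close>, \<open>M\<close> bound the Hoelder constant and the
  supremum of the coefficient and the supremum of the solution. They are parameters of the locale,
  whereas coefficient, domain and solution remain arguments, so each constant obtained inside is
  uniform over all problems with these bounds.\<close>

locale double_phase = ahlfors_space +
  fixes p q s t \<alpha> A L M :: real
  assumes p_gt_1: "1 < p" and p_le_q: "p \<le> q" and s_pos: "0 < s" and s_le_t: "s \<le> t"
    and t_lt_1: "t < 1" and \<alpha>_pos: "0 < \<alpha>" and \<alpha>_le_1: "\<alpha> \<le> 1"
    and tq_le: "t * q \<le> s * p + \<alpha>" and A_nonneg: "0 \<le> A" and L_nonneg: "0 \<le> L"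
    and M_pos: "0 < M"
begin

section \<open>Kernels, energy and weak solutions\<close>

definition ker :: "real \<Rightarrow> 'a \<Rightarrow> 'a \<Rightarrow> real" where
  "ker \<gamma> x y = d x y powr (- (Q + \<gamma>))"

definition modulating :: "('a \<Rightarrow> 'a \<Rightarrow> real) \<Rightarrow> bool" where
  "modulating a \<longleftrightarrow> (\<lambda>z. a (fst z) (snd z)) \<in> borel_measurable (\<mu> \<Otimes>\<^sub>M \<mu>) \<and>
    (\<forall>x y. 0 \<le> a x y \<and> a x y = a y x \<and> a x y \<le> L) \<and>
    (\<forall>x y x' y'. \<bar>a x y - a x' y'\<bar> \<le> A * (d x x' + d y y') powr \<alpha>)"

definition energy_density :: "('a \<Rightarrow> 'a \<Rightarrow> real) \<Rightarrow> real \<Rightarrow> 'a \<Rightarrow> 'a \<Rightarrow> real" where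
  "energy_density a h x y = h powr p * ker (s * p) x y + a x y * h powr q * ker (t * q) x y"

definition flux :: "('a \<Rightarrow> 'a \<Rightarrow> real) \<Rightarrow> real \<Rightarrow> real \<Rightarrow> 'a \<Rightarrow> 'a \<Rightarrow> real" where
  "flux a h e x y = Jpow p h * e * ker (s * p) x y + a x y * (Jpow q h * e) * ker (t * q) x y"

definition finite_energy :: "('a \<Rightarrow> 'a \<Rightarrow> real) \<Rightarrow> 'a set \<Rightarrow> ('a \<Rightarrow> real) \<Rightarrow> bool" where
  "finite_energy a \<Omega> u \<longleftrightarrow> u \<in> borel_measurable \<mu> \<and>
     (\<integral>\<^sup>+ x. ennreal (indicator \<Omega> x * \<bar>u x\<bar> powr p) \<partial>\<mu>) < \<infinity> \<and>
     (\<integral>\<^sup>+ z. ennreal (indicator (UNIV - (- \<Omega>) \<times> (- \<Omega>)) z *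
          energy_density a \<bar>u (fst z) - u (snd z)\<bar> (fst z) (snd z)) \<partial>(\<mu> \<Otimes>\<^sub>M \<mu>)) < \<infinity>"

definition weak_sol :: "('a \<Rightarrow> 'a \<Rightarrow> real) \<Rightarrow> 'a set \<Rightarrow> ('a \<Rightarrow> real) \<Rightarrow> bool" where
  "weak_sol a \<Omega> u \<longleftrightarrow> \<Omega> \<in> sets \<mu> \<and> finite_energy a \<Omega> u \<and>
     (\<forall>\<phi>. finite_energy a \<Omega> \<phi> \<and> (AE x in \<mu>. x \<notin> \<Omega> \<longrightarrow> \<phi> x = 0) \<longrightarrow>
        (\<integral> z. indicator (UNIV - (- \<Omega>) \<times> (- \<Omega>)) z *
            flux a (u (fst z) - u (snd z)) (\<phi> (fst z) - \<phi> (snd z)) (fst z) (snd z)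
          \<partial>(\<mu> \<Otimes>\<^sub>M \<mu>)) = 0)"

lemma q_gt_1: "1 < q" using p_gt_1 p_le_q by simp
lemma t_pos: "0 < t" using s_pos s_le_t by simp
lemma sp_pos: "0 < s * p" using s_pos p_gt_1 by simp
lemma sp_le_tq: "s * p \<le> t * q" using s_pos s_le_t p_gt_1 p_le_q by (intro mult_mono) auto

lemma ker_nonneg [simp]: "0 \<le> ker \<gamma> x y" by (simp add: ker_def)
lemma ker_sym: "ker \<gamma> x y = ker \<gamma> y x" by (simp add: ker_def dist_sym)

lemma modulating_nonneg: "modulating a \<Longrightarrow> 0 \<le> a x y" by (simp add: modulating_def)
lemma modulating_sym: "modulating a \<Longrightarrow> a x y = a y x" unfolding modulating_def by blast
lemma modulating_le: "modulating a \<Longrightarrow> a x y \<le> L" by (simp add: modulating_def)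
lemma modulating_measurable: "modulating a \<Longrightarrow> (\<lambda>z. a (fst z) (snd z)) \<in> borel_measurable (\<mu> \<Otimes>\<^sub>M \<mu>)"
  by (simp add: modulating_def)
lemma modulating_measurable2:
  assumes "modulating a" "f \<in> N \<rightarrow>\<^sub>M \<mu>" "g \<in> N \<rightarrow>\<^sub>M \<mu>"
  shows "(\<lambda>z. a (f z) (g z)) \<in> borel_measurable N"
  using measurable_compose[OF measurable_Pair[OF assms(2,3)] modulating_measurable[OF assms(1)]] by simp

lemma ker_measurable [measurable (raw)]:
  assumes [measurable]: "f \<in> N \<rightarrow>\<^sub>M \<mu>" "g \<in> N \<rightarrow>\<^sub>M \<mu>"
  shows "(\<lambda>z. ker \<gamma> (f z) (g z)) \<in> borel_measurable N"
  unfolding ker_def by measurable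

lemma energy_density_measurable:
  assumes a: "modulating a" and [measurable]: "h \<in> borel_measurable N" "f \<in> N \<rightarrow>\<^sub>M \<mu>" "g \<in> N \<rightarrow>\<^sub>M \<mu>"
  shows "(\<lambda>z. energy_density a (h z) (f z) (g z)) \<in> borel_measurable N"
proof -
  note [measurable] = modulating_measurable2[OF a assms(3,4)]
  show ?thesis unfolding energy_density_def by measurable
qed

lemma flux_measurable:
  assumes a: "modulating a" and [measurable]: "h \<in> borel_measurable N" "e \<in> borel_measurable N" "f \<in> N \<rightarrow>\<^sub>M \<mu>" "g \<in> N \<rightarrow>\<^sub>M \<mu>"
  shows "(\<lambda>z. flux a (h z) (e z) (f z) (g z)) \<in> borel_measurable N"
proof -
  note [measurable] = modulating_measurable2[OF a assms(4,5)]
  show ?thesis unfolding flux_def Jpow_def by measurable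
qed

lemma energy_density_nonneg: "modulating a \<Longrightarrow> 0 \<le> energy_density a h x y"
  by (simp add: energy_density_def modulating_nonneg)

lemma energy_density_sym: "modulating a \<Longrightarrow> energy_density a h x y = energy_density a h y x"
  by (simp add: energy_density_def ker_sym[of _ x] modulating_sym[of a x])

lemma flux_sym: "modulating a \<Longrightarrow> flux a h e x y = flux a (- h) (- e) y x"
  by (simp add: flux_def Jpow_minus ker_sym[of _ x] modulating_sym[of a x])

lemma abs_flux_le:
  assumes "modulating a" shows "\<bar>flux a h e x y\<bar> \<le> energy_density a \<bar>h\<bar> x y + energy_density a \<bar>e\<bar> x y"
proof -
  have "\<bar>flux a h e x y\<bar> \<le> \<bar>Jpow p h * e\<bar> * ker (s * p) x y + a x y * \<bar>Jpow q h * e\<bar> * ker (t * q) x y"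
    unfolding flux_def using modulating_nonneg[OF assms, of x y] abs_triangle_ineq
    by (simp add: abs_mult order_trans[OF abs_triangle_ineq])
  also have "\<dots> \<le> (\<bar>h\<bar> powr p + \<bar>e\<bar> powr p) * ker (s * p) x y
      + a x y * (\<bar>h\<bar> powr q + \<bar>e\<bar> powr q) * ker (t * q) x y"
    using abs_Jpow_mult_le[OF p_gt_1] abs_Jpow_mult_le[OF q_gt_1] modulating_nonneg[OF assms, of x y]
    by (intro add_mono mult_right_mono mult_left_mono) auto
  also have "\<dots> = energy_density a \<bar>h\<bar> x y + energy_density a \<bar>e\<bar> x y" by (simp add: energy_density_def algebra_simps)
  finally show ?thesis .
qed

lemma energy_density_add_le:
  assumes "modulating a" "0 \<le> h" "0 \<le> k" "\<bar>e\<bar> \<le> h + k"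
  shows "energy_density a \<bar>e\<bar> x y \<le> 2 powr q * (energy_density a h x y + energy_density a k x y)"
proof -
  have *: "2 powr p \<le> (2 powr q :: real)" using p_le_q by simp
  have "\<bar>e\<bar> powr p \<le> 2 powr p * (h powr p + k powr p)" using assms p_gt_1 by (intro powr_sum_le) auto
  also have "\<dots> \<le> 2 powr q * (h powr p + k powr p)" using * by (intro mult_right_mono) auto
  finally have 1: "\<bar>e\<bar> powr p \<le> 2 powr q * (h powr p + k powr p)" .
  have 2: "\<bar>e\<bar> powr q \<le> 2 powr q * (h powr q + k powr q)" using assms q_gt_1 by (intro powr_sum_le) auto
  have "energy_density a \<bar>e\<bar> x y \<le> 2 powr q * (h powr p + k powr p) * ker (s * p) x y
     + a x y * (2 powr q * (h powr q + k powr q)) * ker (t * q) x y"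
    unfolding energy_density_def using 1 2 modulating_nonneg[OF assms(1), of x y]
    by (intro add_mono mult_right_mono mult_left_mono) auto
  also have "\<dots> = 2 powr q * (energy_density a h x y + energy_density a k x y)" by (simp add: energy_density_def algebra_simps)
  finally show ?thesis .
qed

text \<open>\<open>Jpow\<close> is odd, so every upper bound for solutions yields a lower bound as
  well.\<close>

lemma weak_sol_minus:
  assumes "weak_sol a \<Omega> u" shows "weak_sol a \<Omega> (\<lambda>x. - u x)"
proof -
  have adm: "finite_energy a \<Omega> (\<lambda>x. - u x)"
    using assms by (simp add: weak_sol_def finite_energy_def abs_minus_commute)
  have "flux a (- u x - - u y) e x y = - flux a (u x - u y) e x y" for x y e
    using Jpow_minus[of _ "u x - u y"] by (simp add: flux_def)
  then show ?thesis using assms adm by (simp add: weak_sol_def)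
qed

section \<open>The cone barrier and the loss it causes\<close>

definition barrier :: "real \<Rightarrow> real \<Rightarrow> 'a \<Rightarrow> real \<Rightarrow> 'a \<Rightarrow> real" where
  "barrier m k x0 r x = m + k * min (d x0 x / r) 1"

definition superlevel :: "('a \<Rightarrow> real) \<Rightarrow> real \<Rightarrow> real \<Rightarrow> 'a \<Rightarrow> real \<Rightarrow> 'a set" where
  "superlevel u m k x0 r = {x. d x0 x < r \<and> barrier m k x0 r x < u x}"

text \<open>The cut at radius \<open>r\<close> is imposed by hand because far away \<open>u\<close>
  is not bounded by \<open>S\<close> and the positive part of \<open>u - barrier\<close> need not
  vanish. For \<open>m \<ge> S - k\<close> the cone has reached \<open>S\<close> at radius
  \<open>r\<close>, so between \<open>r\<close> and \<open>R\<close> the cut changes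
  nothing.\<close>

definition excess :: "('a \<Rightarrow> real) \<Rightarrow> real \<Rightarrow> real \<Rightarrow> 'a \<Rightarrow> real \<Rightarrow> 'a \<Rightarrow> real" where
  "excess u m k x0 r x = (if d x0 x < r then max 0 (u x - barrier m k x0 r x) else 0)"

definition tail_dens :: "('a \<Rightarrow> 'a \<Rightarrow> real) \<Rightarrow> real \<Rightarrow> 'a \<Rightarrow> 'a \<Rightarrow> real" where
  "tail_dens a h x y = h powr (p - 1) * ker (s * p) x y + a x y * h powr (q - 1) * ker (t * q) x y"

definition loss :: "('a \<Rightarrow> 'a \<Rightarrow> real) \<Rightarrow> ('a \<Rightarrow> real) \<Rightarrow> real \<Rightarrow> real \<Rightarrow> 'a \<Rightarrow> real \<Rightarrow> real \<Rightarrow> 'a \<Rightarrow> 'a \<Rightarrow> real" where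
  "loss a u S k x0 r R x y = energy_density a (k * min (d x y / r) 1) x y
     + indicator {y. R \<le> d x0 y} y * k * tail_dens a (\<bar>u y - S\<bar> + k) x y"

lemma barrier_measurable [measurable (raw)]:
  assumes [measurable]: "f \<in> N \<rightarrow>\<^sub>M \<mu>" shows "(\<lambda>x. barrier m k x0 r (f x)) \<in> borel_measurable N"
  unfolding barrier_def by measurable

lemma excess_measurable [measurable]:
  assumes [measurable]: "u \<in> borel_measurable \<mu>" shows "excess u m k x0 r \<in> borel_measurable \<mu>"
  unfolding excess_def by measurable

lemma superlevel_sets [measurable]:
  assumes [measurable]: "u \<in> borel_measurable \<mu>" shows "superlevel u m k x0 r \<in> sets \<mu>"
  unfolding superlevel_def by (rule sets_Collect_mu) measurable

lemma tail_dens_measurable: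
  assumes a: "modulating a" and [measurable]: "h \<in> borel_measurable N" "f \<in> N \<rightarrow>\<^sub>M \<mu>" "g \<in> N \<rightarrow>\<^sub>M \<mu>"
  shows "(\<lambda>z. tail_dens a (h z) (f z) (g z)) \<in> borel_measurable N"
proof -
  note [measurable] = modulating_measurable2[OF a assms(3,4)]
  show ?thesis unfolding tail_dens_def by measurable
qed

lemma tail_dens_nonneg: "modulating a \<Longrightarrow> 0 \<le> tail_dens a h x y"
  by (simp add: tail_dens_def modulating_nonneg)

lemma loss_measurable:
  assumes a: "modulating a" and [measurable]: "u \<in> borel_measurable \<mu>" "f \<in> N \<rightarrow>\<^sub>M \<mu>" "g \<in> N \<rightarrow>\<^sub>M \<mu>"
  shows "(\<lambda>z. loss a u S k x0 r R (f z) (g z)) \<in> borel_measurable N"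
proof -
  have [measurable]: "{y. R \<le> d x0 y} \<in> sets \<mu>" by (rule sets_Collect_mu) measurable
  have [measurable]: "(\<lambda>z. energy_density a (k * min (d (f z) (g z) / r) 1) (f z) (g z)) \<in> borel_measurable N"
    by (rule energy_density_measurable[OF a]) measurable
  have [measurable]: "(\<lambda>z. tail_dens a (\<bar>u (g z) - S\<bar> + k) (f z) (g z)) \<in> borel_measurable N"
    by (rule tail_dens_measurable[OF a]) measurable
  show ?thesis unfolding loss_def by measurable
qed

lemma loss_nonneg: "modulating a \<Longrightarrow> 0 \<le> k \<Longrightarrow> 0 \<le> loss a u S k x0 r R x y"
  by (simp add: loss_def energy_density_nonneg tail_dens_nonneg)

lemma barrier_diff_le:
  assumes "0 < r" "0 \<le> k"
  shows "\<bar>barrier m k x0 r x - barrier m k x0 r y\<bar> \<le> k * min (d x y / r) 1"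
proof -
  have "\<bar>d x0 x - d x0 y\<bar> \<le> d x y"
    using dist_triangle[of x0 x y] dist_triangle[of x0 y x] dist_sym[of x y] by linarith
  then have "\<bar>d x0 x / r - d x0 y / r\<bar> \<le> d x y / r"
    using assms by (simp add: diff_divide_distrib[symmetric] divide_right_mono)
  moreover have "0 \<le> d x0 x / r" "0 \<le> d x0 y / r" using assms dist_nonneg by auto
  ultimately have "\<bar>min (d x0 x / r) 1 - min (d x0 y / r) 1\<bar> \<le> min (d x y / r) 1"
    by (auto simp: min_def)
  then have "k * \<bar>min (d x0 x / r) 1 - min (d x0 y / r) 1\<bar> \<le> k * min (d x y / r) 1"
    using assms by (intro mult_left_mono)
  then show ?thesis using assms by (simp add: barrier_def abs_mult right_diff_distrib[symmetric])
qed

lemma barrier_ge: "0 < r \<Longrightarrow> 0 \<le> k \<Longrightarrow> m \<le> barrier m k x0 r x"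
  using dist_nonneg[of x0 x] by (simp add: barrier_def)

lemma barrier_outside: "0 < r \<Longrightarrow> r \<le> d x0 x \<Longrightarrow> barrier m k x0 r x = m + k"
  by (simp add: barrier_def min_def)

context
  fixes a :: "'a \<Rightarrow> 'a \<Rightarrow> real" and u :: "'a \<Rightarrow> real" and S k m r R :: real and x0 :: 'a
  assumes a: "modulating a" and r: "0 < r" and R: "2 * r \<le> R" and k: "0 < k" and m: "S - k \<le> m"
begin

lemma excess_eq:
  assumes "d x0 y < R" "u y \<le> S"
  shows "excess u m k x0 r y = max 0 (u y - barrier m k x0 r y)"
  using assms barrier_outside[OF r, of x0 y m k] m by (simp add: excess_def max_def)

lemma excess_bounds:
  assumes "d x0 x < r \<Longrightarrow> u x \<le> S"
  shows "0 \<le> excess u m k x0 r x" "excess u m k x0 r x \<le> k"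
  using assms barrier_ge[OF r, of k m x0 x] k m by (auto simp: excess_def max_def)

text \<open>Inside \<open>R\<close> the excess is the positive part of \<open>u - barrier\<close>,
  so \<open>Jpow_barrier\<close> applies; beyond \<open>R\<close> the excess of \<open>y\<close> is
  zero and \<open>Jpow_tail\<close> applies with height \<open>k\<close>.\<close>

lemma phase_loss:
  assumes l: "1 < l" and x: "x \<in> superlevel u m k x0 r"
    and uS: "d x0 x < R \<Longrightarrow> u x \<le> S" "d x0 y < R \<Longrightarrow> u y \<le> S"
  shows "- (Jpow l (u x - u y) * (excess u m k x0 r x - excess u m k x0 r y))
    \<le> (k * min (d x y / r) 1) powr l + indicator {y. R \<le> d x0 y} y * k * (\<bar>u y - S\<bar> + k) powr (l - 1)"
proof -
  have xr: "d x0 x < r" "d x0 x < R" using x R r by (auto simp: superlevel_def)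
  then have uxS: "u x \<le> S" using uS by simp
  show ?thesis
  proof (cases "d x0 y < R")
    case True
    let ?\<psi> = "barrier m k x0 r"
    have "- (Jpow l (u x - u y) * (excess u m k x0 r x - excess u m k x0 r y)) \<le> \<bar>?\<psi> x - ?\<psi> y\<bar> powr l"
      using Jpow_barrier[OF l, of "u x - u y" "?\<psi> x - ?\<psi> y" "u x - ?\<psi> x" "u y - ?\<psi> y"]
        excess_eq[OF xr(2) uxS] excess_eq[OF True uS(2)[OF True]] by simp
    also have "\<dots> \<le> (k * min (d x y / r) 1) powr l"
      using barrier_diff_le[OF r, of k m x0 x y] k l by (intro powr_mono2) auto
    finally show ?thesis using True by simp
  next
    case False
    then have y0: "excess u m k x0 r y = 0" using R r by (simp add: excess_def)
    have "m < u x" using x barrier_ge[OF r, of k m x0 x] k by (auto simp: superlevel_def)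
    then have V: "- (u x - u y) \<le> \<bar>u y - S\<bar> + k" using m by linarith
    have "- (Jpow l (u x - u y) * excess u m k x0 r x) \<le> k * (\<bar>u y - S\<bar> + k) powr (l - 1)"
      using excess_bounds[of x] uxS k by (intro Jpow_tail[OF l V]) auto
    then show ?thesis using False y0 by (simp add: add_increasing)
  qed
qed

lemma flux_loss_left:
  assumes x: "x \<in> superlevel u m k x0 r"
    and uS: "d x0 x < R \<Longrightarrow> u x \<le> S" "d x0 y < R \<Longrightarrow> u y \<le> S"
  shows "- flux a (u x - u y) (excess u m k x0 r x - excess u m k x0 r y) x y \<le> loss a u S k x0 r R x y"
proof -
  let ?e = "excess u m k x0 r x - excess u m k x0 r y"
  let ?g = "\<lambda>l. (k * min (d x y / r) 1) powr l + indicator {y. R \<le> d x0 y} y * k * (\<bar>u y - S\<bar> + k) powr (l - 1)"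
  have "- flux a (u x - u y) ?e x y = - (Jpow p (u x - u y) * ?e) * ker (s * p) x y
     + a x y * - (Jpow q (u x - u y) * ?e) * ker (t * q) x y" by (simp add: flux_def)
  also have "\<dots> \<le> ?g p * ker (s * p) x y + a x y * ?g q * ker (t * q) x y"
    using phase_loss[OF p_gt_1 x uS] phase_loss[OF q_gt_1 x uS] modulating_nonneg[OF a, of x y]
    by (intro add_mono mult_right_mono mult_left_mono) auto
  also have "\<dots> = loss a u S k x0 r R x y"
    by (simp add: loss_def energy_density_def tail_dens_def algebra_simps)
  finally show ?thesis .
qed

text \<open>If neither point lies in the superlevel set, both excesses and hence the flux vanish.
  All loss is therefore charged to that set, which puts its measure on the right-hand side of the
  energy inequality.\<close>

lemma flux_loss:
  assumes uS: "d x0 x < R \<Longrightarrow> u x \<le> S" "d x0 y < R \<Longrightarrow> u y \<le> S"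
  shows "- flux a (u x - u y) (excess u m k x0 r x - excess u m k x0 r y) x y
    \<le> indicator (superlevel u m k x0 r) x * loss a u S k x0 r R x y
      + indicator (superlevel u m k x0 r) y * loss a u S k x0 r R y x"
proof -
  let ?A = "superlevel u m k x0 r"
  have nn: "0 \<le> loss a u S k x0 r R x' y'" for x' y' using loss_nonneg[OF a] k by simp
  consider "x \<in> ?A" | "y \<in> ?A" | "x \<notin> ?A" "y \<notin> ?A" by blast
  then show ?thesis
  proof cases
    case 1
    then show ?thesis using flux_loss_left[OF 1 uS] nn[of y x] by (simp add: indicator_def)
  next
    case 2
    then show ?thesis using flux_loss_left[OF 2 uS(2,1)] nn[of x y]
        flux_sym[OF a, of "u x - u y" "excess u m k x0 r x - excess u m k x0 r y" x y]
      by (simp add: indicator_def)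
  next
    case 3
    then have "excess u m k x0 r x = 0" "excess u m k x0 r y = 0"
      by (auto simp: superlevel_def excess_def)
    then show ?thesis using 3 by (simp add: flux_def)
  qed
qed

text \<open>For the admissibility of the excess as a test function. If \<open>y\<close> is beyond
  \<open>R\<close>, its excess is zero, the minimum is 1 because
  \<open>d x y \<ge> R - r \<ge> r\<close>, and \<open>k\<close> alone bounds the
  difference.\<close>

lemma excess_diff_le:
  assumes x: "d x0 x < r" and uS: "d x0 x < R \<Longrightarrow> u x \<le> S" "d x0 y < R \<Longrightarrow> u y \<le> S"
  shows "\<bar>excess u m k x0 r x - excess u m k x0 r y\<bar> \<le> \<bar>u x - u y\<bar> + k * min (d x y / r) 1"
proof (cases "d x0 y < R")
  case True
  have max_lip: "\<bar>max 0 X - max 0 Y\<bar> \<le> \<bar>X - Y\<bar>" for X Y :: real by auto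
  have "d x0 x < R" using x R r by simp
  then have "\<bar>excess u m k x0 r x - excess u m k x0 r y\<bar>
      \<le> \<bar>(u x - barrier m k x0 r x) - (u y - barrier m k x0 r y)\<bar>"
    using excess_eq[of x] excess_eq[of y] uS True max_lip by simp
  then show ?thesis using barrier_diff_le[OF r, of k m x0 x y] k by linarith
next
  case False
  then have "excess u m k x0 r y = 0" using R r by (simp add: excess_def)
  moreover have "r \<le> d x y" using False x R dist_triangle[of x0 y x] by linarith
  then have "min (d x y / r) 1 = 1" using r by (simp add: min_def)
  ultimately show ?thesis using excess_bounds[of x] uS x R r by simp
qed

end

section \<open>The energy inequality\<close>

abbreviation C_set :: "'a set \<Rightarrow> ('a \<times> 'a) set" where
  "C_set \<Omega> \<equiv> UNIV - (- \<Omega>) \<times> (- \<Omega>)"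

lemma C_set_sets: "\<Omega> \<in> sets \<mu> \<Longrightarrow> C_set \<Omega> \<in> sets (\<mu> \<Otimes>\<^sub>M \<mu>)"
  using sets.top[of "\<mu> \<Otimes>\<^sub>M \<mu>"] sets.compl_sets[of \<Omega> \<mu>]
  by (auto simp: space_pair_measure space_UNIV Compl_eq_Diff_UNIV)

text \<open>Testing with the excess: positive and negative part of the flux have the same integral,
  and \<open>flux_loss\<close> bounds the latter by the loss at either point of the pair; hence the
  factor 2.\<close>

lemma energy:
  assumes a: "modulating a" and sol: "weak_sol a \<Omega> u" and r: "0 < r" and R: "2 * r \<le> R"
    and k: "0 < k" and m: "S - k \<le> m" and ball: "{x. d x0 x < r} \<subseteq> \<Omega>"
    and uS: "AE x in \<mu>. d x0 x < R \<longrightarrow> u x \<le> S"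
    and E: "\<And>x. d x0 x < r \<Longrightarrow> (\<integral>\<^sup>+ y. ennreal (loss a u S k x0 r R x y) \<partial>\<mu>) \<le> ennreal E"
  shows "(\<integral>\<^sup>+ z. ennreal (flux a (u (fst z) - u (snd z))
        (excess u m k x0 r (fst z) - excess u m k x0 r (snd z)) (fst z) (snd z)) \<partial>(\<mu> \<Otimes>\<^sub>M \<mu>))
     \<le> 2 * ennreal E * emeasure \<mu> (superlevel u m k x0 r)"
proof -
  let ?\<phi> = "excess u m k x0 r" and ?l = "loss a u S k x0 r R"
  let ?B = "{x. d x0 x < r}" and ?A = "superlevel u m k x0 r"
  let ?F = "\<lambda>z. flux a (u (fst z) - u (snd z)) (?\<phi> (fst z) - ?\<phi> (snd z)) (fst z) (snd z)"
  have u [measurable]: "u \<in> borel_measurable \<mu>" using sol by (simp add: weak_sol_def finite_energy_def)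
  have \<Omega> [measurable]: "\<Omega> \<in> sets \<mu>" using sol by (simp add: weak_sol_def)
  note C = C_set_sets[OF \<Omega>]
  note exm [measurable] = excess_measurable[OF u, of m k x0 r]
  note lm = loss_measurable[OF a u measurable_fst measurable_snd, of S k x0 r R]
  note lm' = loss_measurable[OF a u measurable_snd measurable_fst, of S k x0 r R]
  have Ass: "?A \<in> sets \<mu>" and Bs: "?B \<in> sets \<mu>" by measurable
  have nnl: "0 \<le> ?l x y" for x y using loss_nonneg[OF a] k by simp
  have pairS: "AE z in \<mu> \<Otimes>\<^sub>M \<mu>. (d x0 (fst z) < R \<longrightarrow> u (fst z) \<le> S) \<and> (d x0 (snd z) < R \<longrightarrow> u (snd z) \<le> S)"
    using AE_pair_fst_snd[OF sigma_finite_measure_axioms uS] .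
  have indm: "(\<lambda>z. indicator X (fst z) * ?l (fst z) (snd z)) \<in> borel_measurable (\<mu> \<Otimes>\<^sub>M \<mu>)"
    "(\<lambda>z. indicator X (snd z) * ?l (snd z) (fst z)) \<in> borel_measurable (\<mu> \<Otimes>\<^sub>M \<mu>)"
    if [measurable]: "X \<in> sets \<mu>" for X
    using lm lm' by measurable
  have int: "(\<integral>\<^sup>+ z. ennreal (indicator X (fst z) * ?l (fst z) (snd z)
       + indicator X (snd z) * ?l (snd z) (fst z)) \<partial>(\<mu> \<Otimes>\<^sub>M \<mu>)) \<le> 2 * ennreal E * emeasure \<mu> X"
    if X: "X \<in> sets \<mu>" "X \<subseteq> ?B" for X
  proof -
    have "(\<integral>\<^sup>+ z. ennreal (indicator X (fst z) * ?l (fst z) (snd z)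
       + indicator X (snd z) * ?l (snd z) (fst z)) \<partial>(\<mu> \<Otimes>\<^sub>M \<mu>))
     = (\<integral>\<^sup>+ z. ennreal (indicator X (fst z) * ?l (fst z) (snd z)) \<partial>(\<mu> \<Otimes>\<^sub>M \<mu>))
       + (\<integral>\<^sup>+ z. ennreal (indicator X (snd z) * ?l (snd z) (fst z)) \<partial>(\<mu> \<Otimes>\<^sub>M \<mu>))"
      using indm[OF X(1)] nnl by (subst nn_integral_add[symmetric]) (auto simp: ennreal_plus)
    also have "\<dots> = 2 * (\<integral>\<^sup>+ x. \<integral>\<^sup>+ y. ennreal (indicator X x * ?l x y) \<partial>\<mu> \<partial>\<mu>)"
      using nn_integral_pair[of "\<lambda>x y. ennreal (indicator X x * ?l x y)"]
        nn_integral_pair_swap[of "\<lambda>x y. ennreal (indicator X x * ?l x y)"] indm[OF X(1)]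
      by (simp add: mult_2)
    also have "\<dots> \<le> 2 * (ennreal E * emeasure \<mu> X)"
      using nn_integral_indicator_fst_le[OF lm nnl X(1), of "ennreal E"] E X(2)
      by (intro mult_left_mono) auto
    finally show ?thesis by (simp add: mult.assoc)
  qed
  have muB: "emeasure \<mu> ?B < \<infinity>" using emeasure_ball[OF r, of x0] by simp
  have \<phi>0: "x \<notin> ?B \<Longrightarrow> ?\<phi> x = 0" for x by (simp add: excess_def)
  \<comment> \<open>The excess is a test function: it is at most \<open>k\<close> on a ball of
    finite measure, and its energy is controlled by that of \<open>u\<close> plus that of the cone,
    which is part of the loss and so bounded through \<open>E\<close>.\<close>
  have adm: "finite_energy a \<Omega> ?\<phi>"
    unfolding finite_energy_def
  proof (intro conjI)
    show "?\<phi> \<in> borel_measurable \<mu>" by measurable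
    have "(\<integral>\<^sup>+ x. ennreal (indicator \<Omega> x * \<bar>?\<phi> x\<bar> powr p) \<partial>\<mu>)
       \<le> (\<integral>\<^sup>+ x. ennreal (k powr p) * indicator ?B x \<partial>\<mu>)"
    proof (rule nn_integral_mono_AE)
      show "AE x in \<mu>. ennreal (indicator \<Omega> x * \<bar>?\<phi> x\<bar> powr p) \<le> ennreal (k powr p) * indicator ?B x"
        using uS
      proof (rule AE_mp, intro AE_I2 impI)
        fix x assume "d x0 x < R \<longrightarrow> u x \<le> S"
        then have b: "0 \<le> ?\<phi> x" "?\<phi> x \<le> k"
          using excess_bounds[OF a r R k m, of x0 x u] R r by auto
        show "ennreal (indicator \<Omega> x * \<bar>?\<phi> x\<bar> powr p) \<le> ennreal (k powr p) * indicator ?B x"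
        proof (cases "x \<in> ?B")
          case True
          have "\<bar>?\<phi> x\<bar> powr p \<le> k powr p" using b p_gt_1 by (intro powr_mono2) auto
          then show ?thesis using True by (auto simp: indicator_def intro!: ennreal_leI)
        qed (use \<phi>0[of x] in simp)
      qed
    qed
    also have "\<dots> = ennreal (k powr p) * emeasure \<mu> ?B" using Bs by (simp add: nn_integral_cmult_indicator)
    also have "\<dots> < \<infinity>" using muB by (simp add: ennreal_mult_less_top)
    finally show "(\<integral>\<^sup>+ x. ennreal (indicator \<Omega> x * \<bar>?\<phi> x\<bar> powr p) \<partial>\<mu>) < \<infinity>" .
    let ?U = "\<lambda>z. indicator (C_set \<Omega>) z * energy_density a \<bar>u (fst z) - u (snd z)\<bar> (fst z) (snd z)"
    let ?W = "\<lambda>z. indicator ?B (fst z) * ?l (fst z) (snd z) + indicator ?B (snd z) * ?l (snd z) (fst z)"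
    have Um: "?U \<in> borel_measurable (\<mu> \<Otimes>\<^sub>M \<mu>)"
      using C energy_density_measurable[OF a _ measurable_fst measurable_snd, of "\<lambda>z. \<bar>u (fst z) - u (snd z)\<bar>"] by measurable
    have Wm: "?W \<in> borel_measurable (\<mu> \<Otimes>\<^sub>M \<mu>)" using indm[OF Bs] by measurable
    have Un: "0 \<le> ?U z" for z using energy_density_nonneg[OF a] by simp
    have Wn: "0 \<le> ?W z" for z using nnl by simp
    have "(\<integral>\<^sup>+ z. ennreal (indicator (C_set \<Omega>) z * energy_density a \<bar>?\<phi> (fst z) - ?\<phi> (snd z)\<bar> (fst z) (snd z)) \<partial>(\<mu> \<Otimes>\<^sub>M \<mu>))
       \<le> (\<integral>\<^sup>+ z. ennreal (2 powr q) * ennreal (?U z) + ennreal (2 powr q) * ennreal (?W z) \<partial>(\<mu> \<Otimes>\<^sub>M \<mu>))"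
    proof (rule nn_integral_mono_AE, use pairS in \<open>rule AE_mp, intro AE_I2 impI\<close>)
      fix z assume S: "(d x0 (fst z) < R \<longrightarrow> u (fst z) \<le> S) \<and> (d x0 (snd z) < R \<longrightarrow> u (snd z) \<le> S)"
      obtain x y where z: "z = (x, y)" by (cases z)
      have "indicator (C_set \<Omega>) z * energy_density a \<bar>?\<phi> x - ?\<phi> y\<bar> x y \<le> 2 powr q * ?U z + 2 powr q * ?W z"
      proof -
        have loss_ge: "energy_density a (k * min (d x y / r) 1) x y \<le> ?l x y" for x y
          using tail_dens_nonneg[OF a] k by (simp add: loss_def)
        have main: "energy_density a \<bar>?\<phi> x - ?\<phi> y\<bar> x y \<le> 2 powr q * (energy_density a \<bar>u x - u y\<bar> x y + ?l x y)"
          if "x \<in> ?B" "d x0 x < R \<longrightarrow> u x \<le> S" "d x0 y < R \<longrightarrow> u y \<le> S" for x y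
        proof -
          have "energy_density a \<bar>?\<phi> x - ?\<phi> y\<bar> x y \<le> 2 powr q * (energy_density a \<bar>u x - u y\<bar> x y + energy_density a (k * min (d x y / r) 1) x y)"
            using excess_diff_le[OF a r R k m, of x0 x u y] that k r dist_nonneg[of x y]
            by (intro energy_density_add_le[OF a]) auto
          also have "\<dots> \<le> 2 powr q * (energy_density a \<bar>u x - u y\<bar> x y + ?l x y)"
            using loss_ge by (intro mult_left_mono add_left_mono) auto
          finally show ?thesis .
        qed
        consider "x \<in> ?B" | "y \<in> ?B" | "x \<notin> ?B" "y \<notin> ?B" by blast
        then show ?thesis
        proof cases
          case 1
          then have "z \<in> C_set \<Omega>" using ball z by auto
          have "energy_density a \<bar>?\<phi> x - ?\<phi> y\<bar> x y \<le> 2 powr q * (energy_density a \<bar>u x - u y\<bar> x y + ?l x y)"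
            using main[of x y] 1 S z by simp
          also have "\<dots> \<le> 2 powr q * (energy_density a \<bar>u x - u y\<bar> x y + ?W z)"
            using 1 z nnl[of y x] by (intro mult_left_mono add_left_mono) (auto simp: indicator_def)
          finally show ?thesis using \<open>z \<in> C_set \<Omega>\<close> z by (simp add: distrib_left)
        next
          case 2
          then have "z \<in> C_set \<Omega>" using ball z by auto
          have "energy_density a \<bar>?\<phi> x - ?\<phi> y\<bar> x y \<le> 2 powr q * (energy_density a \<bar>u x - u y\<bar> x y + ?l y x)"
            using main[of y x] 2 S z energy_density_sym[OF a, of _ x y] by (simp add: abs_minus_commute)
          also have "\<dots> \<le> 2 powr q * (energy_density a \<bar>u x - u y\<bar> x y + ?W z)"
            using 2 z nnl[of x y] by (intro mult_left_mono add_left_mono) (auto simp: indicator_def)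
          finally show ?thesis using \<open>z \<in> C_set \<Omega>\<close> z by (simp add: distrib_left)
        next
          case 3
          then have "energy_density a \<bar>?\<phi> x - ?\<phi> y\<bar> x y = 0" using \<phi>0 p_gt_1 q_gt_1 by (simp add: energy_density_def)
          then show ?thesis using Un[of z] Wn[of z] by simp
        qed
      qed
      then show "ennreal (indicator (C_set \<Omega>) z * energy_density a \<bar>?\<phi> (fst z) - ?\<phi> (snd z)\<bar> (fst z) (snd z))
        \<le> ennreal (2 powr q) * ennreal (?U z) + ennreal (2 powr q) * ennreal (?W z)"
        unfolding ennreal_affine[OF powr_ge_zero Un Wn] z by (simp only: ennreal_leI fst_conv snd_conv)
    qed
    also have "\<dots> = ennreal (2 powr q) * (\<integral>\<^sup>+ z. ennreal (?U z) \<partial>(\<mu> \<Otimes>\<^sub>M \<mu>)) + ennreal (2 powr q) * (\<integral>\<^sup>+ z. ennreal (?W z) \<partial>(\<mu> \<Otimes>\<^sub>M \<mu>))"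
      by (rule nn_integral_affine[OF Um Wm])
    also have "\<dots> < \<infinity>"
    proof -
      have "(\<integral>\<^sup>+ z. ennreal (?U z) \<partial>(\<mu> \<Otimes>\<^sub>M \<mu>)) < \<infinity>" using sol by (simp add: weak_sol_def finite_energy_def)
      moreover have "(\<integral>\<^sup>+ z. ennreal (?W z) \<partial>(\<mu> \<Otimes>\<^sub>M \<mu>)) < \<infinity>"
        by (rule le_less_trans[OF int[OF Bs order_refl]]) (use muB in \<open>simp add: ennreal_mult_less_top\<close>)
      ultimately show ?thesis by (simp add: ennreal_mult_less_top)
    qed
    finally show "(\<integral>\<^sup>+ z. ennreal (indicator (C_set \<Omega>) z * energy_density a \<bar>?\<phi> (fst z) - ?\<phi> (snd z)\<bar> (fst z) (snd z)) \<partial>(\<mu> \<Otimes>\<^sub>M \<mu>)) < \<infinity>" .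
  qed
  have Fm: "?F \<in> borel_measurable (\<mu> \<Otimes>\<^sub>M \<mu>)"
    by (rule flux_measurable[OF a]) measurable
  have Find: "indicator (C_set \<Omega>) z * ?F z = ?F z" for z
  proof (cases "z \<in> C_set \<Omega>")
    case False
    then have "fst z \<notin> ?B" "snd z \<notin> ?B" using ball by (auto simp: mem_Times_iff)
    then show ?thesis using \<phi>0 by (simp add: flux_def)
  qed simp
  have Fint: "integrable (\<mu> \<Otimes>\<^sub>M \<mu>) ?F"
  proof (rule integrableI_bounded[OF Fm])
    let ?U = "\<lambda>v z. indicator (C_set \<Omega>) z * energy_density a \<bar>v (fst z) - v (snd z)\<bar> (fst z) (snd z)"
    have Um: "?U v \<in> borel_measurable (\<mu> \<Otimes>\<^sub>M \<mu>)" if [measurable]: "v \<in> borel_measurable \<mu>" for v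
      using C energy_density_measurable[OF a _ measurable_fst measurable_snd, of "\<lambda>z. \<bar>v (fst z) - v (snd z)\<bar>"] by measurable
    have "(\<integral>\<^sup>+ z. ennreal (norm (?F z)) \<partial>(\<mu> \<Otimes>\<^sub>M \<mu>))
      \<le> (\<integral>\<^sup>+ z. ennreal (?U u z) + ennreal (?U ?\<phi> z) \<partial>(\<mu> \<Otimes>\<^sub>M \<mu>))"
    proof (rule nn_integral_mono)
      fix z
      have "norm (?F z) = norm (indicator (C_set \<Omega>) z * ?F z)" by (simp only: Find)
      also have "\<dots> = indicator (C_set \<Omega>) z * \<bar>?F z\<bar>"
        by (simp only: real_norm_def abs_mult abs_indicator)
      also have "\<dots> \<le> ?U u z + ?U ?\<phi> z"
        using abs_flux_le[OF a, of "u (fst z) - u (snd z)" "?\<phi> (fst z) - ?\<phi> (snd z)" "fst z" "snd z"]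
        by (simp add: distrib_left[symmetric] mult_left_mono)
      finally show "ennreal (norm (?F z)) \<le> ennreal (?U u z) + ennreal (?U ?\<phi> z)"
        using energy_density_nonneg[OF a] by (simp add: ennreal_plus[symmetric] ennreal_leI del: ennreal_plus)
    qed
    also have "\<dots> = (\<integral>\<^sup>+ z. ennreal (?U u z) \<partial>(\<mu> \<Otimes>\<^sub>M \<mu>)) + (\<integral>\<^sup>+ z. ennreal (?U ?\<phi> z) \<partial>(\<mu> \<Otimes>\<^sub>M \<mu>))"
      using Um[OF u] Um[OF exm] by (simp add: nn_integral_add)
    also have "\<dots> < \<infinity>" using adm sol by (simp add: weak_sol_def finite_energy_def)
    finally show "(\<integral>\<^sup>+ z. ennreal (norm (?F z)) \<partial>(\<mu> \<Otimes>\<^sub>M \<mu>)) < \<infinity>" .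
  qed
  have "AE x in \<mu>. x \<notin> \<Omega> \<longrightarrow> ?\<phi> x = 0" using \<phi>0 ball by (intro AE_I2) auto
  then have "(\<integral> z. indicator (C_set \<Omega>) z * ?F z \<partial>(\<mu> \<Otimes>\<^sub>M \<mu>)) = 0"
    using sol adm by (auto simp: weak_sol_def)
  then have F0: "(\<integral> z. ?F z \<partial>(\<mu> \<Otimes>\<^sub>M \<mu>)) = 0" unfolding Find .
  have "(\<integral>\<^sup>+ z. ennreal (?F z) \<partial>(\<mu> \<Otimes>\<^sub>M \<mu>)) = (\<integral>\<^sup>+ z. ennreal (- ?F z) \<partial>(\<mu> \<Otimes>\<^sub>M \<mu>))"
    by (rule ennreal_pos_eq_neg_part[OF Fint F0])
  also have "\<dots> \<le> (\<integral>\<^sup>+ z. ennreal (indicator ?A (fst z) * ?l (fst z) (snd z)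
       + indicator ?A (snd z) * ?l (snd z) (fst z)) \<partial>(\<mu> \<Otimes>\<^sub>M \<mu>))"
  proof (rule nn_integral_mono_AE, use pairS in \<open>rule AE_mp, intro AE_I2 impI\<close>)
    fix z assume S: "(d x0 (fst z) < R \<longrightarrow> u (fst z) \<le> S) \<and> (d x0 (snd z) < R \<longrightarrow> u (snd z) \<le> S)"
    show "ennreal (- ?F z) \<le> ennreal (indicator ?A (fst z) * ?l (fst z) (snd z)
       + indicator ?A (snd z) * ?l (snd z) (fst z))"
      by (rule ennreal_leI, rule flux_loss[OF a r R k m]) (use S in auto)
  qed
  also have "\<dots> \<le> 2 * ennreal E * emeasure \<mu> ?A"
    by (rule int[OF Ass]) (auto simp: superlevel_def)
  finally show ?thesis .
qed

subsection \<open>De Giorgi iteration\<close>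

text \<open>The common gauge of the two phases: the energy per unit measure of a profile of height
  \<open>h\<close> at length \<open>r\<close>, with the coefficient frozen to
  \<open>a0\<close>.\<close>

definition phase_scale :: "real \<Rightarrow> real \<Rightarrow> real \<Rightarrow> real" where
  "phase_scale a0 r h = h powr p * r powr (- (s * p)) + a0 * h powr q * r powr (- (t * q))"

lemma phase_scale_pos: "0 \<le> a0 \<Longrightarrow> 0 < r \<Longrightarrow> 0 < h \<Longrightarrow> 0 < phase_scale a0 r h"
  unfolding phase_scale_def by (intro add_pos_nonneg) auto

text \<open>On bounded heights the larger power costs only a constant; through this the supremum of
  \<open>u\<close> enters.\<close>

lemma powr_le_mult_powr:
  fixes h b :: real
  assumes "0 \<le> h" "h \<le> b" "p' \<le> q'" shows "h powr q' \<le> b powr (q' - p') * h powr p'"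
proof -
  have "h powr q' = h powr (q' - p') * h powr p'" by (simp add: powr_add[symmetric])
  also have "\<dots> \<le> b powr (q' - p') * h powr p'"
    using assms by (intro mult_right_mono powr_mono2) auto
  finally show ?thesis .
qed

text \<open>For \<open>\<kappa> \<le> 1\<close> each phase scales by a factor between
  \<open>\<kappa> powr q\<close> and \<open>\<kappa> powr p\<close>. The bound from above produces
  the gain in \<open>first_step\<close>, the one from below limits the loss in each
  iteration.\<close>

lemma phase_scale_scale:
  assumes "0 \<le> a0" "0 \<le> \<kappa>" "\<kappa> \<le> 1" "0 \<le> h"
  shows "phase_scale a0 r (\<kappa> * h) \<le> \<kappa> powr p * phase_scale a0 r h" "\<kappa> powr q * phase_scale a0 r h \<le> phase_scale a0 r (\<kappa> * h)"
proof -
  have qp: "\<kappa> powr q \<le> \<kappa> powr p" using powr_le_mult_powr[of \<kappa> 1 p q] assms p_le_q by simp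
  have "\<kappa> powr q * (a0 * h powr q * r powr (- (t * q))) \<le> \<kappa> powr p * (a0 * h powr q * r powr (- (t * q)))"
    using qp assms by (intro mult_right_mono) auto
  then show "phase_scale a0 r (\<kappa> * h) \<le> \<kappa> powr p * phase_scale a0 r h"
    using assms by (simp add: phase_scale_def powr_mult algebra_simps)
  have "\<kappa> powr q * (h powr p * r powr (- (s * p))) \<le> \<kappa> powr p * (h powr p * r powr (- (s * p)))"
    using qp assms by (intro mult_right_mono) auto
  then show "\<kappa> powr q * phase_scale a0 r h \<le> phase_scale a0 r (\<kappa> * h)"
    using assms by (simp add: phase_scale_def powr_mult algebra_simps)
qed

section \<open>Freezing the coefficient at the centre\<close>

lemma ker_tq_le_far: "1 \<le> d x y \<Longrightarrow> ker (t * q) x y \<le> ker (s * p) x y"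
  unfolding ker_def using sp_le_tq by (intro powr_mono) auto

lemma ker_tq_le_near: "0 < d x y \<Longrightarrow> d x y \<le> 1 \<Longrightarrow> d x y powr \<alpha> * ker (t * q) x y \<le> ker (s * p) x y"
  unfolding ker_def powr_add[symmetric] using tq_le by (intro powr_mono') auto

lemma powr_alpha_mult_le: "0 < b \<Longrightarrow> 1 \<le> N \<Longrightarrow> (N * b) powr \<alpha> \<le> N * b powr \<alpha>" for b N :: real
  using powr_mono[OF \<alpha>_le_1, of N] \<alpha>_pos by (simp add: powr_mult mult_right_mono)

lemma modulating_diff:
  assumes a: "modulating a" and "d x x0 + d y x0 \<le> N * b" "0 < b" "1 \<le> N"
  shows "\<bar>a x y - a x0 x0\<bar> \<le> A * (N * b powr \<alpha>)"
proof -
  have "\<bar>a x y - a x0 x0\<bar> \<le> A * (d x x0 + d y x0) powr \<alpha>" using a by (simp add: modulating_def)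
  also have "\<dots> \<le> A * (N * b) powr \<alpha>"
    using assms A_nonneg \<alpha>_pos dist_nonneg by (intro mult_left_mono powr_mono2) auto
  also have "\<dots> \<le> A * (N * b powr \<alpha>)"
    using powr_alpha_mult_le[OF assms(3,4)] A_nonneg by (intro mult_left_mono)
  finally show ?thesis .
qed

text \<open>This is where \<open>t q \<le> s p + \<alpha>\<close> enters for long-range interactions.\<close>

lemma modulating_ker_far:
  assumes a: "modulating a" and xy: "0 < d x y" "d x0 x \<le> d x y"
  shows "a x y * ker (t * q) x y \<le> a x0 x0 * ker (t * q) x y + (3 * A + L) * ker (s * p) x y"
proof (cases "d x y \<le> 1")
  case True
  have "d x x0 + d y x0 \<le> 3 * d x y"
    using xy dist_triangle[of y x0 x] dist_sym[of y x] dist_sym[of x x0] by linarith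
  then have "a x y \<le> a x0 x0 + 3 * A * d x y powr \<alpha>"
    using modulating_diff[OF a, of x x0 y 3 "d x y"] xy by simp
  then have "a x y * ker (t * q) x y \<le> (a x0 x0 + 3 * A * d x y powr \<alpha>) * ker (t * q) x y"
    by (intro mult_right_mono) auto
  also have "\<dots> = a x0 x0 * ker (t * q) x y + 3 * A * (d x y powr \<alpha> * ker (t * q) x y)"
    by (simp add: algebra_simps)
  also have "\<dots> \<le> a x0 x0 * ker (t * q) x y + 3 * A * ker (s * p) x y"
    using ker_tq_le_near[OF xy(1) True] A_nonneg by (intro add_left_mono mult_left_mono) auto
  also have "\<dots> \<le> a x0 x0 * ker (t * q) x y + (3 * A + L) * ker (s * p) x y"
    using L_nonneg by (intro add_left_mono mult_right_mono) auto
  finally show ?thesis .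
next
  case False
  \<comment> \<open>At distances above 1 the kernel of the \<open>q\<close>-phase is the smaller
    one, so the sup bound of the coefficient suffices.\<close>
  have "a x y * ker (t * q) x y \<le> L * ker (s * p) x y"
    using False modulating_le[OF a] modulating_nonneg[OF a] ker_tq_le_far[of x y] L_nonneg
    by (intro mult_mono) auto
  also have "\<dots> \<le> (3 * A + L) * ker (s * p) x y" using A_nonneg by (intro mult_right_mono) auto
  finally show ?thesis using modulating_nonneg[OF a, of x0 x0] by (simp add: add_increasing)
qed

text \<open>For \<open>d x y < r\<close> the distances of \<open>x\<close> and \<open>y\<close> to
  the centre add up to at most \<open>3 * r\<close>, which gives the error
  \<open>3 * A * r powr \<alpha>\<close>. For \<open>d x y \<ge> r\<close> the truncated slope is 1
  and \<open>modulating_ker_far\<close> moves the error to the kernel of the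
  \<open>p\<close>-phase.\<close>

lemma slope_dens_le:
  assumes a: "modulating a" and r: "0 < r" "r \<le> 1" and k: "0 < k" and x: "d x0 x < r" and xy: "0 < d x y"
  shows "energy_density a (k * min (d x y / r) 1) x y
    \<le> k powr p * (min (d x y / r) 1 powr p * ker (s * p) x y)
      + k powr q * ((a x0 x0 + 3 * A * r powr \<alpha>) * (min (d x y / r) 1 powr q * ker (t * q) x y)
         + (3 * A + L) * (ker (s * p) x y * indicator {y. r \<le> d x y} y))"
proof -
  let ?m = "min (d x y / r) 1"
  have "a x y * (?m powr q * ker (t * q) x y)
     \<le> (a x0 x0 + 3 * A * r powr \<alpha>) * (?m powr q * ker (t * q) x y)
         + (3 * A + L) * (ker (s * p) x y * indicator {y. r \<le> d x y} y)"
  proof (cases "r \<le> d x y")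
    case True
    then have "?m = 1" using r by (simp add: min_def)
    moreover have "a x y * ker (t * q) x y \<le> a x0 x0 * ker (t * q) x y + (3 * A + L) * ker (s * p) x y"
      using modulating_ker_far[OF a xy, of x0] x True by simp
    moreover have "0 \<le> 3 * A * r powr \<alpha> * ker (t * q) x y" using A_nonneg by simp
    ultimately show ?thesis using True by (simp add: distrib_right)
  next
    case False
    have "d x x0 + d y x0 \<le> 3 * r"
      using x False dist_triangle[of y x0 x] dist_sym[of y x] dist_sym[of x x0] by linarith
    then have "a x y \<le> a x0 x0 + 3 * A * r powr \<alpha>"
      using modulating_diff[OF a, of x x0 y 3 r] r by simp
    then have "a x y * (?m powr q * ker (t * q) x y) \<le> (a x0 x0 + 3 * A * r powr \<alpha>) * (?m powr q * ker (t * q) x y)"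
      by (intro mult_right_mono) auto
    then show ?thesis using False by simp
  qed
  then have "k powr q * (a x y * (?m powr q * ker (t * q) x y))
     \<le> k powr q * ((a x0 x0 + 3 * A * r powr \<alpha>) * (?m powr q * ker (t * q) x y)
         + (3 * A + L) * (ker (s * p) x y * indicator {y. r \<le> d x y} y))"
    by (intro mult_left_mono) auto
  moreover have "energy_density a (k * ?m) x y = k powr p * (?m powr p * ker (s * p) x y) + k powr q * (a x y * (?m powr q * ker (t * q) x y))"
    using k r xy by (simp add: energy_density_def powr_mult min_def)
  ultimately show ?thesis by simp
qed

text \<open>The exponent condition at the scale of the ball: \<open>r powr \<alpha>\<close> pays for
  the gap between \<open>t * q\<close> and \<open>s * p\<close>.\<close>

lemma r_powr_le: "0 < r \<Longrightarrow> r \<le> 1 \<Longrightarrow> r powr \<alpha> * r powr (- (t * q)) \<le> r powr (- (s * p))"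
  unfolding powr_add[symmetric] using tq_le by (intro powr_mono') auto

lemma slope_integral:
  obtains C where "0 \<le> C" "\<And>a r k x0 x. \<lbrakk>modulating a; 0 < r; r \<le> 1; 0 < k; k \<le> 2 * M; d x0 x < r\<rbrakk> \<Longrightarrow>
    (\<integral>\<^sup>+ y. ennreal (energy_density a (k * min (d x y / r) 1) x y) \<partial>\<mu>) \<le> ennreal (C * phase_scale (a x0 x0) r k)"
proof -
  have s1: "s < 1" "0 < p" "0 < q" using s_le_t t_lt_1 p_gt_1 q_gt_1 by auto
  from kernel_truncated[OF s_pos s1(1,2), folded ker_def] obtain C1 where C1: "0 \<le> C1" "\<And>x r. 0 < r \<Longrightarrow>
    (\<integral>\<^sup>+ y. ennreal (min (d x y / r) 1 powr p * ker (s * p) x y) \<partial>\<mu>) \<le> ennreal (C1 * r powr (- (s * p)))"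
    by blast
  from kernel_truncated[OF t_pos t_lt_1 s1(3), folded ker_def] obtain C2 where C2: "0 \<le> C2" "\<And>x r. 0 < r \<Longrightarrow>
    (\<integral>\<^sup>+ y. ennreal (min (d x y / r) 1 powr q * ker (t * q) x y) \<partial>\<mu>) \<le> ennreal (C2 * r powr (- (t * q)))"
    by blast
  from kernel_far[OF sp_pos, folded ker_def] obtain C3 where C3: "0 \<le> C3" "\<And>x r. 0 < r \<Longrightarrow>
    (\<integral>\<^sup>+ y. ennreal (ker (s * p) x y) * indicator {y. r \<le> d x y} y \<partial>\<mu>) \<le> ennreal (C3 * r powr (- (s * p)))"
    by blast
  let ?C = "C1 + C2 + (2 * M) powr (q - p) * (3 * A * C2 + (3 * A + L) * C3)"
  show ?thesis
  proof
    show "0 \<le> ?C" using C1(1) C2(1) C3(1) A_nonneg L_nonneg by simp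
    fix a r k x0 x
    assume a: "modulating a" and r: "0 < r" "r \<le> 1" and k: "0 < k" "k \<le> 2 * M" and x: "d x0 x < r"
    define f1 where "f1 = (\<lambda>y. min (d x y / r) 1 powr p * ker (s * p) x y)"
    define f2 where "f2 = (\<lambda>y. min (d x y / r) 1 powr q * ker (t * q) x y)"
    define f3 where "f3 = (\<lambda>y. ker (s * p) x y * indicator {y. r \<le> d x y} y :: real)"
    define K1 where "K1 = k powr p"
    define K2 where "K2 = k powr q * (a x0 x0 + 3 * A * r powr \<alpha>)"
    define K3 where "K3 = k powr q * (3 * A + L)"
    have K: "0 \<le> K1" "0 \<le> K2" "0 \<le> K3"
      using modulating_nonneg[OF a, of x0 x0] A_nonneg L_nonneg by (auto simp: K1_def K2_def K3_def)
    have [measurable]: "{y. r \<le> d x y} \<in> sets \<mu>" by (rule sets_Collect_mu) measurable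
    have [measurable]: "f1 \<in> borel_measurable \<mu>" "f2 \<in> borel_measurable \<mu>" "f3 \<in> borel_measurable \<mu>"
      unfolding f1_def f2_def f3_def by measurable
    have fn: "0 \<le> f1 y" "0 \<le> f2 y" "0 \<le> f3 y" for y by (auto simp: f1_def f2_def f3_def)
    have "(\<integral>\<^sup>+ y. ennreal (energy_density a (k * min (d x y / r) 1) x y) \<partial>\<mu>)
       \<le> (\<integral>\<^sup>+ y. ennreal K1 * ennreal (f1 y) + ennreal K2 * ennreal (f2 y) + ennreal K3 * ennreal (f3 y) \<partial>\<mu>)"
    proof (rule nn_integral_mono_AE, use null_point[of x] in \<open>rule AE_mp, intro AE_I2 impI\<close>)
      fix y assume "0 < d x y"
      from slope_dens_le[OF a r k(1) x this]
      have "energy_density a (k * min (d x y / r) 1) x y \<le> K1 * f1 y + K2 * f2 y + K3 * f3 y"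
        unfolding K1_def K2_def K3_def f1_def f2_def f3_def by (simp add: algebra_simps)
      then show "ennreal (energy_density a (k * min (d x y / r) 1) x y)
        \<le> ennreal K1 * ennreal (f1 y) + ennreal K2 * ennreal (f2 y) + ennreal K3 * ennreal (f3 y)"
        using K fn[of y] by (simp add: ennreal_mult[symmetric] ennreal_plus[symmetric] ennreal_leI del: ennreal_plus)
    qed
    also have "\<dots> = ennreal K1 * (\<integral>\<^sup>+ y. ennreal (f1 y) \<partial>\<mu>) + ennreal K2 * (\<integral>\<^sup>+ y. ennreal (f2 y) \<partial>\<mu>)
       + ennreal K3 * (\<integral>\<^sup>+ y. ennreal (f3 y) \<partial>\<mu>)"
      by (simp add: nn_integral_add nn_integral_cmult)
    also have "\<dots> \<le> ennreal K1 * ennreal (C1 * r powr (- (s * p))) + ennreal K2 * ennreal (C2 * r powr (- (t * q)))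
       + ennreal K3 * ennreal (C3 * r powr (- (s * p)))"
    proof (intro add_mono mult_left_mono)
      have "ennreal (f3 y) = ennreal (ker (s * p) x y) * indicator {y. r \<le> d x y} y" for y
        by (simp add: f3_def indicator_def)
      then show "(\<integral>\<^sup>+ y. ennreal (f3 y) \<partial>\<mu>) \<le> ennreal (C3 * r powr (- (s * p)))"
        using C3(2)[OF r(1), of x] by simp
    qed (use C1(2)[OF r(1), of x] C2(2)[OF r(1), of x] in \<open>auto simp: f1_def f2_def\<close>)
    also have "\<dots> = ennreal (K1 * (C1 * r powr (- (s * p))) + K2 * (C2 * r powr (- (t * q))) + K3 * (C3 * r powr (- (s * p))))"
      using K C1(1) C2(1) C3(1) by (simp add: ennreal_mult ennreal_plus)
    also have "\<dots> \<le> ennreal (?C * phase_scale (a x0 x0) r k)"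
    proof (rule ennreal_leI)
      let ?P = "r powr (- (s * p))" and ?T = "r powr (- (t * q))" and ?a0 = "a x0 x0" and ?b = "(2 * M) powr (q - p)"
      have kq: "k powr q \<le> ?b * k powr p" using k p_le_q by (intro powr_le_mult_powr) auto
      have a0: "0 \<le> ?a0" using modulating_nonneg[OF a] .
      have G: "phase_scale ?a0 r k = k powr p * ?P + ?a0 * k powr q * ?T" by (simp add: phase_scale_def)
      have nn: "0 \<le> k powr p * ?P" "0 \<le> ?a0 * k powr q * ?T" using a0 by auto
      have e1: "K1 * (C1 * ?P) \<le> C1 * phase_scale ?a0 r k"
        using mult_left_mono[OF _ C1(1), of "k powr p * ?P" "phase_scale ?a0 r k"] nn by (simp add: G K1_def mult_ac)
      have e2: "k powr q * ?a0 * (C2 * ?T) \<le> C2 * phase_scale ?a0 r k"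
        using mult_left_mono[OF _ C2(1), of "?a0 * k powr q * ?T" "phase_scale ?a0 r k"] nn by (simp add: G mult_ac)
      have kP: "k powr q * ?P \<le> ?b * phase_scale ?a0 r k"
      proof -
        have "k powr q * ?P \<le> ?b * (k powr p * ?P)" using mult_right_mono[OF kq, of ?P] by (simp add: mult_ac)
        also have "\<dots> \<le> ?b * phase_scale ?a0 r k" using nn by (intro mult_left_mono) (auto simp: G)
        finally show ?thesis .
      qed
      have e3: "k powr q * (3 * A * r powr \<alpha>) * (C2 * ?T) \<le> 3 * A * C2 * (?b * phase_scale ?a0 r k)"
      proof -
        have "k powr q * (3 * A * r powr \<alpha>) * (C2 * ?T) = 3 * A * C2 * (k powr q * (r powr \<alpha> * ?T))" by (simp add: mult_ac)
        also have "\<dots> \<le> 3 * A * C2 * (k powr q * ?P)"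
          using r_powr_le[OF r] A_nonneg C2(1) by (intro mult_left_mono) auto
        also have "\<dots> \<le> 3 * A * C2 * (?b * phase_scale ?a0 r k)"
          using kP A_nonneg C2(1) by (intro mult_left_mono) auto
        finally show ?thesis .
      qed
      have e4: "K3 * (C3 * ?P) \<le> (3 * A + L) * C3 * (?b * phase_scale ?a0 r k)"
      proof -
        have "K3 * (C3 * ?P) = (3 * A + L) * C3 * (k powr q * ?P)" by (simp add: K3_def mult_ac)
        also have "\<dots> \<le> (3 * A + L) * C3 * (?b * phase_scale ?a0 r k)"
          using kP A_nonneg L_nonneg C3(1) by (intro mult_left_mono) auto
        finally show ?thesis .
      qed
      have "K2 * (C2 * ?T) = k powr q * ?a0 * (C2 * ?T) + k powr q * (3 * A * r powr \<alpha>) * (C2 * ?T)"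
        by (simp add: K2_def algebra_simps)
      then have "K1 * (C1 * ?P) + K2 * (C2 * ?T) + K3 * (C3 * ?P)
        \<le> C1 * phase_scale ?a0 r k + C2 * phase_scale ?a0 r k + 3 * A * C2 * (?b * phase_scale ?a0 r k) + (3 * A + L) * C3 * (?b * phase_scale ?a0 r k)"
        using e1 e2 e3 e4 by linarith
      then show "K1 * (C1 * ?P) + K2 * (C2 * ?T) + K3 * (C3 * ?P) \<le> ?C * phase_scale ?a0 r k"
        by (simp add: algebra_simps)
    qed
    finally show "(\<integral>\<^sup>+ y. ennreal (energy_density a (k * min (d x y / r) 1) x y) \<partial>\<mu>) \<le> ennreal (?C * phase_scale (a x0 x0) r k)" .
  qed
qed

text \<open>The jump is at least \<open>h\<close> and the test increment at least \<open>e\<close>,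
  so each phase contributes \<open>h powr l * (e / h)\<close> times its kernel. The factor
  \<open>(r / \<rho>) powr (s * p)\<close> is the surplus of the kernel at distance
  \<open>\<rho>\<close> over the scale \<open>r\<close>, the source of the superlinear
  decay.\<close>

lemma flux_ge:
  assumes a: "modulating a" and r: "0 < r" "r \<le> 1" and \<rho>: "0 < \<rho>" "\<rho> \<le> 2 * r"
    and x: "d x0 x < r" and xy: "0 < d x y" "d x y < \<rho>"
    and h: "0 < h" "h \<le> 2 * M" "h \<le> g" and e: "0 \<le> e" "e \<le> e'"
  shows "2 powr (- q) / (1 + 4 * A * (2 * M) powr (q - p)) * (e / h) * phase_scale (a x0 x0) r h * (r / \<rho>) powr (s * p) * \<rho> powr (- Q)
    \<le> flux a g e' x y"
proof -
  let ?b = "(2 * M) powr (q - p)" and ?P = "r powr (- (s * p))" and ?T = "r powr (- (t * q))" and ?a0 = "a x0 x0"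
  let ?\<sigma> = "(r / \<rho>) powr (s * p)" and ?N = "1 + 4 * A * (2 * M) powr (q - p)"
  have a': "0 \<le> a x y" using modulating_nonneg[OF a] .
  have J: "h powr l * (e / h) \<le> Jpow l g * e'" if "1 < l" for l
  proof -
    have "h powr (l - 1) \<le> Jpow l g"
    proof -
      have "h powr (l - 1) \<le> \<bar>g\<bar> powr (l - 1)" using h that by (intro powr_mono2) auto
      also have "\<dots> = \<bar>Jpow l g\<bar>" by (simp add: abs_Jpow)
      also have "\<dots> = Jpow l g" using Jpow_nonneg[of g l] h by simp
      finally show ?thesis .
    qed
    then have "h powr (l - 1) * e \<le> Jpow l g * e'" using e h Jpow_nonneg[of g l] by (intro mult_mono) auto
    moreover have "h powr l * (e / h) = h powr (l - 1) * e" using h by (simp add: powr_diff)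
    ultimately show ?thesis by simp
  qed
  have ker: "\<rho> powr (- Q) * \<rho> powr (- \<gamma>) \<le> ker \<gamma> x y" if "0 < \<gamma>" for \<gamma>
    unfolding ker_def powr_add[symmetric] using xy Q_pos that
    by (simp add: powr_mono2' add.commute[of _ "- \<gamma>"])
  have kp: "\<rho> powr (- (s * p)) = ?\<sigma> * ?P"
    using r \<rho> by (simp add: powr_divide powr_minus field_simps)
  \<comment> \<open>Since \<open>r / \<rho> \<ge> 1/2\<close>, the surplus of the
    \<open>q\<close>-kernel is at least \<open>2 powr (- q)\<close> times that of the
    \<open>p\<close>-kernel, so one factor serves both phases.\<close>
  have kq: "2 powr (- q) * (?\<sigma> * ?T) \<le> \<rho> powr (- (t * q))"
  proof -
    have "(2 * r / \<rho>) powr (s * p) \<le> (2 * r / \<rho>) powr (t * q)"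
      using \<rho> sp_le_tq by (intro powr_mono) (auto simp: field_simps)
    then have "2 powr (s * p) * ?\<sigma> \<le> 2 powr (t * q) * (r / \<rho>) powr (t * q)"
      using powr_mult[of 2 "r / \<rho>"] r \<rho> by simp
    moreover have "1 * ?\<sigma> \<le> 2 powr (s * p) * ?\<sigma>"
      using sp_pos by (intro mult_right_mono) (auto simp: ge_one_powr_ge_zero)
    ultimately have "?\<sigma> \<le> 2 powr (t * q) * (r / \<rho>) powr (t * q)" by linarith
    also have "\<dots> \<le> 2 powr q * (r / \<rho>) powr (t * q)"
      using t_lt_1 q_gt_1 t_pos by (intro mult_right_mono powr_mono) auto
    finally have "?\<sigma> \<le> 2 powr q * (r / \<rho>) powr (t * q)" .
    then have "?\<sigma> * ?T \<le> 2 powr q * ((r / \<rho>) powr (t * q) * ?T)"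
      unfolding mult.assoc[symmetric] by (rule mult_right_mono) simp
    also have "(r / \<rho>) powr (t * q) * ?T = \<rho> powr (- (t * q))"
      using r \<rho> by (simp add: powr_divide powr_minus field_simps)
    finally have "2 powr (- q) * (?\<sigma> * ?T) \<le> 2 powr (- q) * (2 powr q * \<rho> powr (- (t * q)))"
      by (rule mult_left_mono) simp
    also have "\<dots> = (2 powr (- q) * 2 powr q) * \<rho> powr (- (t * q))" by (simp only: mult.assoc)
    also have "\<dots> = \<rho> powr (- (t * q))" unfolding powr_add[symmetric] by simp
    finally show ?thesis .
  qed
  have GN: "phase_scale ?a0 r h \<le> ?N * (h powr p * ?P + a x y * h powr q * ?T)"
  proof -
    have "d x x0 + d y x0 \<le> 4 * r"
      using x xy \<rho> dist_triangle[of y x0 x] dist_sym[of y x] dist_sym[of x x0] by linarith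
    then have "?a0 \<le> a x y + 4 * A * r powr \<alpha>"
      using modulating_diff[OF a, of x x0 y 4 r] r by simp
    then have "?a0 * (h powr q * ?T) \<le> (a x y + 4 * A * r powr \<alpha>) * (h powr q * ?T)"
      by (intro mult_right_mono) auto
    moreover have "4 * A * h powr q * (r powr \<alpha> * ?T) \<le> 4 * A * (?b * h powr p) * ?P"
      using r_powr_le[OF r] powr_le_mult_powr[of h "2 * M" p q] h p_le_q A_nonneg
      by (intro mult_mono mult_left_mono) auto
    moreover have "0 \<le> 4 * A * ?b * (a x y * h powr q * ?T)" using a' A_nonneg by simp
    ultimately show ?thesis by (simp add: phase_scale_def algebra_simps)
  qed
  have N: "0 < ?N" using A_nonneg by (simp add: add_pos_nonneg)
  have "2 powr (- q) / ?N * (e / h) * phase_scale ?a0 r h * ?\<sigma> * \<rho> powr (- Q)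
     = (2 powr (- q) * (e / h) * ?\<sigma> * \<rho> powr (- Q)) * (phase_scale ?a0 r h / ?N)" by (simp add: mult_ac)
  also have "\<dots> \<le> (2 powr (- q) * (e / h) * ?\<sigma> * \<rho> powr (- Q)) * (h powr p * ?P + a x y * h powr q * ?T)"
    using GN N e h by (intro mult_left_mono) (auto simp: field_simps)
  also have "\<dots> = (h powr p * (e / h)) * (\<rho> powr (- Q) * (2 powr (- q) * (?\<sigma> * ?P)))
     + a x y * (h powr q * (e / h)) * (\<rho> powr (- Q) * (2 powr (- q) * (?\<sigma> * ?T)))" by (simp add: algebra_simps)
  also have "\<dots> \<le> (h powr p * (e / h)) * (\<rho> powr (- Q) * \<rho> powr (- (s * p)))
     + a x y * (h powr q * (e / h)) * (\<rho> powr (- Q) * \<rho> powr (- (t * q)))"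
  proof -
    have "2 powr (- q) * (?\<sigma> * ?P) \<le> 1 * (?\<sigma> * ?P)"
      using q_gt_1 by (intro mult_right_mono) (auto simp: powr_minus ge_one_powr_ge_zero inverse_le_1_iff)
    then have "2 powr (- q) * (?\<sigma> * ?P) \<le> \<rho> powr (- (s * p))" using kp by simp
    then show ?thesis using kq e h a' by (intro add_mono mult_left_mono) auto
  qed
  also have "\<dots> \<le> (Jpow p g * e') * ker (s * p) x y + a x y * (Jpow q g * e') * ker (t * q) x y"
  proof (rule add_mono)
    have e': "0 \<le> Jpow l g * e'" for l using Jpow_nonneg[of g l] h e by simp
    show "(h powr p * (e / h)) * (\<rho> powr (- Q) * \<rho> powr (- (s * p))) \<le> (Jpow p g * e') * ker (s * p) x y"
      by (rule mult_mono[OF J[OF p_gt_1] ker[OF sp_pos] e']) simp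
    have "(h powr q * (e / h)) * (\<rho> powr (- Q) * \<rho> powr (- (t * q))) \<le> (Jpow q g * e') * ker (t * q) x y"
      by (rule mult_mono[OF J[OF q_gt_1] ker e']) (use t_pos q_gt_1 in auto)
    then show "a x y * (h powr q * (e / h)) * (\<rho> powr (- Q) * \<rho> powr (- (t * q)))
        \<le> a x y * (Jpow q g * e') * ker (t * q) x y"
      unfolding mult.assoc using a' by (intro mult_left_mono) (auto simp: mult.assoc)
  qed
  also have "\<dots> = flux a g e' x y" by (simp add: flux_def)
  finally show ?thesis .
qed

text \<open>The last clause measures the tail beyond \<open>R\<close> on the scale of the cone
  itself: multiplied by the height \<open>k\<close> of the test function it costs at most
  \<open>phase_scale\<close> at height \<open>k\<close>, the same order as the slope.\<close>

definition growth_hyp :: "('a \<Rightarrow> 'a \<Rightarrow> real) \<Rightarrow> 'a set \<Rightarrow> ('a \<Rightarrow> real) \<Rightarrow> 'a \<Rightarrow> real \<Rightarrow> real \<Rightarrow> real \<Rightarrow> real \<Rightarrow> bool" where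
  "growth_hyp a \<Omega> u x0 r R S k \<longleftrightarrow> modulating a \<and> weak_sol a \<Omega> u \<and> 0 < r \<and> r \<le> 1 \<and> 2 * r \<le> R \<and>
     {x. d x0 x < r} \<subseteq> \<Omega> \<and> (AE x in \<mu>. d x0 x < R \<longrightarrow> u x \<le> S) \<and> 0 < k \<and> k \<le> 2 * M \<and>
     (\<forall>x. d x0 x < r \<longrightarrow> (\<integral>\<^sup>+ y. ennreal (indicator {y. R \<le> d x0 y} y * tail_dens a (\<bar>u y - S\<bar> + k) x y) \<partial>\<mu>)
        \<le> ennreal (phase_scale (a x0 x0) r k / k))"

section \<open>Interaction between level sets\<close>

lemma emeasure_super:
  assumes "u \<in> borel_measurable \<mu>" "0 < r"
  shows "emeasure \<mu> (superlevel u m k x0 r) = ennreal (measure \<mu> (superlevel u m k x0 r))"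
    "measure \<mu> (superlevel u m k x0 r) \<le> c * r powr Q"
proof -
  have "emeasure \<mu> (superlevel u m k x0 r) \<le> ennreal (c * r powr Q)"
    unfolding emeasure_ball[OF assms(2), of x0, symmetric] by (rule emeasure_mono) (auto simp: superlevel_def)
  moreover from this show eq: "emeasure \<mu> (superlevel u m k x0 r) = ennreal (measure \<mu> (superlevel u m k x0 r))"
    by (intro emeasure_eq_ennreal_measure) (auto simp: top_unique)
  ultimately show "measure \<mu> (superlevel u m k x0 r) \<le> c * r powr Q"
    using c_pos by simp
qed

lemma superlevel_mono: "m' \<le> m \<Longrightarrow> superlevel u m k x0 r \<subseteq> superlevel u m' k x0 r"
  by (auto simp: superlevel_def barrier_def)

lemma excess_ge: "d x0 x < r \<Longrightarrow> e \<le> u x - barrier m k x0 r x \<Longrightarrow> e \<le> excess u m k x0 r x"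
  by (simp add: excess_def)

lemma measure_super_mono:
  assumes "u \<in> borel_measurable \<mu>" "0 < r" "m' \<le> m"
  shows "measure \<mu> (superlevel u m k x0 r) \<le> measure \<mu> (superlevel u m' k x0 r)"
  using assms emeasure_super(1)[OF assms(1,2), of m' k x0]
  by (intro measure_mono_fmeasurable superlevel_mono fmeasurableI superlevel_sets) auto

text \<open>\<open>X\<close> is a high set and \<open>Y\<close> a low one; \<open>h\<close> is the
  jump of \<open>u\<close> between them, \<open>e\<close> that of the excess, and \<open>b\<close>
  the measure of \<open>Y\<close> near a point of \<open>X\<close> in units of
  \<open>\<rho> powr Q\<close>. A predicate of \<open>C\<close> alone fixes the constant before
  coefficient, solution and geometry.\<close>

definition cross_bound :: "real \<Rightarrow> bool" where
  "cross_bound C \<longleftrightarrow> (\<forall>a \<Omega> u x0 r R S k m X Y \<rho> h e b.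
     growth_hyp a \<Omega> u x0 r R S k \<and> S - k \<le> m \<and> X \<in> sets \<mu> \<and> X \<subseteq> {x. d x0 x < r} \<and> Y \<in> sets \<mu> \<and>
     0 < \<rho> \<and> \<rho> \<le> 2 * r \<and> 0 < h \<and> h \<le> 2 * M \<and> 0 \<le> e \<and> 0 \<le> b \<and>
     (\<forall>x\<in>X. \<forall>y\<in>Y. d x y < \<rho> \<longrightarrow> h \<le> u x - u y \<and> e \<le> excess u m k x0 r x - excess u m k x0 r y) \<and>
     (\<forall>x\<in>X. ennreal (b * \<rho> powr Q) \<le> emeasure \<mu> (Y \<inter> {y. d x y < \<rho>})) \<longrightarrow>
     b * (e / h) * phase_scale (a x0 x0) r h * (r / \<rho>) powr (s * p) * measure \<mu> X
      \<le> C * phase_scale (a x0 x0) r k * measure \<mu> (superlevel u m k x0 r))"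

lemma cross_boundD:
  assumes "cross_bound C" "growth_hyp a \<Omega> u x0 r R S k" "S - k \<le> m" "X \<in> sets \<mu>" "X \<subseteq> {x. d x0 x < r}" "Y \<in> sets \<mu>"
     "0 < \<rho>" "\<rho> \<le> 2 * r" "0 < h" "h \<le> 2 * M" "0 \<le> e" "0 \<le> b"
     "\<And>x y. x \<in> X \<Longrightarrow> y \<in> Y \<Longrightarrow> d x y < \<rho> \<Longrightarrow> h \<le> u x - u y"
     "\<And>x y. x \<in> X \<Longrightarrow> y \<in> Y \<Longrightarrow> d x y < \<rho> \<Longrightarrow> e \<le> excess u m k x0 r x - excess u m k x0 r y"
     "\<And>x. x \<in> X \<Longrightarrow> ennreal (b * \<rho> powr Q) \<le> emeasure \<mu> (Y \<inter> {y. d x y < \<rho>})"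
  shows "b * (e / h) * phase_scale (a x0 x0) r h * (r / \<rho>) powr (s * p) * measure \<mu> X
      \<le> C * phase_scale (a x0 x0) r k * measure \<mu> (superlevel u m k x0 r)"
  by (rule assms(1)[unfolded cross_bound_def, rule_format, of a \<Omega> u x0 r R S k m X Y \<rho> h e b])
    (intro conjI ballI impI assms; assumption)

text \<open>The same positive part is bounded from below by integrating \<open>flux_ge\<close> over
  \<open>X \<times> Y\<close> and from above by \<open>energy\<close>. The factor
  \<open>\<rho> powr (- Q)\<close> of the kernel cancels the volume of the ball.\<close>

lemma energy_cross:
  obtains C where "0 < C" "cross_bound C"
proof -
  obtain C1 where C1: "0 \<le> C1" "\<And>a r k x0 x. \<lbrakk>modulating a; 0 < r; r \<le> 1; 0 < k; k \<le> 2 * M; d x0 x < r\<rbrakk> \<Longrightarrow>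
    (\<integral>\<^sup>+ y. ennreal (energy_density a (k * min (d x y / r) 1) x y) \<partial>\<mu>) \<le> ennreal (C1 * phase_scale (a x0 x0) r k)"
    using slope_integral by blast
  define c2 where "c2 = 2 powr (- q) / (1 + 4 * A * (2 * M) powr (q - p))"
  have c2: "0 < c2" using A_nonneg by (auto simp: c2_def intro!: divide_pos_pos add_pos_nonneg)
  show ?thesis
  proof
    show "0 < 2 * (C1 + 1) / c2" using C1(1) c2 by simp
    show "cross_bound (2 * (C1 + 1) / c2)"
      unfolding cross_bound_def
    proof (intro allI impI, elim conjE)
      fix a \<Omega> u x0 r R S k m X Y \<rho> h e b
      assume growth_hyp: "growth_hyp a \<Omega> u x0 r R S k" and m: "S - k \<le> m"
        and X: "X \<in> sets \<mu>" "X \<subseteq> {x. d x0 x < r}" and Y: "Y \<in> sets \<mu>" and \<rho>: "0 < \<rho>" "\<rho> \<le> 2 * r"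
        and h: "0 < h" "h \<le> 2 * M" and e: "0 \<le> e" and b: "0 \<le> b"
        and xy': "\<forall>x\<in>X. \<forall>y\<in>Y. d x y < \<rho> \<longrightarrow> h \<le> u x - u y \<and> e \<le> excess u m k x0 r x - excess u m k x0 r y"
        and bu': "\<forall>x\<in>X. ennreal (b * \<rho> powr Q) \<le> emeasure \<mu> (Y \<inter> {y. d x y < \<rho>})"
      have hu: "\<And>x y. x \<in> X \<Longrightarrow> y \<in> Y \<Longrightarrow> d x y < \<rho> \<Longrightarrow> h \<le> u x - u y"
        and eu: "\<And>x y. x \<in> X \<Longrightarrow> y \<in> Y \<Longrightarrow> d x y < \<rho> \<Longrightarrow> e \<le> excess u m k x0 r x - excess u m k x0 r y"
        and bu: "\<And>x. x \<in> X \<Longrightarrow> ennreal (b * \<rho> powr Q) \<le> emeasure \<mu> (Y \<inter> {y. d x y < \<rho>})"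
        using xy' bu' by blast+
      let ?G = "phase_scale (a x0 x0) r"
      have a: "modulating a" and sol: "weak_sol a \<Omega> u" and r: "0 < r" "r \<le> 1" and R: "2 * r \<le> R"
        and ball: "{x. d x0 x < r} \<subseteq> \<Omega>" and uS: "AE x in \<mu>. d x0 x < R \<longrightarrow> u x \<le> S"
        and k: "0 < k" "k \<le> 2 * M"
        and tail: "\<And>x. d x0 x < r \<Longrightarrow> (\<integral>\<^sup>+ y. ennreal (indicator {y. R \<le> d x0 y} y * tail_dens a (\<bar>u y - S\<bar> + k) x y) \<partial>\<mu>)
          \<le> ennreal (?G k / k)"
        using growth_hyp by (auto simp: growth_hyp_def)
      have u [measurable]: "u \<in> borel_measurable \<mu>" using sol by (simp add: weak_sol_def finite_energy_def)
      have a0: "0 \<le> a x0 x0" using modulating_nonneg[OF a] .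
      have Gk: "0 < ?G k" "0 < ?G h" using phase_scale_pos[OF a0 r(1)] k h by auto
      \<comment> \<open>\<open>C1\<close> comes from the slope, the extra 1 from the tail clause of
        \<open>growth_hyp\<close>.\<close>
      define E where "E = (C1 + 1) * ?G k"
      have E0: "0 \<le> E" using C1(1) Gk by (simp add: E_def)
      have loss: "(\<integral>\<^sup>+ y. ennreal (loss a u S k x0 r R x y) \<partial>\<mu>) \<le> ennreal E" if x: "d x0 x < r" for x
      proof -
        define f where "f = (\<lambda>y. energy_density a (k * min (d x y / r) 1) x y)"
        define g where "g = (\<lambda>y. indicator {y. R \<le> d x0 y} y * tail_dens a (\<bar>u y - S\<bar> + k) x y)"
        have [measurable]: "{y. R \<le> d x0 y} \<in> sets \<mu>" by (rule sets_Collect_mu) measurable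
        have [measurable]: "f \<in> borel_measurable \<mu>" unfolding f_def
          by (rule energy_density_measurable[OF a]) measurable
        have [measurable]: "(\<lambda>y. tail_dens a (\<bar>u y - S\<bar> + k) x y) \<in> borel_measurable \<mu>"
          by (rule tail_dens_measurable[OF a]) measurable
        have [measurable]: "g \<in> borel_measurable \<mu>" unfolding g_def by measurable
        have fg: "0 \<le> f y" "0 \<le> g y" for y
          using energy_density_nonneg[OF a] tail_dens_nonneg[OF a] by (auto simp: f_def g_def)
        have "loss a u S k x0 r R x y = f y + k * g y" for y by (simp add: loss_def f_def g_def)
        then have "(\<integral>\<^sup>+ y. ennreal (loss a u S k x0 r R x y) \<partial>\<mu>) = (\<integral>\<^sup>+ y. ennreal (f y) + ennreal k * ennreal (g y) \<partial>\<mu>)"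
          using fg k by (simp add: ennreal_mult ennreal_plus)
        also have "\<dots> = (\<integral>\<^sup>+ y. ennreal (f y) \<partial>\<mu>) + ennreal k * (\<integral>\<^sup>+ y. ennreal (g y) \<partial>\<mu>)"
          by (simp add: nn_integral_add nn_integral_cmult)
        also have "\<dots> \<le> ennreal (C1 * ?G k) + ennreal k * ennreal (?G k / k)"
          unfolding f_def g_def using C1(2)[OF a r k x] tail[OF x] by (intro add_mono mult_left_mono) auto
        also have "\<dots> = ennreal (C1 * ?G k + k * (?G k / k))"
          using C1(1) Gk k by (subst ennreal_plus) (simp_all only: ennreal_mult'' divide_nonneg_pos mult_nonneg_nonneg less_imp_le)
        also have "C1 * ?G k + k * (?G k / k) = E" using k by (simp add: E_def algebra_simps)
        finally show ?thesis .
      qed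
      define \<Theta> where "\<Theta> = c2 * (e / h) * ?G h * (r / \<rho>) powr (s * p) * \<rho> powr (- Q)"
      have \<Theta>0: "0 \<le> \<Theta>" using c2 e h Gk by (simp add: \<Theta>_def)
      have meas: "(\<lambda>z. flux a (u (fst z) - u (snd z)) (excess u m k x0 r (fst z) - excess u m k x0 r (snd z)) (fst z) (snd z))
         \<in> borel_measurable (\<mu> \<Otimes>\<^sub>M \<mu>)"
        by (rule flux_measurable[OF a]) measurable
      have "ennreal \<Theta> * ennreal (b * \<rho> powr Q) * emeasure \<mu> X
        \<le> (\<integral>\<^sup>+ z. ennreal (flux a (u (fst z) - u (snd z)) (excess u m k x0 r (fst z) - excess u m k x0 r (snd z)) (fst z) (snd z)) \<partial>(\<mu> \<Otimes>\<^sub>M \<mu>))"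
      proof (rule cross_integral_ge[OF meas X(1) Y _ bu])
        fix x y assume xy: "x \<in> X" "y \<in> Y" "0 < d x y" "d x y < \<rho>"
        show "\<Theta> \<le> flux a (u x - u y) (excess u m k x0 r x - excess u m k x0 r y) x y"
          unfolding \<Theta>_def c2_def
          by (rule flux_ge[OF a r \<rho> _ xy(3,4) h hu[OF xy(1,2,4)] e eu[OF xy(1,2,4)]]) (use X xy in auto)
      qed
      also have "\<dots> \<le> 2 * ennreal E * emeasure \<mu> (superlevel u m k x0 r)"
        by (rule energy[OF a sol r(1) R k(1) m ball uS loss])
      also have "emeasure \<mu> (superlevel u m k x0 r) = ennreal (measure \<mu> (superlevel u m k x0 r))"
        by (rule emeasure_super(1)[OF u r(1)])
      also have "emeasure \<mu> X = ennreal (measure \<mu> X)"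
      proof -
        have "emeasure \<mu> X \<le> emeasure \<mu> {x. d x0 x < r}" using X by (intro emeasure_mono) auto
        then show ?thesis using emeasure_ball[OF r(1), of x0]
          by (intro emeasure_eq_ennreal_measure) (auto simp: top_unique)
      qed
      finally have "ennreal (\<Theta> * (b * \<rho> powr Q) * measure \<mu> X) \<le> ennreal (2 * E * measure \<mu> (superlevel u m k x0 r))"
        using \<Theta>0 b E0 by (simp add: ennreal_mult)
      then have "\<Theta> * (b * \<rho> powr Q) * measure \<mu> X \<le> 2 * E * measure \<mu> (superlevel u m k x0 r)"
        using E0 by (subst (asm) ennreal_le_iff) auto
      moreover have "\<Theta> * (b * \<rho> powr Q) * measure \<mu> X = c2 * (b * (e / h) * ?G h * (r / \<rho>) powr (s * p) * measure \<mu> X) * (\<rho> powr (- Q) * \<rho> powr Q)"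
        by (simp add: \<Theta>_def mult_ac)
      moreover have "\<rho> powr (- Q) * \<rho> powr Q = 1" using \<rho> by (simp add: powr_add[symmetric])
      ultimately have "c2 * (b * (e / h) * ?G h * (r / \<rho>) powr (s * p) * measure \<mu> X)
         \<le> 2 * E * measure \<mu> (superlevel u m k x0 r)" by simp
      then show "b * (e / h) * ?G h * (r / \<rho>) powr (s * p) * measure \<mu> X
        \<le> 2 * (C1 + 1) / c2 * ?G k * measure \<mu> (superlevel u m k x0 r)"
        using c2 by (simp add: E_def pos_le_divide_eq algebra_simps)
    qed
  qed
qed

text \<open>Here the cross term is taken against the set where \<open>u \<le> S - \<omega> / 2\<close>, of at least half
  measure; the gain is the power \<open>p - 1 > 0\<close> of the slope.\<close>

lemma first_step:
  obtains C where "0 < C" "\<And>a \<Omega> u x0 r R S k \<omega>.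
    \<lbrakk>growth_hyp a \<Omega> u x0 r R S k; 0 < \<omega>; \<omega> \<le> 2 * M; 4 * k \<le> \<omega>;
      c * r powr Q / 2 \<le> measure \<mu> {y. d x0 y < r \<and> u y \<le> S - \<omega> / 2}\<rbrakk>
    \<Longrightarrow> measure \<mu> (superlevel u (S - k / 2) k x0 r) \<le> C * (k / \<omega>) powr (p - 1) * r powr Q"
proof -
  obtain C where C: "0 < C" "cross_bound C" by (rule energy_cross)
  \<comment> \<open>A ball of radius \<open>2 * r\<close> about any point of \<open>?X\<close>
    contains the whole low set, and \<open>b * (2 * r) powr Q = c * r powr Q / 2\<close>.\<close>
  define b where "b = c / 2 * 2 powr (- Q)"
  define \<sigma> :: real where "\<sigma> = (1 / 2) powr (s * p)"
  define D where "D = C * c * 4 powr p / (2 * b * \<sigma>)"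
  have b: "0 < b" and \<sigma>: "0 < \<sigma>" using c_pos by (auto simp: b_def \<sigma>_def)
  show ?thesis
  proof
    show "0 < D" using C(1) c_pos b \<sigma> by (simp add: D_def)
    fix a \<Omega> u x0 r R S k \<omega>
    assume growth_hyp: "growth_hyp a \<Omega> u x0 r R S k" and \<omega>: "0 < \<omega>" "\<omega> \<le> 2 * M" "4 * k \<le> \<omega>"
      and half: "c * r powr Q / 2 \<le> measure \<mu> {y. d x0 y < r \<and> u y \<le> S - \<omega> / 2}"
    have a: "modulating a" and r: "0 < r" and k: "0 < k" using growth_hyp by (auto simp: growth_hyp_def)
    have u [measurable]: "u \<in> borel_measurable \<mu>" using growth_hyp by (simp add: growth_hyp_def weak_sol_def finite_energy_def)
    let ?G = "phase_scale (a x0 x0) r"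
    let ?X = "superlevel u (S - k / 2) k x0 r" and ?Y = "{y. d x0 y < r \<and> u y \<le> S - \<omega> / 2}"
    have Ys: "?Y \<in> sets \<mu>" by (rule sets_Collect_mu) measurable
    have a0: "0 \<le> a x0 x0" using modulating_nonneg[OF a] .
    have Gp: "0 < ?G (\<omega> / 4)" using phase_scale_pos[OF a0 r] \<omega> by auto
    have Gk: "?G k \<le> (4 * k / \<omega>) powr p * ?G (\<omega> / 4)"
      using phase_scale_scale(1)[OF a0, of "4 * k / \<omega>" "\<omega> / 4" r] k \<omega> by (simp add: field_simps)
    \<comment> \<open>Jump \<open>\<omega> / 4\<close>: \<open>u\<close> exceeds
      \<open>S - k / 2\<close> on \<open>?X\<close> and is at most \<open>S - \<omega> / 2\<close>
      on \<open>?Y\<close>, while \<open>4 * k \<le> \<omega>\<close>. Excess \<open>k / 2\<close>: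
      the test level \<open>S - k\<close> lies that far below the level of
      \<open>?X\<close>.\<close>
    have "b * ((k / 2) / (\<omega> / 4)) * ?G (\<omega> / 4) * (r / (2 * r)) powr (s * p) * measure \<mu> ?X
        \<le> C * ?G k * measure \<mu> (superlevel u (S - k) k x0 r)"
    proof (rule cross_boundD[OF C(2) growth_hyp order_refl superlevel_sets[OF u] _ Ys])
      fix x y assume xy: "x \<in> ?X" "y \<in> ?Y"
      have ux: "barrier (S - k / 2) k x0 r x < u x" "d x0 x < r" using xy by (auto simp: superlevel_def)
      show "\<omega> / 4 \<le> u x - u y"
        using ux xy barrier_ge[OF r, of k "S - k / 2" x0 x] k \<omega> by auto
      have "excess u (S - k) k x0 r y = 0"
        using xy barrier_ge[OF r, of k "S - k" x0 y] k \<omega> by (auto simp: excess_def)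
      moreover have "k / 2 \<le> u x - barrier (S - k) k x0 r x"
        using ux(1) unfolding barrier_def by linarith
      then have "k / 2 \<le> excess u (S - k) k x0 r x"
        by (rule excess_ge[OF ux(2)])
      ultimately show "k / 2 \<le> excess u (S - k) k x0 r x - excess u (S - k) k x0 r y" by simp
    next
      fix x assume x: "x \<in> ?X"
      have "d x y < 2 * r" if "d x0 y < r" for y
        using that x dist_triangle[of x y x0] dist_sym[of x x0] by (auto simp: superlevel_def)
      then have eq: "?Y \<inter> {y. d x y < 2 * r} = ?Y" by auto
      have "emeasure \<mu> ?Y \<le> emeasure \<mu> {y. d x0 y < r}" by (rule emeasure_mono) auto
      then have "emeasure \<mu> ?Y = ennreal (measure \<mu> ?Y)"
        using emeasure_ball[OF r, of x0] by (intro emeasure_eq_ennreal_measure) (auto simp: top_unique)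
      moreover have "b * (2 * r) powr Q = c * r powr Q / 2"
        using r by (simp add: b_def powr_mult powr_minus)
      ultimately show "ennreal (b * (2 * r) powr Q) \<le> emeasure \<mu> (?Y \<inter> {y. d x y < 2 * r})"
        using half eq by (simp add: ennreal_leI)
    qed (use r k \<omega> b in \<open>auto simp: superlevel_def\<close>)
    also have "\<dots> \<le> C * ((4 * k / \<omega>) powr p * ?G (\<omega> / 4)) * (c * r powr Q)"
      using Gk C(1) emeasure_super(2)[OF u r, of "S - k" k x0] Gp
      by (intro mult_mono mult_left_mono) auto
    finally have "b * ((k / 2) / (\<omega> / 4)) * ?G (\<omega> / 4) * (r / (2 * r)) powr (s * p) * measure \<mu> ?X
      \<le> C * ((4 * k / \<omega>) powr p * ?G (\<omega> / 4)) * (c * r powr Q)" .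
    moreover have "(r / (2 * r)) powr (s * p) = \<sigma>" using r by (simp add: \<sigma>_def)
    moreover have "(4 * k / \<omega>) powr p = 4 powr p * ((k / \<omega>) powr (p - 1) * (k / \<omega>))"
      using k \<omega> powr_mult[of 4 "k / \<omega>" p] powr_diff_one_mult[of "k / \<omega>" p] by simp
    moreover have "(k / 2) / (\<omega> / 4) = 2 * (k / \<omega>)" by simp
    \<comment> \<open>The right side carries \<open>(k / \<omega>) powr p\<close>, the left only the
      ratio \<open>2 * (k / \<omega>)\<close> of excess to jump; cancelling leaves the power
      \<open>p - 1\<close>.\<close>
    ultimately have "(?G (\<omega> / 4) * (k / \<omega>)) * (2 * b * \<sigma> * measure \<mu> ?X)
       \<le> (?G (\<omega> / 4) * (k / \<omega>)) * (C * c * 4 powr p * (k / \<omega>) powr (p - 1) * r powr Q)"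
      by (simp only: mult_ac)
    then have "2 * b * \<sigma> * measure \<mu> ?X \<le> C * c * 4 powr p * (k / \<omega>) powr (p - 1) * r powr Q"
      by (rule mult_left_le_imp_le) (use Gp k \<omega> in simp)
    then show "measure \<mu> ?X \<le> D * (k / \<omega>) powr (p - 1) * r powr Q"
      using b \<sigma> by (simp add: D_def pos_le_divide_eq mult_ac)
  qed
qed

text \<open>No Sobolev inequality is needed: the factor \<open>(\<rho> / r) powr (s * p)\<close> comes from
  the kernel on a ball of radius \<open>\<rho>\<close> of which at least half lies below the lower cone.\<close>

lemma iteration_step:
  obtains C where "0 < C" "\<And>a \<Omega> u x0 r R S k m h \<rho>.
    \<lbrakk>growth_hyp a \<Omega> u x0 r R S k; 0 < h; h \<le> k; S - k \<le> m - h; 0 < \<rho>; \<rho> \<le> r; k * \<rho> \<le> h * r;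
      measure \<mu> (superlevel u (m - h) k x0 r) \<le> c * \<rho> powr Q / 2\<rbrakk>
    \<Longrightarrow> measure \<mu> (superlevel u (m + h) k x0 r)
      \<le> C * (k / h) powr q * (\<rho> / r) powr (s * p) * measure \<mu> (superlevel u (m - h) k x0 r)"
proof -
  obtain C where C: "0 < C" "cross_bound C" by (rule energy_cross)
  show ?thesis
  proof
    show "0 < 2 * C / c" using C(1) c_pos by simp
    fix a \<Omega> u x0 r R S k m h \<rho>
    assume growth_hyp: "growth_hyp a \<Omega> u x0 r R S k" and h: "0 < h" "h \<le> k" "S - k \<le> m - h"
      and \<rho>: "0 < \<rho>" "\<rho> \<le> r" "k * \<rho> \<le> h * r"
      and small: "measure \<mu> (superlevel u (m - h) k x0 r) \<le> c * \<rho> powr Q / 2"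
    have a: "modulating a" and r: "0 < r" and R: "2 * r \<le> R" and k: "0 < k" "k \<le> 2 * M"
      and uS: "AE x in \<mu>. d x0 x < R \<longrightarrow> u x \<le> S"
      using growth_hyp by (auto simp: growth_hyp_def)
    have u [measurable]: "u \<in> borel_measurable \<mu>" using growth_hyp by (simp add: growth_hyp_def weak_sol_def finite_energy_def)
    let ?G = "phase_scale (a x0 x0) r"
    let ?X = "superlevel u (m + h) k x0 r" and ?Z = "superlevel u (m - h) k x0 r"
    \<comment> \<open>The low set is taken in the ball of radius \<open>R\<close>, since a ball of
      radius \<open>\<rho>\<close> about a point of \<open>?X\<close> may leave the ball of radius
      \<open>r\<close>.\<close>
    let ?Y = "{y. d x0 y < R \<and> u y \<le> barrier (m - h) k x0 r y}"
    have Ys [measurable]: "?Y \<in> sets \<mu>" by (rule sets_Collect_mu) measurable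
    have a0: "0 \<le> a x0 x0" using modulating_nonneg[OF a] .
    have Gp: "0 < ?G h" using phase_scale_pos[OF a0 r h(1)] .
    have Gk: "?G k \<le> (k / h) powr q * ?G h"
    proof -
      have "(h / k) powr q * ?G k \<le> ?G h"
        using phase_scale_scale(2)[OF a0, of "h / k" k r] k h by simp
      then have "(k / h) powr q * ((h / k) powr q * ?G k) \<le> (k / h) powr q * ?G h"
        by (rule mult_left_mono) simp
      moreover have "(k / h) powr q * (h / k) powr q = 1"
        using k h by (simp add: powr_mult[symmetric])
      ultimately show ?thesis by (simp add: mult.assoc[symmetric])
    qed
    \<comment> \<open>The test level \<open>m\<close> lies midway between the two cones. Over a
      distance \<open>\<rho>\<close> the cone varies by at most
      \<open>k * \<rho> / r \<le> h\<close>, which leaves a jump of \<open>h\<close> out of the gap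
      \<open>2 * h\<close>.\<close>
    have "(c / 2) * (h / h) * ?G h * (r / \<rho>) powr (s * p) * measure \<mu> ?X
        \<le> C * ?G k * measure \<mu> (superlevel u m k x0 r)"
    proof (rule cross_boundD[OF C(2) growth_hyp _ superlevel_sets[OF u] _ Ys])
      fix x y assume xy: "x \<in> ?X" "y \<in> ?Y" "d x y < \<rho>"
      have ux: "barrier (m + h) k x0 r x < u x" "d x0 x < r" using xy by (auto simp: superlevel_def)
      have "k * min (d x y / r) 1 \<le> k * (\<rho> / r)"
        using xy r k by (intro mult_left_mono) (auto simp: min_def divide_right_mono)
      also have "\<dots> \<le> h" using \<rho> r by (simp add: field_simps)
      finally have "barrier m k x0 r y - barrier m k x0 r x \<le> h"
        using barrier_diff_le[OF r, of k m x0 x y] k by simp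
      moreover have "u y \<le> barrier m k x0 r y - h" "barrier m k x0 r x + h < u x"
        using xy(2) ux(1) by (simp_all add: barrier_def)
      ultimately show "h \<le> u x - u y" by linarith
      have "excess u m k x0 r y = 0"
        using xy(2) h by (auto simp: excess_def barrier_def)
      moreover have "h \<le> u x - barrier m k x0 r x"
        using ux(1) unfolding barrier_def by linarith
      then have "h \<le> excess u m k x0 r x"
        by (rule excess_ge[OF ux(2)])
      ultimately show "h \<le> excess u m k x0 r x - excess u m k x0 r y" by simp
    next
      fix x assume x: "x \<in> ?X"
      let ?B = "{y. d x y < \<rho>}" and ?N = "{y. d x0 y < R \<and> \<not> u y \<le> S}"
      have Nn: "?N \<in> null_sets \<mu>"
      proof (rule null_setsI)
        show "?N \<in> sets \<mu>" by (rule sets_Collect_mu) measurable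
        then show "emeasure \<mu> ?N = 0" using uS by (subst (asm) AE_iff_measurable[of ?N]) (auto simp: space_UNIV)
      qed
      \<comment> \<open>Between \<open>r\<close> and \<open>R\<close> the lower cone is at least
        \<open>S\<close>, so up to a null set the part of the ball outside \<open>?Y\<close> lies in
        \<open>?Z\<close>, which is small.\<close>
      have "?B \<subseteq> (?Y \<inter> ?B) \<union> ?Z \<union> ?N"
      proof
        fix y assume y: "y \<in> ?B"
        then have yR: "d x0 y < R" using x \<rho> R dist_triangle[of x0 y x] by (auto simp: superlevel_def)
        show "y \<in> (?Y \<inter> ?B) \<union> ?Z \<union> ?N"
        proof (cases "u y \<le> barrier (m - h) k x0 r y \<or> d x0 y < r")
          case True
          then show ?thesis using y yR by (auto simp: superlevel_def)
        next
          case False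
          then have "S < u y" using barrier_outside[OF r, of x0 y "m - h" k] h by auto
          then show ?thesis using yR by auto
        qed
      qed
      then have "emeasure \<mu> ?B \<le> emeasure \<mu> ((?Y \<inter> ?B) \<union> ?Z \<union> ?N)"
        using Nn u by (intro emeasure_mono sets.Un superlevel_sets sets.Int Ys ball_sets) auto
      also have "\<dots> = emeasure \<mu> ((?Y \<inter> ?B) \<union> ?Z)"
        using Nn u by (intro emeasure_Un_null_set sets.Un superlevel_sets sets.Int Ys ball_sets) auto
      also have "\<dots> \<le> emeasure \<mu> (?Y \<inter> ?B) + emeasure \<mu> ?Z"
        using u by (intro emeasure_subadditive superlevel_sets sets.Int Ys ball_sets)
      also have "\<dots> \<le> emeasure \<mu> (?Y \<inter> ?B) + ennreal (c * \<rho> powr Q / 2)"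
        using small emeasure_super(1)[OF u r, of "m - h" k x0] by (intro add_left_mono) (simp add: ennreal_leI)
      finally have "ennreal (c * \<rho> powr Q) \<le> emeasure \<mu> (?Y \<inter> ?B) + ennreal (c * \<rho> powr Q / 2)"
        using emeasure_ball[OF \<rho>(1), of x] by simp
      then show "ennreal (c / 2 * \<rho> powr Q) \<le> emeasure \<mu> (?Y \<inter> ?B)"
        using c_pos by (cases "emeasure \<mu> (?Y \<inter> ?B)") (simp_all add: ennreal_plus[symmetric] del: ennreal_plus)
    qed (use r k h \<rho> c_pos in \<open>auto simp: superlevel_def\<close>)
    also have "\<dots> \<le> C * ((k / h) powr q * ?G h) * measure \<mu> ?Z"
      using Gk C(1) Gp h by (intro mult_mono mult_left_mono measure_super_mono[OF u r]) auto
    finally have "?G h * ((c / 2) * (r / \<rho>) powr (s * p) * measure \<mu> ?X) \<le> ?G h * (C * (k / h) powr q * measure \<mu> ?Z)"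
      using h by (simp add: mult_ac)
    then have *: "(c / 2) * (r / \<rho>) powr (s * p) * measure \<mu> ?X \<le> C * (k / h) powr q * measure \<mu> ?Z"
      by (rule mult_left_le_imp_le) (rule Gp)
    have e1: "(\<rho> / r) powr (s * p) * (r / \<rho>) powr (s * p) = 1"
      using r \<rho> by (simp add: powr_mult[symmetric])
    have "(c / 2) * measure \<mu> ?X = ((\<rho> / r) powr (s * p) * (r / \<rho>) powr (s * p)) * ((c / 2) * measure \<mu> ?X)"
      by (simp only: e1 mult_1)
    also have "\<dots> = (\<rho> / r) powr (s * p) * ((c / 2) * (r / \<rho>) powr (s * p) * measure \<mu> ?X)"
      by (simp only: mult_ac)
    also have "\<dots> \<le> (\<rho> / r) powr (s * p) * (C * (k / h) powr q * measure \<mu> ?Z)"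
      using * by (rule mult_left_mono) simp
    finally show "measure \<mu> ?X \<le> 2 * C / c * (k / h) powr q * (\<rho> / r) powr (s * p) * measure \<mu> ?Z"
      using c_pos by (simp add: field_simps)
  qed
qed

text \<open>The levels \<open>ml j\<close> rise from \<open>S - k / 2\<close> to
  \<open>S - k / 4\<close> in steps \<open>2 * h\<close> with \<open>h\<close> of order
  \<open>k / 2 ^ j\<close>, and the measure of the superlevel set is kept below half the volume of a
  ball of radius \<open>\<tau>j j * r\<close>. Each constant answers one demand:
  \<open>\<kappa>\<close> balances the loss from halving the steps, \<open>\<tau>\<close> makes a
  step reproduce the bound, \<open>\<delta>\<close> starts the induction. In the limit the
  superlevel set at \<open>S - k / 4\<close> is null.\<close>

lemma growth:
  obtains \<delta> where "0 < \<delta>" "\<delta> \<le> 1 / 4" "\<And>a \<Omega> u x0 r R S \<omega>.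
    \<lbrakk>growth_hyp a \<Omega> u x0 r R S (\<delta> * \<omega>); 0 < \<omega>; \<omega> \<le> 2 * M;
      c * r powr Q / 2 \<le> measure \<mu> {y. d x0 y < r \<and> u y \<le> S - \<omega> / 2}\<rbrakk>
    \<Longrightarrow> AE y in \<mu>. d x0 y < r / 8 \<longrightarrow> u y \<le> S - \<delta> * \<omega> / 8"
proof -
  from first_step obtain C1 where C1: "0 < C1" "\<And>a \<Omega> u x0 r R S k \<omega>.
    \<lbrakk>growth_hyp a \<Omega> u x0 r R S k; 0 < \<omega>; \<omega> \<le> 2 * M; 4 * k \<le> \<omega>;
      c * r powr Q / 2 \<le> measure \<mu> {y. d x0 y < r \<and> u y \<le> S - \<omega> / 2}\<rbrakk>
    \<Longrightarrow> measure \<mu> (superlevel u (S - k / 2) k x0 r) \<le> C1 * (k / \<omega>) powr (p - 1) * r powr Q"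
    by blast
  from iteration_step obtain C where C: "0 < C" "\<And>a \<Omega> u x0 r R S k m h \<rho>.
    \<lbrakk>growth_hyp a \<Omega> u x0 r R S k; 0 < h; h \<le> k; S - k \<le> m - h; 0 < \<rho>; \<rho> \<le> r; k * \<rho> \<le> h * r;
      measure \<mu> (superlevel u (m - h) k x0 r) \<le> c * \<rho> powr Q / 2\<rbrakk>
    \<Longrightarrow> measure \<mu> (superlevel u (m + h) k x0 r)
      \<le> C * (k / h) powr q * (\<rho> / r) powr (s * p) * measure \<mu> (superlevel u (m - h) k x0 r)"
    by blast
  \<comment> \<open>\<open>\<kappa> powr (s * p) = 2 powr (- q)\<close>: the shrinking radii
    compensate the growth of \<open>(k / h) powr q\<close> when the step between levels is
    halved.\<close>
  define \<kappa> :: real where "\<kappa> = 2 powr (- (q / (s * p)))"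
  have sp_q: "s * p \<le> q"
    using s_pos s_le_t t_lt_1 p_gt_1 p_le_q mult_left_le_one_le[of p s] by linarith
  have \<kappa>: "0 < \<kappa>" "\<kappa> \<le> 1 / 2"
  proof -
    have "\<kappa> \<le> 2 powr (-1)" unfolding \<kappa>_def using sp_q sp_pos by (intro powr_mono) auto
    then show "\<kappa> \<le> 1 / 2" by (simp add: powr_minus)
  qed (simp add: \<kappa>_def)
  have \<kappa>sp: "\<kappa> powr (s * p) = 2 powr (- q)"
    using sp_pos by (auto simp: \<kappa>_def powr_powr)
  \<comment> \<open>With \<open>\<tau> powr (s * p) \<le> T\<close> the factor of one iteration is
    at most \<open>\<kappa> powr Q\<close>, the ratio of the volumes of consecutive balls.\<close>
  define T where "T = \<kappa> powr Q / (C * 16 powr q)"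
  have T: "0 < T" using \<kappa> C(1) by (simp add: T_def)
  define \<tau> where "\<tau> = min (1 / 16) (T powr (1 / (s * p)))"
  have \<tau>: "0 < \<tau>" "\<tau> \<le> 1 / 16" using T by (auto simp: \<tau>_def)
  have \<tau>sp: "\<tau> powr (s * p) \<le> T"
  proof -
    have "\<tau> powr (s * p) \<le> (T powr (1 / (s * p))) powr (s * p)"
      using \<tau> sp_pos by (intro powr_mono2) (auto simp: \<tau>_def)
    also have "\<dots> = T" unfolding powr_powr using sp_pos T by auto
    finally show ?thesis .
  qed
  \<comment> \<open>\<open>first_step\<close> bounds the initial measure by
    \<open>C1 * \<delta> powr (p - 1) * r powr Q\<close>, which is at most
    \<open>c * (\<tau> * r) powr Q / 2\<close> once
    \<open>\<delta> powr (p - 1) \<le> U\<close>.\<close>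
  define U where "U = c * \<tau> powr Q / (2 * C1)"
  have U: "0 < U" using \<tau> C1(1) c_pos by (simp add: U_def)
  define \<delta> where "\<delta> = min (1 / 4) (U powr (1 / (p - 1)))"
  have \<delta>: "0 < \<delta>" "\<delta> \<le> 1 / 4" using U by (auto simp: \<delta>_def)
  have \<delta>U: "\<delta> powr (p - 1) \<le> U"
  proof -
    have "\<delta> powr (p - 1) \<le> (U powr (1 / (p - 1))) powr (p - 1)"
      using \<delta> p_gt_1 by (intro powr_mono2) (auto simp: \<delta>_def)
    also have "\<dots> = U" unfolding powr_powr using p_gt_1 U by simp
    finally show ?thesis .
  qed
  show ?thesis
  proof
    show "0 < \<delta>" "\<delta> \<le> 1 / 4" by fact+
    fix a \<Omega> u x0 r R S \<omega>
    assume growth_hyp: "growth_hyp a \<Omega> u x0 r R S (\<delta> * \<omega>)" and \<omega>: "0 < \<omega>" "\<omega> \<le> 2 * M"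
      and half: "c * r powr Q / 2 \<le> measure \<mu> {y. d x0 y < r \<and> u y \<le> S - \<omega> / 2}"
    define k where "k = \<delta> * \<omega>"
    have k: "0 < k" "4 * k \<le> \<omega>" using \<delta> \<omega> by (auto simp: k_def mult_right_mono)
    note good' = growth_hyp[folded k_def]
    have r: "0 < r" and u: "u \<in> borel_measurable \<mu>"
      using growth_hyp by (auto simp: growth_hyp_def weak_sol_def finite_energy_def)
    define ml where "ml j = S - k / 4 - (k / 4) * (1 / 2) ^ j" for j :: nat
    define \<tau>j where "\<tau>j j = \<tau> * \<kappa> ^ j" for j :: nat
    have \<tau>j: "0 < \<tau>j j" for j using \<tau> \<kappa> by (simp add: \<tau>j_def)
    have main: "measure \<mu> (superlevel u (ml j) k x0 r) \<le> c * (\<tau>j j * r) powr Q / 2" for j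
    proof (induction j)
      case 0
      have "measure \<mu> (superlevel u (S - k / 2) k x0 r) \<le> C1 * (k / \<omega>) powr (p - 1) * r powr Q"
        using C1(2)[OF good' \<omega> k(2) half] .
      also have "\<dots> = C1 * \<delta> powr (p - 1) * r powr Q" using \<omega> by (simp add: k_def)
      also have "\<dots> \<le> C1 * U * r powr Q"
        using \<delta>U C1(1) by (intro mult_right_mono mult_left_mono) auto
      also have "\<dots> = c * (\<tau> * r) powr Q / 2" using C1(1) r \<tau> by (simp add: U_def powr_mult)
      finally show ?case by (simp add: ml_def \<tau>j_def)
    next
      case (Suc j)
      define h where "h = k * (1 / 2) ^ j / 16"
      define m where "m = ml j + h"
      have pw: "0 < (1 / 2 :: real) ^ j" "(1 / 2 :: real) ^ j \<le> 1" by (auto simp: power_le_one)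
      have h: "0 < h" "h \<le> k" using k pw by (auto simp: h_def)
      have mj: "m - h = ml j" "m + h = ml (Suc j)" by (auto simp: m_def ml_def h_def)
      have mS: "S - k \<le> m - h"
      proof -
        have "(k / 4) * (1 / 2) ^ j \<le> (k / 4) * 1" using pw k by (intro mult_left_mono) auto
        then show ?thesis unfolding mj ml_def using k by linarith
      qed
      \<comment> \<open>\<open>\<tau> \<le> 1/16\<close> and \<open>\<kappa> \<le> 1/2\<close> keep
        the variation of the cone over the distance \<open>\<tau>j j * r\<close> at most
        \<open>h = k * (1/2) ^ j / 16\<close>.\<close>
      have \<kappa>j: "\<kappa> ^ j \<le> (1 / 2) ^ j" using \<kappa> by (intro power_mono) auto
      have "\<tau> * \<kappa> ^ j \<le> 1 / 16 * (1 / 2) ^ j" using \<tau> \<kappa> \<kappa>j by (intro mult_mono) auto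
      then have "k * (\<tau> * \<kappa> ^ j) \<le> k * (1 / 16 * (1 / 2) ^ j)" using k by (intro mult_left_mono) auto
      then have \<tau>h: "k * \<tau>j j \<le> h" by (simp add: \<tau>j_def h_def)
      then have "k * \<tau>j j \<le> k * 1" using h by linarith
      then have "\<tau>j j \<le> 1" by (rule mult_left_le_imp_le) (rule k)
      then have \<rho>: "0 < \<tau>j j * r" "\<tau>j j * r \<le> r" "k * (\<tau>j j * r) \<le> h * r"
        using \<tau>j[of j] r \<tau>h by (auto simp: mult.assoc[symmetric] mult_right_mono)
      have "measure \<mu> (superlevel u (m + h) k x0 r)
        \<le> C * (k / h) powr q * (\<tau>j j * r / r) powr (s * p) * measure \<mu> (superlevel u (m - h) k x0 r)"
        by (rule C(2)[OF good' h mS \<rho>]) (use Suc.IH mj in simp)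
      also have "\<dots> \<le> \<kappa> powr Q * measure \<mu> (superlevel u (m - h) k x0 r)"
      proof (rule mult_right_mono)
        have "k / h = 16 * 2 ^ j" using k by (simp add: h_def power_divide)
        then have "(k / h) powr q = 16 powr q * (2 powr q) ^ j"
          by (simp add: powr_mult powr_power[symmetric] powr_powr powr_realpow[symmetric] mult.commute)
        moreover have "(\<tau>j j * r / r) powr (s * p) = \<tau> powr (s * p) * (\<kappa> powr (s * p)) ^ j"
          using r \<tau> \<kappa> by (simp add: \<tau>j_def powr_mult powr_powr powr_realpow[symmetric] mult.commute)
        moreover have "(2 powr q) ^ j * (\<kappa> powr (s * p)) ^ j = 1"
          unfolding \<kappa>sp power_mult_distrib[symmetric] powr_add[symmetric] by simp
        ultimately have "C * (k / h) powr q * (\<tau>j j * r / r) powr (s * p) = C * 16 powr q * \<tau> powr (s * p)"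
          by (simp add: mult_ac)
        also have "\<dots> \<le> C * 16 powr q * T" using \<tau>sp C(1) by (intro mult_left_mono) auto
        also have "\<dots> = \<kappa> powr Q" using C(1) by (simp add: T_def)
        finally show "C * (k / h) powr q * (\<tau>j j * r / r) powr (s * p) \<le> \<kappa> powr Q" .
      qed simp
      also have "\<dots> \<le> \<kappa> powr Q * (c * (\<tau>j j * r) powr Q / 2)"
        using Suc.IH mj by (intro mult_left_mono) auto
      also have "\<dots> = c * (\<tau>j (Suc j) * r) powr Q / 2"
        using \<tau> \<kappa> r by (simp add: \<tau>j_def powr_mult)
      finally show ?case unfolding mj .
    qed
    have le: "measure \<mu> (superlevel u (S - k / 4) k x0 r) \<le> c * (\<tau> * r) powr Q / 2 * (\<kappa> powr Q) ^ j" for j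
    proof -
      have "measure \<mu> (superlevel u (S - k / 4) k x0 r) \<le> measure \<mu> (superlevel u (ml j) k x0 r)"
        using k by (intro measure_super_mono[OF u r]) (simp add: ml_def)
      also have "\<dots> \<le> c * (\<tau>j j * r) powr Q / 2" by (rule main)
      also have "\<dots> = c * (\<tau> * r) powr Q / 2 * (\<kappa> powr Q) ^ j"
        using \<tau> \<kappa> r by (simp add: \<tau>j_def powr_mult powr_powr powr_realpow[symmetric] mult.commute)
      finally show ?thesis .
    qed
    have "\<kappa> powr Q < 1" using \<kappa> Q_pos powr_less_mono2[of Q \<kappa> 1] by simp
    then have "(\<lambda>j. c * (\<tau> * r) powr Q / 2 * (\<kappa> powr Q) ^ j) \<longlonglongrightarrow> c * (\<tau> * r) powr Q / 2 * 0"
      by (intro tendsto_intros LIMSEQ_power_zero) simp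
    then have "measure \<mu> (superlevel u (S - k / 4) k x0 r) \<le> 0"
      using LIMSEQ_le_const[of _ "c * (\<tau> * r) powr Q / 2 * 0" "measure \<mu> (superlevel u (S - k / 4) k x0 r)"] le
      by (metis mult_zero_right)
    then have "emeasure \<mu> (superlevel u (S - k / 4) k x0 r) = 0"
      using emeasure_super(1)[OF u r, of "S - k / 4" k x0] by (simp add: ennreal_eq_0_iff)
    then have "superlevel u (S - k / 4) k x0 r \<in> null_sets \<mu>" using superlevel_sets[OF u] by auto
    then have "AE y in \<mu>. y \<notin> superlevel u (S - k / 4) k x0 r" by (rule AE_not_in)
    then show "AE y in \<mu>. d x0 y < r / 8 \<longrightarrow> u y \<le> S - \<delta> * \<omega> / 8"
    proof (rule AE_mp, intro AE_I2 impI)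
      fix y assume y: "y \<notin> superlevel u (S - k / 4) k x0 r" "d x0 y < r / 8"
      \<comment> \<open>Within \<open>r / 8\<close> the cone has risen by at most
        \<open>k / 8\<close>, half of the gain \<open>k / 4\<close>.\<close>
      then have "u y \<le> S - k / 4 + k * min (d x0 y / r) 1"
        using r by (auto simp: superlevel_def barrier_def)
      also have "k * min (d x0 y / r) 1 \<le> k * (1 / 8)"
        using y r k by (intro mult_left_mono) (auto simp: min_le_iff_disj field_simps)
      finally show "u y \<le> S - \<delta> * \<omega> / 8" by (simp add: k_def)
    qed
  qed
qed

subsection \<open>Tails and decay of oscillation\<close>

text \<open>A fixed exponent for the growth of the tails: the constants of the tail estimates, and with them
  the scale ratio, must not depend on the Hoelder exponent, which is chosen last.\<close>

definition \<beta>0 :: real where "\<beta>0 = s * p / (2 * (q - 1))"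

lemma \<beta>0: "0 < \<beta>0" "\<beta>0 < s * p / (q - 1)" "\<beta>0 * (p - 1) < s * p" "\<beta>0 * (q - 1) < t * q"
proof -
  show pos: "0 < \<beta>0" using sp_pos q_gt_1 by (simp add: \<beta>0_def)
  show "\<beta>0 < s * p / (q - 1)" 
    unfolding \<beta>0_def using sp_pos q_gt_1 by (intro divide_strict_left_mono) auto
  have eq: "\<beta>0 * (q - 1) = s * p / 2"
    using q_gt_1 by (simp only: \<beta>0_def times_divide_eq_left) (simp only: mult_divide_mult_cancel_right)
  then show "\<beta>0 * (q - 1) < t * q" using sp_pos sp_le_tq by linarith
  have "\<beta>0 * (p - 1) \<le> \<beta>0 * (q - 1)" using pos p_le_q by (intro mult_left_mono) auto
  then show "\<beta>0 * (p - 1) < s * p" using eq sp_pos by linarith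
qed

text \<open>\<open>modulating_ker_far\<close> freezes the coefficient; the remainder carries the
  kernel of the \<open>p\<close>-phase, and \<open>V \<le> 5 * M\<close> lowers its power from
  \<open>q - 1\<close> to \<open>p - 1\<close>.\<close>

lemma tail_dens_split:
  assumes a: "modulating a" and xy: "0 < d x y" "d x0 x \<le> d x y" and V: "0 \<le> V" "V \<le> 5 * M"
  shows "tail_dens a V x y \<le> (1 + (5 * M) powr (q - p) * (3 * A + L)) * (V powr (p - 1) * ker (s * p) x y)
    + a x0 x0 * (V powr (q - 1) * ker (t * q) x y)"
proof -
  have "a x y * V powr (q - 1) * ker (t * q) x y = V powr (q - 1) * (a x y * ker (t * q) x y)" by simp
  also have "\<dots> \<le> V powr (q - 1) * (a x0 x0 * ker (t * q) x y + (3 * A + L) * ker (s * p) x y)"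
    by (intro mult_left_mono modulating_ker_far[OF a xy]) auto
  also have "\<dots> = a x0 x0 * (V powr (q - 1) * ker (t * q) x y) + V powr (q - 1) * ((3 * A + L) * ker (s * p) x y)"
    by (simp add: algebra_simps)
  also have "V powr (q - 1) * ((3 * A + L) * ker (s * p) x y) \<le> (5 * M) powr (q - p) * V powr (p - 1) * ((3 * A + L) * ker (s * p) x y)"
    using powr_le_mult_powr[of V "5 * M" "p - 1" "q - 1"] V p_le_q A_nonneg L_nonneg
    by (intro mult_right_mono) auto
  finally show ?thesis by (simp add: tail_dens_def algebra_simps)
qed

text \<open>Growth of order \<open>\<beta>0\<close> leaves the kernel the integrable exponent
  \<open>\<sigma> - \<beta>0 * (l - 1)\<close>. The quantity \<open>2 * d x y\<close> stands for the
  distance of \<open>y\<close> to the centre, seen from a point \<open>x\<close> near it.\<close>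

lemma growth_kernel_integral:
  assumes "0 \<le> \<beta>0 * (l - 1)" "\<beta>0 * (l - 1) < \<sigma>" "1 < l"
  obtains C where "0 < C" "\<And>x R \<omega>. 0 < R \<Longrightarrow> 0 < \<omega> \<Longrightarrow>
    (\<integral>\<^sup>+ y. ennreal ((4 * \<omega> * (2 * d x y / R) powr \<beta>0) powr (l - 1) * ker \<sigma> x y) * indicator {y. R / 2 \<le> d x y} y \<partial>\<mu>)
      \<le> ennreal (C * \<omega> powr (l - 1) * R powr (- \<sigma>))"
proof -
  define \<gamma> where "\<gamma> = \<sigma> - \<beta>0 * (l - 1)"
  have \<gamma>: "0 < \<gamma>" using assms by (simp add: \<gamma>_def)
  from kernel_far[OF \<gamma>] obtain K where K: "0 \<le> K" "\<And>x r. 0 < r \<Longrightarrow>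
    (\<integral>\<^sup>+ y. ennreal (d x y powr (- (Q + \<gamma>))) * indicator {y. r \<le> d x y} y \<partial>\<mu>) \<le> ennreal (K * r powr (- \<gamma>))"
    by blast
  let ?C = "(K + 1) * 4 powr (l - 1) * 2 powr \<sigma>"
  show ?thesis
  proof
    show "0 < ?C" using K(1) by simp
    fix x :: 'a and R \<omega> :: real assume R: "0 < R" and \<omega>: "0 < \<omega>"
    define B where "B = 4 powr (l - 1) * \<omega> powr (l - 1) * (R / 2) powr (- (\<beta>0 * (l - 1)))"
    have B: "0 \<le> B" by (simp add: B_def)
    have "(\<integral>\<^sup>+ y. ennreal ((4 * \<omega> * (2 * d x y / R) powr \<beta>0) powr (l - 1) * ker \<sigma> x y) * indicator {y. R / 2 \<le> d x y} y \<partial>\<mu>)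
      = (\<integral>\<^sup>+ y. ennreal B * (ennreal (d x y powr (- (Q + \<gamma>))) * indicator {y. R / 2 \<le> d x y} y) \<partial>\<mu>)"
    proof (rule nn_integral_cong)
      fix y
      show "ennreal ((4 * \<omega> * (2 * d x y / R) powr \<beta>0) powr (l - 1) * ker \<sigma> x y) * indicator {y. R / 2 \<le> d x y} y
        = ennreal B * (ennreal (d x y powr (- (Q + \<gamma>))) * indicator {y. R / 2 \<le> d x y} y)"
      proof (cases "R / 2 \<le> d x y")
        case True
        have dn: "0 \<le> d x y" by (rule dist_nonneg)
        have "(4 * \<omega> * (2 * d x y / R) powr \<beta>0) powr (l - 1) = 4 powr (l - 1) * \<omega> powr (l - 1) * (d x y / (R / 2)) powr (\<beta>0 * (l - 1))"
        proof -
          have e: "2 * d x y / R = d x y / (R / 2)" by simp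
          show ?thesis unfolding e
            using powr_mult[of "4 * \<omega>" "(d x y / (R / 2)) powr \<beta>0" "l - 1"] powr_mult[of 4 \<omega> "l - 1"]
            by (simp only: powr_powr)
        qed
        also have "(d x y / (R / 2)) powr (\<beta>0 * (l - 1)) = d x y powr (\<beta>0 * (l - 1)) * (R / 2) powr (- (\<beta>0 * (l - 1)))"
          unfolding powr_minus_divide using powr_divide[of "d x y" "R / 2" "\<beta>0 * (l - 1)"] R dn by simp
        finally have "(4 * \<omega> * (2 * d x y / R) powr \<beta>0) powr (l - 1) * ker \<sigma> x y
          = B * (d x y powr (\<beta>0 * (l - 1)) * d x y powr (- (Q + \<sigma>)))"
          unfolding B_def ker_def by (simp only: mult_ac)
        also have "d x y powr (\<beta>0 * (l - 1)) * d x y powr (- (Q + \<sigma>)) = d x y powr (- (Q + \<gamma>))"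
          unfolding powr_add[symmetric] by (simp add: \<gamma>_def algebra_simps)
        finally show ?thesis using True B by (simp add: ennreal_mult)
      qed simp
    qed
    also have "\<dots> = ennreal B * (\<integral>\<^sup>+ y. ennreal (d x y powr (- (Q + \<gamma>))) * indicator {y. R / 2 \<le> d x y} y \<partial>\<mu>)"
    proof -
      have [measurable]: "{y. R / 2 \<le> d x y} \<in> sets \<mu>" by (rule sets_Collect_mu) measurable
      show ?thesis by (rule nn_integral_cmult) measurable
    qed
    also have "\<dots> \<le> ennreal B * ennreal (K * (R / 2) powr (- \<gamma>))"
      using K(2)[of "R / 2" x] R by (intro mult_left_mono) auto
    also have "\<dots> = ennreal (B * (K * (R / 2) powr (- \<gamma>)))" using B K(1) by (simp add: ennreal_mult)
    also have "B * (K * (R / 2) powr (- \<gamma>)) = K * (4 powr (l - 1) * \<omega> powr (l - 1) * ((R / 2) powr (- (\<beta>0 * (l - 1))) * (R / 2) powr (- \<gamma>)))"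
      by (simp add: B_def mult_ac)
    also have "(R / 2) powr (- (\<beta>0 * (l - 1))) * (R / 2) powr (- \<gamma>) = (R / 2) powr (- \<sigma>)"
      unfolding powr_add[symmetric] by (simp add: \<gamma>_def)
    also have "(R / 2) powr (- \<sigma>) = 2 powr \<sigma> * R powr (- \<sigma>)"
      using R powr_divide[of R 2 "- \<sigma>"] powr_minus_divide[of 2 \<sigma>] by simp
    finally have fin: "(\<integral>\<^sup>+ y. ennreal ((4 * \<omega> * (2 * d x y / R) powr \<beta>0) powr (l - 1) * ker \<sigma> x y) * indicator {y. R / 2 \<le> d x y} y \<partial>\<mu>)
      \<le> ennreal (K * (4 powr (l - 1) * \<omega> powr (l - 1) * (2 powr \<sigma> * R powr (- \<sigma>))))" .
    have "K * (4 powr (l - 1) * \<omega> powr (l - 1) * (2 powr \<sigma> * R powr (- \<sigma>)))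
       \<le> (K + 1) * (4 powr (l - 1) * \<omega> powr (l - 1) * (2 powr \<sigma> * R powr (- \<sigma>)))"
      by (intro mult_right_mono) auto
    also have "\<dots> = ?C * \<omega> powr (l - 1) * R powr (- \<sigma>)" by (simp only: mult_ac)
    finally show "(\<integral>\<^sup>+ y. ennreal ((4 * \<omega> * (2 * d x y / R) powr \<beta>0) powr (l - 1) * ker \<sigma> x y) * indicator {y. R / 2 \<le> d x y} y \<partial>\<mu>)
      \<le> ennreal (?C * \<omega> powr (l - 1) * R powr (- \<sigma>))"
      by (rule order_trans[OF fin ennreal_leI])
  qed
qed

text \<open>Since \<open>d x0 x < r \<le> R / 2\<close>, the distance of \<open>y\<close> to
  \<open>x0\<close> is at most twice that to \<open>x\<close>, so the growth bound for
  \<open>V\<close> passes to the kernels centred at \<open>x\<close>. The constant is independent of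
  \<open>\<rho>0\<close>, the radius up to which bounds on \<open>V\<close> are available.\<close>

lemma tail_near:
  obtains C where "0 < C" "\<And>a V x0 x r R \<rho>0 \<omega>.
    \<lbrakk>modulating a; V \<in> borel_measurable \<mu>; \<And>y. 0 \<le> V y; 0 < r; 2 * r \<le> R; 0 < \<omega>; d x0 x < r;
      AE y in \<mu>. R \<le> d x0 y \<and> d x0 y < \<rho>0 \<longrightarrow> V y \<le> 4 * \<omega> * (d x0 y / R) powr \<beta>0 \<and> V y \<le> 5 * M\<rbrakk>
    \<Longrightarrow> (\<integral>\<^sup>+ y. ennreal (indicator {y. R \<le> d x0 y \<and> d x0 y < \<rho>0} y * tail_dens a (V y) x y) \<partial>\<mu>)
      \<le> ennreal (C * (\<omega> powr (p - 1) * R powr (- (s * p)) + a x0 x0 * \<omega> powr (q - 1) * R powr (- (t * q))))"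
proof -
  have n: "0 \<le> \<beta>0 * (p - 1)" "0 \<le> \<beta>0 * (q - 1)" using \<beta>0(1) p_gt_1 q_gt_1 by auto
  from growth_kernel_integral[OF n(1) \<beta>0(3) p_gt_1] obtain C1 where C1: "0 < C1" "\<And>x R \<omega>. 0 < R \<Longrightarrow> 0 < \<omega> \<Longrightarrow>
    (\<integral>\<^sup>+ y. ennreal ((4 * \<omega> * (2 * d x y / R) powr \<beta>0) powr (p - 1) * ker (s * p) x y) * indicator {y. R / 2 \<le> d x y} y \<partial>\<mu>)
      \<le> ennreal (C1 * \<omega> powr (p - 1) * R powr (- (s * p)))" by blast
  from growth_kernel_integral[OF n(2) \<beta>0(4) q_gt_1] obtain C2 where C2: "0 < C2" "\<And>x R \<omega>. 0 < R \<Longrightarrow> 0 < \<omega> \<Longrightarrow>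
    (\<integral>\<^sup>+ y. ennreal ((4 * \<omega> * (2 * d x y / R) powr \<beta>0) powr (q - 1) * ker (t * q) x y) * indicator {y. R / 2 \<le> d x y} y \<partial>\<mu>)
      \<le> ennreal (C2 * \<omega> powr (q - 1) * R powr (- (t * q)))" by blast
  define N where "N = 1 + (5 * M) powr (q - p) * (3 * A + L)"
  have N: "0 < N" using A_nonneg L_nonneg by (simp add: N_def add_pos_nonneg)
  show ?thesis
  proof
    show "0 < N * C1 + C2" using N C1(1) C2(1) by (intro add_pos_pos mult_pos_pos)
    fix a V x0 x r R \<rho>0 \<omega>
    assume a: "modulating a" and V [measurable]: "V \<in> borel_measurable \<mu>" and V0: "\<And>y. 0 \<le> V y"
      and r: "0 < r" and R: "2 * r \<le> R" and \<omega>: "0 < \<omega>" and x: "d x0 x < r"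
      and AEV: "AE y in \<mu>. R \<le> d x0 y \<and> d x0 y < \<rho>0 \<longrightarrow> V y \<le> 4 * \<omega> * (d x0 y / R) powr \<beta>0 \<and> V y \<le> 5 * M"
    have R0: "0 < R" using r R by simp
    have a0: "0 \<le> a x0 x0" using modulating_nonneg[OF a] .
    define f where "f = (\<lambda>l \<sigma> y. ennreal ((4 * \<omega> * (2 * d x y / R) powr \<beta>0) powr (l - 1) * ker \<sigma> x y) * indicator {y. R / 2 \<le> d x y} y)"
    have [measurable]: "{y. R / 2 \<le> d x y} \<in> sets \<mu>" by (rule sets_Collect_mu) measurable
    have fm [measurable]: "f l \<sigma> \<in> borel_measurable \<mu>" for l \<sigma> unfolding f_def by measurable
    have "(\<integral>\<^sup>+ y. ennreal (indicator {y. R \<le> d x0 y \<and> d x0 y < \<rho>0} y * tail_dens a (V y) x y) \<partial>\<mu>)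
      \<le> (\<integral>\<^sup>+ y. ennreal N * f p (s * p) y + ennreal (a x0 x0) * f q (t * q) y \<partial>\<mu>)"
    proof (rule nn_integral_mono_AE, use AEV in \<open>rule AE_mp, intro AE_I2 impI\<close>)
      fix y assume Vy: "R \<le> d x0 y \<and> d x0 y < \<rho>0 \<longrightarrow> V y \<le> 4 * \<omega> * (d x0 y / R) powr \<beta>0 \<and> V y \<le> 5 * M"
      show "ennreal (indicator {y. R \<le> d x0 y \<and> d x0 y < \<rho>0} y * tail_dens a (V y) x y)
        \<le> ennreal N * f p (s * p) y + ennreal (a x0 x0) * f q (t * q) y"
      proof (cases "R \<le> d x0 y \<and> d x0 y < \<rho>0")
        case True
        then have V': "V y \<le> 4 * \<omega> * (d x0 y / R) powr \<beta>0" "V y \<le> 5 * M" using Vy by auto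
        have tri: "d x0 y \<le> d x0 x + d x y" by (rule dist_triangle)
        then have xy: "0 < d x y" "d x0 x \<le> d x y" "R / 2 \<le> d x y" "d x0 y \<le> 2 * d x y"
          using True x R r by auto
        have "(d x0 y / R) powr \<beta>0 \<le> (2 * d x y / R) powr \<beta>0"
          using xy R0 \<beta>0(1) dist_nonneg[of x0 y] by (intro powr_mono2) (auto simp: divide_right_mono)
        then have "4 * \<omega> * (d x0 y / R) powr \<beta>0 \<le> 4 * \<omega> * (2 * d x y / R) powr \<beta>0"
          using \<omega> by (intro mult_left_mono) auto
        then have VW: "V y \<le> 4 * \<omega> * (2 * d x y / R) powr \<beta>0" using V' by simp
        have Vl: "V y powr (l - 1) * ker \<sigma> x y \<le> (4 * \<omega> * (2 * d x y / R) powr \<beta>0) powr (l - 1) * ker \<sigma> x y" if "1 < l" for l \<sigma>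
          using VW V0[of y] that by (intro mult_right_mono powr_mono2) auto
        have "tail_dens a (V y) x y \<le> N * (V y powr (p - 1) * ker (s * p) x y) + a x0 x0 * (V y powr (q - 1) * ker (t * q) x y)"
          unfolding N_def by (rule tail_dens_split[OF a xy(1,2) V0 V'(2)])
        also have "\<dots> \<le> N * ((4 * \<omega> * (2 * d x y / R) powr \<beta>0) powr (p - 1) * ker (s * p) x y)
            + a x0 x0 * ((4 * \<omega> * (2 * d x y / R) powr \<beta>0) powr (q - 1) * ker (t * q) x y)"
          using N a0 Vl[OF p_gt_1] Vl[OF q_gt_1] by (intro add_mono mult_left_mono) auto
        finally show ?thesis using True xy N a0
          by (simp add: f_def ennreal_mult[symmetric] ennreal_plus[symmetric] ennreal_leI del: ennreal_plus)
      qed simp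
    qed
    also have "\<dots> = ennreal N * (\<integral>\<^sup>+ y. f p (s * p) y \<partial>\<mu>) + ennreal (a x0 x0) * (\<integral>\<^sup>+ y. f q (t * q) y \<partial>\<mu>)"
      by (simp add: nn_integral_add nn_integral_cmult)
    also have "\<dots> \<le> ennreal N * ennreal (C1 * \<omega> powr (p - 1) * R powr (- (s * p)))
        + ennreal (a x0 x0) * ennreal (C2 * \<omega> powr (q - 1) * R powr (- (t * q)))"
      unfolding f_def by (intro add_mono mult_left_mono C1(2)[OF R0 \<omega>] C2(2)[OF R0 \<omega>]) auto
    also have "\<dots> = ennreal (N * (C1 * \<omega> powr (p - 1) * R powr (- (s * p))) + a x0 x0 * (C2 * \<omega> powr (q - 1) * R powr (- (t * q))))"
      using N a0 C1(1) C2(1) by (simp add: ennreal_mult ennreal_plus)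
    also have "\<dots> \<le> ennreal ((N * C1 + C2) * (\<omega> powr (p - 1) * R powr (- (s * p)) + a x0 x0 * \<omega> powr (q - 1) * R powr (- (t * q))))"
    proof (rule ennreal_leI)
      have "0 \<le> C2 * (\<omega> powr (p - 1) * R powr (- (s * p)))" "0 \<le> N * C1 * (a x0 x0 * \<omega> powr (q - 1) * R powr (- (t * q)))"
        using N a0 C1(1) C2(1) by auto
      then show "N * (C1 * \<omega> powr (p - 1) * R powr (- (s * p))) + a x0 x0 * (C2 * \<omega> powr (q - 1) * R powr (- (t * q)))
        \<le> (N * C1 + C2) * (\<omega> powr (p - 1) * R powr (- (s * p)) + a x0 x0 * \<omega> powr (q - 1) * R powr (- (t * q)))"
        by (simp add: algebra_simps)
    qed
    finally show "(\<integral>\<^sup>+ y. ennreal (indicator {y. R \<le> d x0 y \<and> d x0 y < \<rho>0} y * tail_dens a (V y) x y) \<partial>\<mu>)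
      \<le> ennreal ((N * C1 + C2) * (\<omega> powr (p - 1) * R powr (- (s * p)) + a x0 x0 * \<omega> powr (q - 1) * R powr (- (t * q))))" .
  qed
qed

text \<open>Constants have finite tails; this serves the bounded part of \<open>V\<close> in
  \<open>tail_far\<close>.\<close>

lemma weight_integrable: "(\<integral>\<^sup>+ y. ennreal ((1 + d z y) powr (- (Q + s * p))) \<partial>\<mu>) < \<infinity>"
proof -
  from kernel_far[OF sp_pos] obtain K where K: "0 \<le> K" "\<And>x r. 0 < r \<Longrightarrow>
    (\<integral>\<^sup>+ y. ennreal (d x y powr (- (Q + s * p))) * indicator {y. r \<le> d x y} y \<partial>\<mu>) \<le> ennreal (K * r powr (- (s * p)))"
    by blast
  have [measurable]: "{y. 1 \<le> d z y} \<in> sets \<mu>" by (rule sets_Collect_mu) measurable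
  have "(\<integral>\<^sup>+ y. ennreal ((1 + d z y) powr (- (Q + s * p))) \<partial>\<mu>)
    \<le> (\<integral>\<^sup>+ y. indicator {y. d z y < 1} y + ennreal (d z y powr (- (Q + s * p))) * indicator {y. 1 \<le> d z y} y \<partial>\<mu>)"
  proof (rule nn_integral_mono)
    fix y
    have "(1 + d z y) powr (- (Q + s * p)) \<le> 1 powr (- (Q + s * p))"
      using dist_nonneg[of z y] Q_pos sp_pos by (intro powr_mono2') auto
    moreover have "(1 + d z y) powr (- (Q + s * p)) \<le> d z y powr (- (Q + s * p))" if "1 \<le> d z y"
      using that Q_pos sp_pos by (intro powr_mono2') auto
    ultimately show "ennreal ((1 + d z y) powr (- (Q + s * p)))
      \<le> indicator {y. d z y < 1} y + ennreal (d z y powr (- (Q + s * p))) * indicator {y. 1 \<le> d z y} y"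
      by (cases "d z y < 1") (auto intro: ennreal_leI)
  qed
  also have "\<dots> = emeasure \<mu> {y. d z y < 1} + (\<integral>\<^sup>+ y. ennreal (d z y powr (- (Q + s * p))) * indicator {y. 1 \<le> d z y} y \<partial>\<mu>)"
    by (subst nn_integral_add) auto
  also have "\<dots> < \<infinity>"
    using emeasure_ball[of 1 z] le_less_trans[OF K(2)[of 1 z]] by simp
  finally show ?thesis .
qed

text \<open>\<open>T\<close> is finite but not small, and it depends on \<open>u\<close>,
  \<open>\<rho>\<close> and \<open>H\<close>. It affects only the starting radius of the iteration,
  not the Hoelder exponent.\<close>

lemma tail_far:
  assumes a: "modulating a" and u [measurable]: "u \<in> borel_measurable \<mu>"
    and tail: "(\<integral>\<^sup>+ y. ennreal (\<bar>u y\<bar> powr (q - 1) * (1 + d z y) powr (- (Q + s * p))) \<partial>\<mu>) < \<infinity>"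
    and \<rho>: "0 < \<rho>" "\<rho> \<le> 1" and H: "0 \<le> H"
  obtains T where "0 \<le> T" "\<And>x0 x V. \<lbrakk>d z x0 \<le> H; d x0 x < \<rho> / 2; \<And>y. 0 \<le> V y; \<And>y. V y \<le> \<bar>u y\<bar> + 5 * M\<rbrakk> \<Longrightarrow>
    (\<integral>\<^sup>+ y. ennreal (indicator {y. \<rho> \<le> d x0 y} y * tail_dens a (V y) x y) \<partial>\<mu>) \<le> ennreal T"
proof -
  \<comment> \<open>Chosen so that \<open>1 + d z y \<le> K * d x y\<close> whenever
    \<open>\<rho> \<le> d x0 y\<close>; this exchanges the kernel at \<open>x\<close> for the weight
    centred at \<open>z\<close>.\<close>
  define K where "K = 2 + 2 * (1 + H) / \<rho>"
  have K: "0 < K" using H \<rho> by (simp add: K_def add_pos_nonneg)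
  \<comment> \<open>\<open>D - 1\<close> is the price of replacing the kernel of the
    \<open>q\<close>-phase, with its coefficient, by that of the \<open>p\<close>-phase at distances
    at least \<open>\<rho> / 2\<close>.\<close>
  define D where "D = 1 + L * (\<rho> / 2) powr (s * p - t * q)"
  have D: "1 \<le> D" using L_nonneg by (simp add: D_def)
  define W where "W = (\<lambda>y. (1 + d z y) powr (- (Q + s * p)))"
  have [measurable]: "W \<in> borel_measurable \<mu>" unfolding W_def by measurable
  define B where "B = 1 + (5 * M) powr (q - 1) * 2 powr (q - 1)"
  define c1 where "c1 = D * K powr (Q + s * p)"
  define f where "f = (\<lambda>y. ennreal (c1 * 2 powr (q - 1)) * ennreal (\<bar>u y\<bar> powr (q - 1) * W y) + ennreal (c1 * B) * ennreal (W y))"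
  have c1: "0 \<le> c1" using D by (simp add: c1_def)
  have B: "0 \<le> B" by (simp add: B_def add_nonneg_nonneg)
  have W: "0 \<le> W y" for y by (simp add: W_def)
  have "(\<integral>\<^sup>+ y. f y \<partial>\<mu>) = ennreal (c1 * 2 powr (q - 1)) * (\<integral>\<^sup>+ y. ennreal (\<bar>u y\<bar> powr (q - 1) * W y) \<partial>\<mu>)
      + ennreal (c1 * B) * (\<integral>\<^sup>+ y. ennreal (W y) \<partial>\<mu>)"
    unfolding f_def by (subst nn_integral_add) (auto simp: nn_integral_cmult)
  also have "\<dots> < \<infinity>"
    using tail weight_integrable[of z] by (simp add: W_def ennreal_mult_less_top)
  finally have fin: "(\<integral>\<^sup>+ y. f y \<partial>\<mu>) < \<infinity>" .
  show ?thesis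
  proof
    show "0 \<le> enn2real (\<integral>\<^sup>+ y. f y \<partial>\<mu>)" by simp
    fix x0 x and V :: "'a \<Rightarrow> real"
    assume x0: "d z x0 \<le> H" and x: "d x0 x < \<rho> / 2" and V: "\<And>y. 0 \<le> V y" "\<And>y. V y \<le> \<bar>u y\<bar> + 5 * M"
    have "(\<integral>\<^sup>+ y. ennreal (indicator {y. \<rho> \<le> d x0 y} y * tail_dens a (V y) x y) \<partial>\<mu>) \<le> (\<integral>\<^sup>+ y. f y \<partial>\<mu>)"
    proof (rule nn_integral_mono)
      fix y
      show "ennreal (indicator {y. \<rho> \<le> d x0 y} y * tail_dens a (V y) x y) \<le> f y"
      proof (cases "\<rho> \<le> d x0 y")
        case True
        have tri: "d x0 y \<le> d x0 x + d x y" by (rule dist_triangle)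
        then have xy: "0 < d x y" "\<rho> / 2 \<le> d x y" "d x0 y \<le> 2 * d x y"
          using True x \<rho> by auto
        have V1: "V y powr (q - 1) \<le> 2 powr (q - 1) * (\<bar>u y\<bar> powr (q - 1) + (5 * M) powr (q - 1))"
          using powr_sum_le[of "\<bar>u y\<bar>" "5 * M" "q - 1" "V y"] V M_pos q_gt_1 by simp
        have V2: "V y powr (p - 1) \<le> 1 + V y powr (q - 1)"
        proof (cases "V y \<le> 1")
          case True
          have "V y powr (p - 1) \<le> 1 powr (p - 1)" using True V p_gt_1 by (intro powr_mono2) auto
          then show ?thesis by (simp add: add_increasing2)
        next
          case False
          then show ?thesis using p_le_q by (simp add: add_increasing)
        qed
        have kt: "a x y * ker (t * q) x y \<le> L * (\<rho> / 2) powr (s * p - t * q) * ker (s * p) x y"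
        proof -
          have "ker (t * q) x y = d x y powr (s * p - t * q) * ker (s * p) x y"
            unfolding ker_def powr_add[symmetric] by (simp add: algebra_simps)
          also have "\<dots> \<le> (\<rho> / 2) powr (s * p - t * q) * ker (s * p) x y"
            using xy \<rho> sp_le_tq by (intro mult_right_mono powr_mono2') auto
          finally have "ker (t * q) x y \<le> (\<rho> / 2) powr (s * p - t * q) * ker (s * p) x y" .
          then have "a x y * ker (t * q) x y \<le> L * ((\<rho> / 2) powr (s * p - t * q) * ker (s * p) x y)"
            using modulating_le[OF a] modulating_nonneg[OF a] L_nonneg by (intro mult_mono) auto
          then show ?thesis by (simp add: mult.assoc)
        qed
        have kW: "ker (s * p) x y \<le> K powr (Q + s * p) * W y"
        proof -
          have "1 + d z y \<le> 1 + H + d x0 y" using dist_triangle[of z y x0] x0 by simp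
          also have "\<dots> \<le> (1 + H) * (d x y / (\<rho> / 2)) + 2 * d x y"
          proof -
            have "1 \<le> d x y / (\<rho> / 2)" using xy \<rho> by (simp add: field_simps)
            then have "(1 + H) * 1 \<le> (1 + H) * (d x y / (\<rho> / 2))" using H by (intro mult_left_mono) auto
            from add_mono[OF this xy(3)] show ?thesis by (simp only: mult_1_right)
          qed
          also have "\<dots> = K * d x y" by (simp add: K_def algebra_simps)
          finally have le: "(1 + d z y) / K \<le> d x y" using K by (simp add: field_simps)
          have p1: "0 < 1 + d z y" using dist_nonneg[of z y] by simp
          have "ker (s * p) x y \<le> ((1 + d z y) / K) powr (- (Q + s * p))"
            unfolding ker_def using le p1 K Q_pos sp_pos by (intro powr_mono2') auto
          also have "\<dots> = K powr (Q + s * p) * W y"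
            unfolding W_def using p1 K powr_divide[of "1 + d z y" K "- (Q + s * p)"] powr_minus[of K "Q + s * p"]
            by (simp only: less_imp_le) (simp add: divide_inverse mult.commute)
          finally show ?thesis .
        qed
        have "tail_dens a (V y) x y \<le> V y powr (p - 1) * ker (s * p) x y + V y powr (q - 1) * (L * (\<rho> / 2) powr (s * p - t * q) * ker (s * p) x y)"
          unfolding tail_dens_def using mult_left_mono[OF kt, of "V y powr (q - 1)"] by (simp add: mult_ac)
        also have "\<dots> = (V y powr (p - 1) + V y powr (q - 1) * (D - 1)) * ker (s * p) x y"
          by (simp add: D_def algebra_simps)
        also have "\<dots> \<le> (D * (1 + V y powr (q - 1))) * ker (s * p) x y"
        proof (rule mult_right_mono)
          have "0 \<le> D - 1" using D by simp
          then show "V y powr (p - 1) + V y powr (q - 1) * (D - 1) \<le> D * (1 + V y powr (q - 1))"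
            using V2 by (simp add: algebra_simps)
        qed simp
        also have "\<dots> \<le> (D * (1 + V y powr (q - 1))) * (K powr (Q + s * p) * W y)"
          using kW D by (intro mult_left_mono) (auto simp: add_nonneg_nonneg)
        also have "\<dots> = c1 * (1 + V y powr (q - 1)) * W y" by (simp add: c1_def mult_ac)
        also have "\<dots> \<le> c1 * (2 powr (q - 1) * \<bar>u y\<bar> powr (q - 1) + B) * W y"
          using V1 c1 W[of y] by (intro mult_right_mono mult_left_mono) (auto simp: B_def algebra_simps)
        also have "\<dots> = c1 * 2 powr (q - 1) * (\<bar>u y\<bar> powr (q - 1) * W y) + c1 * B * W y" by (simp add: algebra_simps)
        finally have "ennreal (tail_dens a (V y) x y) \<le> ennreal (c1 * 2 powr (q - 1) * (\<bar>u y\<bar> powr (q - 1) * W y) + c1 * B * W y)"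
          by (rule ennreal_leI)
        also have "\<dots> = f y" unfolding f_def using c1 B W[of y] by (simp add: ennreal_plus ennreal_mult)
        finally show ?thesis using True by simp
      qed simp
    qed
    also have "\<dots> = ennreal (enn2real (\<integral>\<^sup>+ y. f y \<partial>\<mu>))" using fin by simp
    finally show "(\<integral>\<^sup>+ y. ennreal (indicator {y. \<rho> \<le> d x0 y} y * tail_dens a (V y) x y) \<partial>\<mu>) \<le> ennreal (enn2real (\<integral>\<^sup>+ y. f y \<partial>\<mu>))" .
  qed
qed

section \<open>Decay of oscillation along geometric radii\<close>

lemma exists_decay_exponent:
  assumes "0 < \<theta>" "\<theta> \<le> 1 / 2" "0 < \<sigma>" "\<sigma> < 1"
  obtains \<beta> where "0 < \<beta>" "\<beta> \<le> \<beta>0" "1 - \<theta> \<le> \<sigma> powr \<beta>"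
proof
  \<comment> \<open>\<open>\<sigma> powr ?b = 1 - \<theta>\<close>: losing the fraction
    \<open>\<theta>\<close> of the oscillation per radius ratio \<open>\<sigma>\<close> is decay of
    this order. Capping by \<open>\<beta>0\<close> keeps the tails within the growth for which their
    constants were computed.\<close>
  let ?b = "ln (1 - \<theta>) / ln \<sigma>"
  have b: "0 < ?b" using assms by (intro divide_neg_neg) auto
  show "0 < min \<beta>0 ?b" using b \<beta>0(1) by simp
  show "min \<beta>0 ?b \<le> \<beta>0" by simp
  have "1 - \<theta> = exp (?b * ln \<sigma>)" using assms by simp
  also have "\<dots> = \<sigma> powr ?b" using assms by (simp add: powr_def)
  also have "\<dots> \<le> \<sigma> powr (min \<beta>0 ?b)" using assms by (intro powr_mono') auto
  finally show "1 - \<theta> \<le> \<sigma> powr (min \<beta>0 ?b)" .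
qed

lemma first_index:
  fixes \<sigma> R0 x :: real
  assumes "0 < \<sigma>" "\<sigma> < 1" "0 < R0" "0 < x"
  obtains n where "R0 * \<sigma> ^ n \<le> x" "\<And>i. i < n \<Longrightarrow> x < R0 * \<sigma> ^ i"
proof -
  obtain n0 where "\<sigma> ^ n0 < x / R0" using real_arch_pow_inv[of "x / R0" \<sigma>] assms by auto
  then have "R0 * \<sigma> ^ n0 \<le> x" using assms by (simp add: field_simps)
  then have "R0 * \<sigma> ^ (LEAST n. R0 * \<sigma> ^ n \<le> x) \<le> x" by (rule LeastI)
  moreover have "x < R0 * \<sigma> ^ i" if "i < (LEAST n. R0 * \<sigma> ^ n \<le> x)" for i
    using not_less_Least[OF that] by simp
  ultimately show thesis by (rule that)
qed

text \<open>With \<open>b\<close> the midpoint of the oscillation interval, this decides whether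
  \<open>growth\<close> is applied to \<open>u\<close> or to \<open>- u\<close>.\<close>

lemma half_measure:
  fixes u :: "'a \<Rightarrow> real"
  assumes [measurable]: "u \<in> borel_measurable \<mu>" and r: "0 < r"
  shows "c * r powr Q / 2 \<le> measure \<mu> {y. d x0 y < r \<and> u y \<le> b} \<or>
    c * r powr Q / 2 \<le> measure \<mu> {y. d x0 y < r \<and> - u y \<le> - b}"
proof -
  let ?X = "{y. d x0 y < r \<and> u y \<le> b}" and ?Y = "{y. d x0 y < r \<and> - u y \<le> - b}"
  have X: "?X \<in> sets \<mu>" by (rule sets_Collect_mu) measurable
  have "{y. d x0 y < r \<and> b \<le> u y} \<in> sets \<mu>" by (rule sets_Collect_mu) measurable
  then have Y: "?Y \<in> sets \<mu>" by simp
  have eq: "{y. d x0 y < r} = ?X \<union> ?Y" by auto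
  have "c * r powr Q = measure \<mu> {y. d x0 y < r}"
    using emeasure_ball[OF r, of x0] c_pos by (simp add: measure_def)
  also have "\<dots> \<le> measure \<mu> ?X + measure \<mu> ?Y"
  proof -
    have "measure \<mu> (?X \<union> ?Y) \<le> measure \<mu> ?X + measure \<mu> ?Y"
      by (rule measure_Un_le[OF X Y])
    then show ?thesis by (simp only: eq)
  qed
  finally have "c * r powr Q / 2 + c * r powr Q / 2 \<le> measure \<mu> ?X + measure \<mu> ?Y" by simp
  then show ?thesis by (rule contrapos_pp) (simp only: de_Morgan_disj not_le add_strict_mono)
qed

text \<open>\<open>\<delta>\<close> and \<open>CT\<close> fix the ratio \<open>\<Lambda>\<close>,
  this fixes \<open>\<sigma>\<close>, and \<open>\<beta>\<close> follows; none of them sees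
  \<open>u\<close>, whereas \<open>C\<close> and \<open>R0\<close> come after the solution.
  \<open>W\<close> is the set on which the bound \<open>M\<close> holds, and \<open>z\<close>,
  \<open>H\<close> locate the centres for the far tail.\<close>

lemma oscillation:
  obtains \<beta> where "0 < \<beta>" "\<beta> < s * p / (q - 1)" "\<And>a \<Omega> u z H \<rho> W.
    \<lbrakk>modulating a; weak_sol a \<Omega> u; 0 < \<rho>; 0 \<le> H;
     (\<integral>\<^sup>+ y. ennreal (\<bar>u y\<bar> powr (q - 1) * (1 + d z y) powr (- (Q + s * p))) \<partial>\<mu>) < \<infinity>;
     AE y in \<mu>. y \<in> W \<longrightarrow> \<bar>u y\<bar> \<le> M\<rbrakk> \<Longrightarrow>
    \<exists>C R0. 0 < C \<and> 0 < R0 \<and> (\<forall>x0 r. d z x0 \<le> H \<and> {y. d x0 y < \<rho>} \<subseteq> W \<inter> \<Omega> \<and> 0 < r \<and> r \<le> R0 \<longrightarrow>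
      (\<exists>S. AE y in \<mu>. d x0 y < r \<longrightarrow> \<bar>u y - S\<bar> \<le> C * r powr \<beta>))"
proof -
  from growth obtain \<delta> where \<delta>: "0 < \<delta>" "\<delta> \<le> 1 / 4" and grow: "\<And>a \<Omega> u x0 r R S \<omega>.
    \<lbrakk>growth_hyp a \<Omega> u x0 r R S (\<delta> * \<omega>); 0 < \<omega>; \<omega> \<le> 2 * M;
      c * r powr Q / 2 \<le> measure \<mu> {y. d x0 y < r \<and> u y \<le> S - \<omega> / 2}\<rbrakk>
    \<Longrightarrow> AE y in \<mu>. d x0 y < r / 8 \<longrightarrow> u y \<le> S - \<delta> * \<omega> / 8"
    by blast
  from tail_near obtain CT where CT: "0 < CT" and near: "\<And>a V x0 x r R \<rho>0 \<omega>.
    \<lbrakk>modulating a; V \<in> borel_measurable \<mu>; \<And>y. 0 \<le> V y; 0 < r; 2 * r \<le> R; 0 < \<omega>; d x0 x < r;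
      AE y in \<mu>. R \<le> d x0 y \<and> d x0 y < \<rho>0 \<longrightarrow> V y \<le> 4 * \<omega> * (d x0 y / R) powr \<beta>0 \<and> V y \<le> 5 * M\<rbrakk>
    \<Longrightarrow> (\<integral>\<^sup>+ y. ennreal (indicator {y. R \<le> d x0 y \<and> d x0 y < \<rho>0} y * tail_dens a (V y) x y) \<partial>\<mu>)
      \<le> ennreal (CT * (\<omega> powr (p - 1) * R powr (- (s * p)) + a x0 x0 * \<omega> powr (q - 1) * R powr (- (t * q))))"
    by blast
  define \<theta> where "\<theta> = \<delta> / 8"
  have \<theta>: "0 < \<theta>" "\<theta> \<le> 1 / 2" using \<delta> by (auto simp: \<theta>_def)
  \<comment> \<open>Relative to the scale \<open>Rj j / \<Lambda>\<close> of the cone, the near tail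
    carries the factor \<open>CT * \<Lambda> powr (- (s * p))\<close>. Taking
    \<open>\<Lambda> powr (s * p) \<ge> Y\<close> brings it down to half of what a cone of height
    \<open>\<delta> * \<omega> j\<close> tolerates.\<close>
  define Y where "Y = 2 * CT / \<delta> powr (q - 1)"
  have Y: "0 < Y" using CT \<delta> by (simp add: Y_def)
  define \<Lambda> where "\<Lambda> = max 2 (Y powr (1 / (s * p)))"
  have \<Lambda>: "2 \<le> \<Lambda>" by (simp add: \<Lambda>_def)
  have Ysp: "Y \<le> \<Lambda> powr (s * p)"
  proof -
    have "Y = (Y powr (1 / (s * p))) powr (s * p)" unfolding powr_powr using sp_pos Y by auto
    also have "\<dots> \<le> \<Lambda> powr (s * p)" using sp_pos by (intro powr_mono2) (auto simp: \<Lambda>_def)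
    finally show ?thesis .
  qed
  \<comment> \<open>\<open>growth\<close> in a ball of radius \<open>Rj j / \<Lambda>\<close>
    improves the bound on an eighth of it, hence this ratio of consecutive radii.\<close>
  define \<sigma> where "\<sigma> = 1 / (8 * \<Lambda>)"
  have \<sigma>: "0 < \<sigma>" "\<sigma> < 1" using \<Lambda> by (auto simp: \<sigma>_def field_simps)
  obtain \<beta> where \<beta>: "0 < \<beta>" "\<beta> \<le> \<beta>0" "1 - \<theta> \<le> \<sigma> powr \<beta>"
    using exists_decay_exponent[OF \<theta> \<sigma>] by blast
  have \<beta>1: "\<sigma> powr \<beta> \<le> 1" using \<sigma> \<beta> powr_mono'[of 0 \<beta> \<sigma>] by simp
  have \<beta>half: "1 / 2 \<le> \<sigma> powr \<beta>" using \<beta> \<theta> by linarith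
  show ?thesis
  proof
    show "0 < \<beta>" "\<beta> < s * p / (q - 1)" using \<beta> \<beta>0(2) by auto
    fix a \<Omega> u z H \<rho>' W
    assume a: "modulating a" and sol: "weak_sol a \<Omega> u" and \<rho>': "0 < (\<rho>' :: real)" and H: "0 \<le> (H::real)"
      and tail: "(\<integral>\<^sup>+ y. ennreal (\<bar>u y\<bar> powr (q - 1) * (1 + d z y) powr (- (Q + s * p))) \<partial>\<mu>) < \<infinity>"
      and uM: "AE y in \<mu>. y \<in> W \<longrightarrow> \<bar>u y\<bar> \<le> M"
    define \<rho> where "\<rho> = min \<rho>' 1"
    have \<rho>: "0 < \<rho>" "\<rho> \<le> 1" "\<rho> \<le> \<rho>'" using \<rho>' by (auto simp: \<rho>_def)
    have u [measurable]: "u \<in> borel_measurable \<mu>" using sol by (simp add: weak_sol_def finite_energy_def)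
    obtain T where T: "0 \<le> T" and far: "\<And>x0 x V. \<lbrakk>d z x0 \<le> H; d x0 x < \<rho> / 2; \<And>y. 0 \<le> V y; \<And>y. V y \<le> \<bar>u y\<bar> + 5 * M\<rbrakk> \<Longrightarrow>
      (\<integral>\<^sup>+ y. ennreal (indicator {y. \<rho> \<le> d x0 y} y * tail_dens a (V y) x y) \<partial>\<mu>) \<le> ennreal T"
      using tail_far[OF a u tail \<rho>(1,2) H] by blast
    \<comment> \<open>The bound on \<open>R0 powr (s * p)\<close> under which the far tail
      \<open>T\<close> uses at most half of the tolerance at the initial oscillation
      \<open>2 * M\<close>.\<close>
    define X where "X = \<delta> powr (p - 1) * (2 * M) powr (p - 1) / ((T + 1) * 2)"
    have X: "0 < X" using \<delta> M_pos T by (simp add: X_def)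
    define R0 where "R0 = min (\<rho> / 2) (X powr (1 / (s * p)))"
    have R0: "0 < R0" "R0 \<le> \<rho> / 2" using \<rho> X by (auto simp: R0_def)
    have R0X: "T \<le> \<delta> powr (p - 1) * (2 * M) powr (p - 1) * R0 powr (- (s * p)) / 2"
    proof -
      have "R0 powr (s * p) \<le> (X powr (1 / (s * p))) powr (s * p)"
        using R0 sp_pos by (intro powr_mono2) (auto simp: R0_def)
      also have "\<dots> = X" unfolding powr_powr using sp_pos X by auto
      finally have "(T + 1) * R0 powr (s * p) \<le> (T + 1) * X" using T by (intro mult_left_mono) auto
      also have "\<dots> = \<delta> powr (p - 1) * (2 * M) powr (p - 1) / 2"
        unfolding X_def times_divide_eq_right using T by (intro mult_divide_mult_cancel_left) auto
      finally have "(T + 1) * (R0 powr (s * p) * R0 powr (- (s * p))) \<le> \<delta> powr (p - 1) * (2 * M) powr (p - 1) / 2 * R0 powr (- (s * p))"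
        unfolding mult.assoc[symmetric] by (rule mult_right_mono) simp
      then show ?thesis using R0 by (simp add: powr_add[symmetric])
    qed
    define Rj where "Rj j = R0 * \<sigma> ^ j" for j :: nat
    define \<omega> where "\<omega> j = 2 * M * (\<sigma> powr \<beta>) ^ j" for j :: nat
    have Rj: "0 < Rj j" "Rj j \<le> R0" for j
      using R0 \<sigma> power_le_one[of \<sigma> j] by (auto simp: Rj_def mult_left_le)
    have Rj_mono: "i \<le> j \<Longrightarrow> Rj j \<le> Rj i" for i j
      using R0 \<sigma> power_decreasing[of i j \<sigma>] by (simp add: Rj_def)
    have \<omega>: "0 < \<omega> j" for j using M_pos \<sigma> by (simp add: \<omega>_def)
    have \<omega>_mono: "i \<le> j \<Longrightarrow> \<omega> j \<le> \<omega> i" for i j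
      using M_pos \<sigma> \<beta>1 power_decreasing[of i j "\<sigma> powr \<beta>"] by (simp add: \<omega>_def)
    have \<omega>0: "\<omega> 0 = 2 * M" by (simp add: \<omega>_def)
    have \<omega>_le: "\<omega> j \<le> 2 * M" for j using \<omega>_mono[of 0 j] \<omega>0 by simp
    have \<omega>_step: "(1 - \<theta>) * \<omega> j \<le> \<omega> (Suc j)" "\<omega> j \<le> 2 * \<omega> (Suc j)" for j
    proof -
      have eq: "\<omega> (Suc j) = \<sigma> powr \<beta> * \<omega> j" by (simp add: \<omega>_def)
      show "(1 - \<theta>) * \<omega> j \<le> \<omega> (Suc j)"
        unfolding eq using \<beta>(3) \<omega>[of j] by (intro mult_right_mono) auto
      have "1 / 2 * \<omega> j \<le> \<omega> (Suc j)"
        unfolding eq using \<beta>half \<omega>[of j] by (intro mult_right_mono) auto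
      then show "\<omega> j \<le> 2 * \<omega> (Suc j)" by simp
    qed
    have \<omega>_R: "\<omega> j = 2 * M * (Rj j / R0) powr \<beta>" for j
      using R0 \<sigma> by (simp add: \<omega>_def Rj_def powr_powr powr_realpow[symmetric] mult.commute)
    \<comment> \<open>The oscillation at a larger radius is compared with that at
      \<open>Rj j\<close>. As \<open>x / Rj j \<ge> 1\<close>, the exponent \<open>\<beta>\<close>
      may be raised to \<open>\<beta>0\<close>, so the constants of the tail estimate never see
      \<open>\<beta>\<close>.\<close>
    have \<omega>_ratio: "\<omega> n \<le> \<omega> j * (x / Rj j) powr \<beta>0" if "Rj n \<le> x" "Rj j \<le> x" for n j x
    proof -
      have "\<omega> n \<le> 2 * M * (x / R0) powr \<beta>"
        unfolding \<omega>_R using that(1) R0 \<beta> M_pos Rj(1)[of n]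
        by (intro mult_left_mono powr_mono2) (auto simp: divide_right_mono)
      also have "(x / R0) powr \<beta> = (Rj j / R0) powr \<beta> * (x / Rj j) powr \<beta>"
        using R0 Rj(1)[of j] that by (simp add: powr_mult[symmetric])
      also have "2 * M * \<dots> = \<omega> j * (x / Rj j) powr \<beta>" by (simp add: \<omega>_R)
      also have "\<dots> \<le> \<omega> j * (x / Rj j) powr \<beta>0"
        using \<beta>(2) \<omega>[of j] Rj(1)[of j] that by (intro mult_left_mono powr_mono) auto
      finally show ?thesis .
    qed
    \<comment> \<open>All earlier balls stay in the induction hypothesis: on the ball of index
      \<open>i\<close>, \<open>u\<close> leaves the current interval from \<open>b\<close> to
      \<open>b + \<omega> j\<close> by at most \<open>\<omega> i - \<omega> j\<close> on either
      side. This is what bounds the tail at the next step.\<close>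
    have osc: "\<exists>b. - M \<le> b \<and> b + \<omega> j \<le> M \<and>
        (\<forall>i\<le>j. AE y in \<mu>. d x0 y < Rj i \<longrightarrow> b + \<omega> j - \<omega> i \<le> u y \<and> u y \<le> b + \<omega> i)"
      if x0: "d z x0 \<le> H" "{y. d x0 y < \<rho>'} \<subseteq> W \<inter> \<Omega>" for x0 j
    proof (induction j)
      case 0
      have "AE y in \<mu>. d x0 y < Rj 0 \<longrightarrow> - M \<le> u y \<and> u y \<le> - M + \<omega> 0"
        using uM
      proof (rule AE_mp, intro AE_I2 impI)
        fix y assume y: "y \<in> W \<longrightarrow> \<bar>u y\<bar> \<le> M" "d x0 y < Rj 0"
        then have "d x0 y < \<rho>'" using R0 \<rho> by (simp add: Rj_def)
        then show "- M \<le> u y \<and> u y \<le> - M + \<omega> 0" using y x0 \<omega>0 by auto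
      qed
      then show ?case by (intro exI[of _ "- M"]) (simp add: \<omega>0)
    next
      case (Suc j)
      then obtain b where b: "- M \<le> b" "b + \<omega> j \<le> M"
        and ub: "\<And>i. i \<le> j \<Longrightarrow> AE y in \<mu>. d x0 y < Rj i \<longrightarrow> b + \<omega> j - \<omega> i \<le> u y \<and> u y \<le> b + \<omega> i"
        by blast
      define r where "r = Rj j / \<Lambda>"
      define k where "k = \<delta> * \<omega> j"
      have k: "0 < k" "k \<le> \<omega> j / 4" using \<delta> \<omega>[of j] mult_right_mono[of \<delta> "1/4" "\<omega> j"] by (auto simp: k_def)
      have r: "0 < r" "2 * r \<le> Rj j" "r \<le> 1" "r < \<rho> / 2" "r \<le> Rj j"
      proof -
        show "0 < r" using Rj(1)[of j] \<Lambda> by (simp add: r_def)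
        have "r * \<Lambda> = Rj j" using \<Lambda> by (simp add: r_def)
        moreover have "r * 2 \<le> r * \<Lambda>" using \<Lambda> \<open>0 < r\<close> by (intro mult_left_mono) auto
        ultimately show *: "2 * r \<le> Rj j" by simp
        then show "r \<le> 1" "r < \<rho> / 2" "r \<le> Rj j" using Rj(2)[of j] R0 \<rho> \<open>0 < r\<close> by linarith+
      qed
      have r8: "r / 8 = Rj (Suc j)" by (simp add: r_def Rj_def \<sigma>_def)
      let ?G = "phase_scale (a x0 x0) r"
      have a0: "0 \<le> a x0 x0" using modulating_nonneg[OF a] .
      have AEall: "AE y in \<mu>. (\<forall>i\<le>j. d x0 y < Rj i \<longrightarrow> b + \<omega> j - \<omega> i \<le> u y \<and> u y \<le> b + \<omega> i) \<and> (y \<in> W \<longrightarrow> \<bar>u y\<bar> \<le> M)"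
      proof -
        have "AE y in \<mu>. \<forall>i\<in>{..j}. d x0 y < Rj i \<longrightarrow> b + \<omega> j - \<omega> i \<le> u y \<and> u y \<le> b + \<omega> i"
          using ub by (intro AE_finite_allI) auto
        then show ?thesis using uM by eventually_elim auto
      qed
      \<comment> \<open>Both choices of \<open>S\<close> occur: \<open>b + \<omega> j\<close> when
        \<open>growth\<close> is applied to \<open>u\<close>, and \<open>b\<close> when it is
        applied to \<open>- u\<close>.\<close>
      have tailG: "(\<integral>\<^sup>+ y. ennreal (indicator {y. Rj j \<le> d x0 y} y * tail_dens a (\<bar>u y - S\<bar> + k) x y) \<partial>\<mu>)
          \<le> ennreal (?G k / k)"
        if x: "d x0 x < r" and S: "S = b \<or> S = b + \<omega> j" for x S
      proof -
        define V where "V y = \<bar>u y - S\<bar> + k" for y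
        have [measurable]: "V \<in> borel_measurable \<mu>" unfolding V_def by measurable
        have V0: "0 \<le> V y" for y using k by (simp add: V_def)
        have S_M: "\<bar>S\<bar> \<le> M" using S b \<omega>[of j] by auto
        have kM: "k \<le> M / 2" using k \<omega>_le[of j] by linarith
        have VM: "V y \<le> \<bar>u y\<bar> + 5 * M" for y using S_M kM M_pos unfolding V_def by linarith
        have AEV: "AE y in \<mu>. Rj j \<le> d x0 y \<and> d x0 y < \<rho> \<longrightarrow> V y \<le> 4 * \<omega> j * (d x0 y / Rj j) powr \<beta>0 \<and> V y \<le> 5 * M"
          using AEall
        proof (rule AE_mp, intro AE_I2 impI)
          fix y assume y: "(\<forall>i\<le>j. d x0 y < Rj i \<longrightarrow> b + \<omega> j - \<omega> i \<le> u y \<and> u y \<le> b + \<omega> i) \<and> (y \<in> W \<longrightarrow> \<bar>u y\<bar> \<le> M)"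
            and dy: "Rj j \<le> d x0 y \<and> d x0 y < \<rho>"
          have "d x0 y < \<rho>'" using dy \<rho> by simp
          then have uy: "\<bar>u y\<bar> \<le> M" using y x0 by auto
          have V5: "V y \<le> 5 * M" using uy S_M kM M_pos unfolding V_def by linarith
          have "0 < d x0 y" using dy Rj(1)[of j] by linarith
          \<comment> \<open>\<open>n\<close> selects the shell of \<open>y\<close>: outside the ball
            of index \<open>n\<close>, inside that of index \<open>n - 1\<close>, whose oscillation
            bound applies. For \<open>n = 0\<close> the bound \<open>M\<close> takes over.\<close>
          from first_index[OF \<sigma> R0(1) this] obtain n where n: "Rj n \<le> d x0 y" "\<And>i. i < n \<Longrightarrow> d x0 y < Rj i"
            unfolding Rj_def by blast
          have nj: "n \<le> j" using n(2)[of j] dy by (meson not_le)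
          have "V y \<le> 4 * \<omega> n"
          proof (cases n)
            case 0
            have "V y \<le> 4 * M" using uy S_M kM M_pos unfolding V_def by linarith
            then show ?thesis using 0 \<omega>0 M_pos by simp
          next
            case (Suc i)
            have "d x0 y < Rj i" using n(2)[of i] Suc by simp
            then have ui: "b + \<omega> j - \<omega> i \<le> u y" "u y \<le> b + \<omega> i" using y nj Suc by auto
            have ji: "\<omega> j \<le> \<omega> i" using \<omega>_mono nj Suc by simp
            have "\<bar>u y - S\<bar> \<le> \<omega> i" using S ui ji \<omega>[of j] by (auto simp: abs_le_iff)
            then have "V y \<le> 2 * \<omega> i" using k ji \<omega>[of j] unfolding V_def by linarith
            then show ?thesis using \<omega>_step(2)[of i] Suc by simp
          qed
          also have "\<dots> \<le> 4 * (\<omega> j * (d x0 y / Rj j) powr \<beta>0)"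
            using \<omega>_ratio[OF n(1)] dy by (intro mult_left_mono) auto
          finally show "V y \<le> 4 * \<omega> j * (d x0 y / Rj j) powr \<beta>0 \<and> V y \<le> 5 * M" using V5 by simp
        qed
        have S1: "{y. Rj j \<le> d x0 y \<and> d x0 y < \<rho>} \<in> sets \<mu>" "{y. \<rho> \<le> d x0 y} \<in> sets \<mu>"
          by (rule sets_Collect_mu; measurable)+
        note [measurable] = S1 tail_dens_measurable[OF a \<open>V \<in> borel_measurable \<mu>\<close> measurable_const_space measurable_ident, unfolded id_def]
        have tn: "0 \<le> tail_dens a (V y) x y" for y using tail_dens_nonneg[OF a] .
        have "(\<integral>\<^sup>+ y. ennreal (indicator {y. Rj j \<le> d x0 y} y * tail_dens a (V y) x y) \<partial>\<mu>)
          \<le> (\<integral>\<^sup>+ y. ennreal (indicator {y. Rj j \<le> d x0 y \<and> d x0 y < \<rho>} y * tail_dens a (V y) x y)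
             + ennreal (indicator {y. \<rho> \<le> d x0 y} y * tail_dens a (V y) x y) \<partial>\<mu>)"
          by (intro nn_integral_mono) (auto simp: indicator_def)
        also have "\<dots> = (\<integral>\<^sup>+ y. ennreal (indicator {y. Rj j \<le> d x0 y \<and> d x0 y < \<rho>} y * tail_dens a (V y) x y) \<partial>\<mu>)
             + (\<integral>\<^sup>+ y. ennreal (indicator {y. \<rho> \<le> d x0 y} y * tail_dens a (V y) x y) \<partial>\<mu>)"
          by (rule nn_integral_add) measurable
        also have "\<dots> \<le> ennreal (CT * (\<omega> j powr (p - 1) * Rj j powr (- (s * p)) + a x0 x0 * \<omega> j powr (q - 1) * Rj j powr (- (t * q)))) + ennreal T"
        proof (rule add_mono)
          show "(\<integral>\<^sup>+ y. ennreal (indicator {y. Rj j \<le> d x0 y \<and> d x0 y < \<rho>} y * tail_dens a (V y) x y) \<partial>\<mu>)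
            \<le> ennreal (CT * (\<omega> j powr (p - 1) * Rj j powr (- (s * p)) + a x0 x0 * \<omega> j powr (q - 1) * Rj j powr (- (t * q))))"
            by (rule near[OF a _ V0 r(1,2) \<omega> x AEV]) measurable
          show "(\<integral>\<^sup>+ y. ennreal (indicator {y. \<rho> \<le> d x0 y} y * tail_dens a (V y) x y) \<partial>\<mu>) \<le> ennreal T"
            by (rule far[OF x0(1) _ V0 VM]) (use x r in linarith)
        qed
        also have "\<dots> = ennreal (CT * (\<omega> j powr (p - 1) * Rj j powr (- (s * p)) + a x0 x0 * \<omega> j powr (q - 1) * Rj j powr (- (t * q))) + T)"
          using CT a0 T by (simp add: ennreal_plus)
        also have "\<dots> \<le> ennreal (?G k / k)"
        proof (rule ennreal_leI)
          let ?P = "\<omega> j powr (p - 1) * r powr (- (s * p))" and ?T = "a x0 x0 * \<omega> j powr (q - 1) * r powr (- (t * q))"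
          have P0: "0 \<le> ?P" "0 \<le> ?T" using a0 by auto
          have Rr: "Rj j = \<Lambda> * r" using \<Lambda> by (simp add: r_def)
          have \<Lambda>t: "\<Lambda> powr (- (t * q)) \<le> \<Lambda> powr (- (s * p))" using \<Lambda> sp_le_tq by (intro powr_mono) auto
          have \<Lambda>s: "CT * \<Lambda> powr (- (s * p)) \<le> \<delta> powr (q - 1) / 2"
          proof -
            have "CT * 2 \<le> \<delta> powr (q - 1) * \<Lambda> powr (s * p)" using Ysp \<delta> by (simp add: Y_def field_simps)
            then have "CT * 2 * \<Lambda> powr (- (s * p)) \<le> \<delta> powr (q - 1) * (\<Lambda> powr (s * p) * \<Lambda> powr (- (s * p)))"
              unfolding mult.assoc[symmetric] by (rule mult_right_mono) simp
            also have "\<Lambda> powr (s * p) * \<Lambda> powr (- (s * p)) = 1" using \<Lambda> by (simp add: powr_add[symmetric])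
            finally show ?thesis by simp
          qed
          have "CT * (\<omega> j powr (p - 1) * Rj j powr (- (s * p)) + a x0 x0 * \<omega> j powr (q - 1) * Rj j powr (- (t * q)))
            = CT * \<Lambda> powr (- (s * p)) * ?P + CT * \<Lambda> powr (- (t * q)) * ?T"
            unfolding Rr using r(1) \<Lambda> by (simp add: powr_mult algebra_simps)
          also have "\<dots> \<le> \<delta> powr (q - 1) / 2 * ?P + \<delta> powr (q - 1) / 2 * ?T"
          proof -
            have "CT * \<Lambda> powr (- (t * q)) \<le> CT * \<Lambda> powr (- (s * p))" using \<Lambda>t CT by (intro mult_left_mono) auto
            then show ?thesis using \<Lambda>s P0 by (intro add_mono mult_right_mono) auto
          qed
          also have "\<delta> powr (q - 1) / 2 * ?P \<le> \<delta> powr (p - 1) / 2 * ?P"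
            using P0 \<delta> p_le_q by (intro mult_right_mono divide_right_mono powr_mono') auto
          finally have near': "CT * (\<omega> j powr (p - 1) * Rj j powr (- (s * p)) + a x0 x0 * \<omega> j powr (q - 1) * Rj j powr (- (t * q)))
            \<le> \<delta> powr (p - 1) / 2 * ?P + \<delta> powr (q - 1) / 2 * ?T" by simp
          have far': "T \<le> \<delta> powr (p - 1) / 2 * ?P"
          proof -
            \<comment> \<open>\<open>T\<close> was absorbed at radius \<open>R0\<close>; because
              \<open>\<beta> * (p - 1) \<le> s * p\<close>, the tolerance does not decrease as the
              radii shrink.\<close>
            have "(2 * M) powr (p - 1) * R0 powr (- (s * p)) \<le> \<omega> j powr (p - 1) * Rj j powr (- (s * p))"
            proof -
              have b1: "\<beta> * (p - 1) \<le> s * p"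
                using \<beta>(2) \<beta>0(3) mult_right_mono[of \<beta> \<beta>0 "p - 1"] p_gt_1 by linarith
              have x: "0 < Rj j / R0" "Rj j / R0 \<le> 1" using Rj[of j] R0 by auto
              have "1 = (Rj j / R0) powr 0" using R0 Rj(1)[of j] by simp
              also have "\<dots> \<le> (Rj j / R0) powr (\<beta> * (p - 1) - s * p)"
                using x b1 by (intro powr_mono') auto
              also have "\<dots> = (Rj j / R0) powr (\<beta> * (p - 1)) * (Rj j / R0) powr (- (s * p))"
                by (simp add: powr_add[symmetric])
              finally have one: "1 \<le> (Rj j / R0) powr (\<beta> * (p - 1)) * (Rj j / R0) powr (- (s * p))" .
              have "\<omega> j powr (p - 1) = (2 * M) powr (p - 1) * (Rj j / R0) powr (\<beta> * (p - 1))"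
                unfolding \<omega>_R using M_pos powr_mult[of "2 * M" "(Rj j / R0) powr \<beta>" "p - 1"] by (simp only: powr_powr)
              moreover have "Rj j powr (- (s * p)) = R0 powr (- (s * p)) * (Rj j / R0) powr (- (s * p))"
                using R0 Rj(1)[of j] by (simp add: powr_mult[symmetric])
              ultimately have "\<omega> j powr (p - 1) * Rj j powr (- (s * p))
                = ((2 * M) powr (p - 1) * R0 powr (- (s * p))) * ((Rj j / R0) powr (\<beta> * (p - 1)) * (Rj j / R0) powr (- (s * p)))"
                by (simp only: mult_ac)
              then show ?thesis using mult_left_mono[OF one, of "(2 * M) powr (p - 1) * R0 powr (- (s * p))"] by simp
            qed
            also have "\<dots> \<le> ?P" using r Rj(1)[of j] sp_pos by (intro mult_left_mono powr_mono2') auto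
            finally have "\<delta> powr (p - 1) / 2 * ((2 * M) powr (p - 1) * R0 powr (- (s * p))) \<le> \<delta> powr (p - 1) / 2 * ?P"
              by (rule mult_left_mono) simp
            then show ?thesis using R0X by simp
          qed
          have "\<delta> powr (q - 1) / 2 * ?T \<le> \<delta> powr (q - 1) * ?T" using P0 by (intro mult_right_mono) auto
          then have "CT * (\<omega> j powr (p - 1) * Rj j powr (- (s * p)) + a x0 x0 * \<omega> j powr (q - 1) * Rj j powr (- (t * q))) + T
            \<le> \<delta> powr (p - 1) * ?P + \<delta> powr (q - 1) * ?T" using near' far' by (simp add: field_simps)
          also have "\<dots> = k powr (p - 1) * r powr (- (s * p)) + a x0 x0 * k powr (q - 1) * r powr (- (t * q))"
            using \<delta> \<omega>[of j] by (simp add: k_def powr_mult)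
          also have "\<dots> = ?G k / k"
            using k by (simp add: phase_scale_def powr_diff field_simps)
          finally show "CT * (\<omega> j powr (p - 1) * Rj j powr (- (s * p)) + a x0 x0 * \<omega> j powr (q - 1) * Rj j powr (- (t * q))) + T \<le> ?G k / k" .
        qed
        finally show ?thesis by (simp add: V_def)
      qed
      have ball: "{x. d x0 x < r} \<subseteq> \<Omega>" using x0(2) r(4) \<rho> by auto
      have k2M: "k \<le> 2 * M" using k \<omega>_le[of j] \<omega>[of j] by linarith
      have AEj: "AE y in \<mu>. d x0 y < Rj j \<longrightarrow> b \<le> u y \<and> u y \<le> b + \<omega> j" using ub[of j] by simp
      from half_measure[OF u r(1), of x0 "b + \<omega> j / 2"] show ?case
      proof
        assume half: "c * r powr Q / 2 \<le> measure \<mu> {y. d x0 y < r \<and> u y \<le> b + \<omega> j / 2}"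
        have "AE y in \<mu>. d x0 y < Rj j \<longrightarrow> u y \<le> b + \<omega> j" using AEj by eventually_elim auto
        then have "growth_hyp a \<Omega> u x0 r (Rj j) (b + \<omega> j) (\<delta> * \<omega> j)"
          unfolding growth_hyp_def k_def[symmetric] using a sol r ball k k2M tailG by auto
        moreover have "b + \<omega> j - \<omega> j / 2 = b + \<omega> j / 2" by simp
        ultimately have gr: "AE y in \<mu>. d x0 y < Rj (Suc j) \<longrightarrow> u y \<le> b + \<omega> j - \<delta> * \<omega> j / 8"
          using grow[OF _ \<omega> \<omega>_le, of a \<Omega> u x0 r "Rj j" "b + \<omega> j" j] half by (simp only: r8)
        show ?case
        proof (intro exI[of _ b] conjI allI impI)
          show "- M \<le> b" by fact
          show "b + \<omega> (Suc j) \<le> M" using b \<omega>_mono[of j "Suc j"] by simp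
          fix i assume i: "i \<le> Suc j"
          show "AE y in \<mu>. d x0 y < Rj i \<longrightarrow> b + \<omega> (Suc j) - \<omega> i \<le> u y \<and> u y \<le> b + \<omega> i"
          proof (cases "i \<le> j")
            case True
            from ub[OF True] show ?thesis
            proof eventually_elim
              case (elim y)
              then show ?case using \<omega>_mono[of j "Suc j"] by auto
            qed
          next
            case False
            then have i: "i = Suc j" using i by simp
            from gr AEj show ?thesis unfolding i
            proof eventually_elim
              case (elim y)
              then show ?case using Rj_mono[of j "Suc j"] \<omega>_step(1)[of j] by (auto simp: \<theta>_def algebra_simps)
            qed
          qed
        qed
      next
        assume half: "c * r powr Q / 2 \<le> measure \<mu> {y. d x0 y < r \<and> - u y \<le> - (b + \<omega> j / 2)}"
        have AEm: "AE y in \<mu>. d x0 y < Rj j \<longrightarrow> - u y \<le> - b" using AEj by eventually_elim auto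
        have tail': "(\<integral>\<^sup>+ y. ennreal (indicator {y. Rj j \<le> d x0 y} y * tail_dens a (\<bar>- u y - - b\<bar> + k) x y) \<partial>\<mu>)
          \<le> ennreal (?G k / k)" if "d x0 x < r" for x
        proof -
          have "\<bar>- u y - - b\<bar> = \<bar>u y - b\<bar>" for y by (simp add: abs_minus_commute)
          then show ?thesis using tailG[OF that, of b] by simp
        qed
        have "growth_hyp a \<Omega> (\<lambda>y. - u y) x0 r (Rj j) (- b) (\<delta> * \<omega> j)"
          unfolding growth_hyp_def k_def[symmetric] using a weak_sol_minus[OF sol] r ball k k2M tail' AEm by auto
        moreover have "- b - \<omega> j / 2 = - (b + \<omega> j / 2)" by simp
        ultimately have "AE y in \<mu>. d x0 y < Rj (Suc j) \<longrightarrow> - u y \<le> - b - \<delta> * \<omega> j / 8"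
          using grow[OF _ \<omega> \<omega>_le, of a \<Omega> "\<lambda>y. - u y" x0 r "Rj j" "- b" j] half by (simp only: r8)
        then have gr: "AE y in \<mu>. d x0 y < Rj (Suc j) \<longrightarrow> b + \<delta> * \<omega> j / 8 \<le> u y"
          by eventually_elim auto
        \<comment> \<open>Here the top \<open>b + \<omega> j\<close> of the interval is kept and the
          bottom rises.\<close>
        define b' where "b' = b + \<omega> j - \<omega> (Suc j)"
        show ?case
        proof (intro exI[of _ b'] conjI allI impI)
          show "- M \<le> b'" using b \<omega>_mono[of j "Suc j"] by (simp add: b'_def)
          show "b' + \<omega> (Suc j) \<le> M" using b by (simp add: b'_def)
          fix i assume i: "i \<le> Suc j"
          show "AE y in \<mu>. d x0 y < Rj i \<longrightarrow> b' + \<omega> (Suc j) - \<omega> i \<le> u y \<and> u y \<le> b' + \<omega> i"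
          proof (cases "i \<le> j")
            case True
            from ub[OF True] show ?thesis
            proof eventually_elim
              case (elim y)
              then show ?case using \<omega>_mono[of j "Suc j"] by (auto simp: b'_def)
            qed
          next
            case False
            then have i: "i = Suc j" using i by simp
            from gr AEj show ?thesis unfolding i
            proof eventually_elim
              case (elim y)
              then show ?case using Rj_mono[of j "Suc j"] \<omega>_step(1)[of j] by (auto simp: \<theta>_def b'_def algebra_simps)
            qed
          qed
        qed
      qed
    qed
    show "\<exists>C R0. 0 < C \<and> 0 < R0 \<and> (\<forall>x0 r. d z x0 \<le> H \<and> {y. d x0 y < \<rho>'} \<subseteq> W \<inter> \<Omega> \<and> 0 < r \<and> r \<le> R0 \<longrightarrow>
      (\<exists>S. AE y in \<mu>. d x0 y < r \<longrightarrow> \<bar>u y - S\<bar> \<le> C * r powr \<beta>))"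
    proof (rule exI[of _ "4 * M * R0 powr (- \<beta>)"], rule exI[of _ "R0"], intro conjI allI impI)
      show "0 < 4 * M * R0 powr (- \<beta>)" using M_pos R0 by simp
      show "0 < R0" by (rule R0)
      fix x0 r assume h: "d z x0 \<le> H \<and> {y. d x0 y < \<rho>'} \<subseteq> W \<inter> \<Omega> \<and> 0 < r \<and> r \<le> R0"
      \<comment> \<open>An arbitrary radius sits between consecutive ones; passing from
        \<open>\<omega> j\<close> to \<open>\<omega> (Suc j)\<close> costs a factor 2, which gives
        the constant \<open>4 * M\<close>.\<close>
      obtain j where j: "r \<le> Rj j" "\<omega> j \<le> 2 * \<omega> (Suc j)" "Rj (Suc j) \<le> r"
      proof -
        from first_index[OF \<sigma> R0(1), of r] h obtain n where n: "Rj n \<le> r" "\<And>i. i < n \<Longrightarrow> r < Rj i"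
          unfolding Rj_def by blast
        show thesis
        proof (cases n)
          case 0
          then have "r = Rj 0" using n h by (simp add: Rj_def)
          then show ?thesis using that[of 0] Rj_mono[of 0 1] \<omega>_step(2)[of 0] by simp
        next
          case (Suc i)
          then show ?thesis using that[of i] n(2)[of i] n(1) \<omega>_step(2)[of i] by simp
        qed
      qed
      obtain b where "AE y in \<mu>. d x0 y < Rj j \<longrightarrow> b \<le> u y \<and> u y \<le> b + \<omega> j"
        using osc[of x0 j] h by fastforce
      then have "AE y in \<mu>. d x0 y < r \<longrightarrow> \<bar>u y - b\<bar> \<le> 4 * M * R0 powr (- \<beta>) * r powr \<beta>"
      proof eventually_elim
        case (elim y)
        have "\<omega> j \<le> 2 * (2 * M * (r / R0) powr \<beta>)"
        proof -
          have "\<omega> (Suc j) \<le> 2 * M * (r / R0) powr \<beta>"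
            unfolding \<omega>_R using j(3) R0 \<beta> M_pos Rj(1)[of "Suc j"]
            by (intro mult_left_mono powr_mono2) (auto simp: divide_right_mono)
          then show ?thesis using j(2) by linarith
        qed
        also have "(r / R0) powr \<beta> = R0 powr (- \<beta>) * r powr \<beta>"
          using R0 h powr_divide[of r R0 \<beta>] by (simp add: powr_minus_divide)
        finally have "\<omega> j \<le> 4 * M * R0 powr (- \<beta>) * r powr \<beta>" by simp
        then show ?case using elim j(1) by auto
      qed
      then show "\<exists>S. AE y in \<mu>. d x0 y < r \<longrightarrow> \<bar>u y - S\<bar> \<le> 4 * M * R0 powr (- \<beta>) * r powr \<beta>" by blast
    qed
  qed
qed

end

subsection \<open>The Heisenberg group\<close>

lemma hmult_Pair: "hmult (x, y, \<tau>) (x', y', \<tau>') = (x + x', y + y', \<tau> + \<tau>' + (x \<bullet> y' - y \<bullet> x') / 2)"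
  by (simp add: hmult_def)

lemma hinv_Pair: "hinv (x, y, \<tau>) = (- x, - y, - \<tau>)"
  by (simp add: hinv_def)

lemma hmult_assoc: "hmult (hmult a b) c = hmult a (hmult b c)"
  by (cases a; cases b; cases c) (simp add: hmult_Pair algebra_simps inner_add_left inner_add_right add_divide_distrib diff_divide_distrib)

lemma hinv_left: "hmult (hinv a) a = 0"
  by (cases a) (simp add: hmult_Pair hinv_Pair zero_prod_def inner_commute)

lemma hmult_inv_cancel: "hmult a (hmult (hinv a) b) = b"
  by (cases a; cases b) (simp add: hmult_Pair hinv_Pair inner_add_left inner_add_right inner_commute algebra_simps diff_divide_distrib add_divide_distrib)

lemma hinv_diff: "hinv (hmult (hinv a) b) = hmult (hinv b) a"
  by (cases a; cases b) (simp add: hmult_Pair hinv_Pair inner_commute algebra_simps diff_divide_distrib)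

lemma hnorm_inv: "hnorm (hinv a) = hnorm a"
  by (cases a) (simp add: hnorm_def hinv_Pair)

lemma hnorm_nonneg: "0 \<le> hnorm a"
  by (cases a) (simp add: hnorm_def)

lemma hnorm_zero: "hnorm 0 = 0"
  by (simp add: hnorm_def zero_prod_def)

text \<open>Turns the fourth root into a Euclidean norm in the plane, where the triangle inequality
  is available.\<close>

lemma hnorm_square: "hnorm (x, y, \<tau>) ^ 2 = norm (norm x ^ 2 + norm y ^ 2, \<tau>)"
proof -
  have "hnorm (x, y, \<tau>) ^ 2 = ((norm x ^ 2 + norm y ^ 2) ^ 2 + \<tau> ^ 2) powr (1 / 4 + 1 / 4)"
    unfolding hnorm_def prod.case powr_add by (rule power2_eq_square)
  also have "\<dots> = sqrt ((norm x ^ 2 + norm y ^ 2) ^ 2 + \<tau> ^ 2)" by (simp add: powr_half_sqrt)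
  finally show ?thesis by (simp add: norm_Pair)
qed

text \<open>Bessel's inequality for the orthogonal vectors \<open>(x', y')\<close> and \<open>(y', - x')\<close>: this is the
  Cauchy-Schwarz inequality of the Hermitian form behind the group law.\<close>

lemma hermitian_cauchy_schwarz:
  fixes x y x' y' :: "'v::real_inner"
  shows "(x \<bullet> x' + y \<bullet> y') ^ 2 + (x \<bullet> y' - y \<bullet> x') ^ 2 \<le> (norm x ^ 2 + norm y ^ 2) * (norm x' ^ 2 + norm y' ^ 2)"
proof -
  define a b g w where "a = norm x ^ 2 + norm y ^ 2" and "b = norm x' ^ 2 + norm y' ^ 2"
    and "g = x \<bullet> x' + y \<bullet> y'" and "w = x \<bullet> y' - y \<bullet> x'"
  define v1 where "v1 = b *\<^sub>R x - g *\<^sub>R x' - w *\<^sub>R y'"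
  define v2 where "v2 = b *\<^sub>R y - g *\<^sub>R y' + w *\<^sub>R x'"
  have n: "norm x ^ 2 = x \<bullet> x" "norm y ^ 2 = y \<bullet> y" "norm x' ^ 2 = x' \<bullet> x'" "norm y' ^ 2 = y' \<bullet> y'"
    by (simp_all add: power2_norm_eq_inner)
  have "v1 \<bullet> v1 + v2 \<bullet> v2 = b ^ 2 * a + (g ^ 2 + w ^ 2) * b - 2 * b * g * g - 2 * b * w * w"
    unfolding v1_def v2_def a_def b_def g_def w_def n
    by (simp add: inner_diff_left inner_diff_right inner_add_left inner_add_right inner_commute power2_eq_square algebra_simps)
  also have "\<dots> = b * (a * b - (g ^ 2 + w ^ 2))" by (simp add: power2_eq_square algebra_simps)
  finally have nn: "0 \<le> b * (a * b - (g ^ 2 + w ^ 2))"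
    by (metis add_nonneg_nonneg inner_ge_zero)
  show ?thesis
  proof (cases "b = 0")
    case True
    then have "x' = 0" "y' = 0" unfolding b_def by (simp_all add: add_nonneg_eq_0_iff)
    then show ?thesis by simp
  next
    case False
    then have "0 < b" unfolding b_def by (simp add: add_nonneg_nonneg less_le)
    then have "0 \<le> a * b - (g ^ 2 + w ^ 2)" using nn by (simp add: zero_le_mult_iff)
    then show ?thesis by (simp add: a_def b_def g_def w_def)
  qed
qed

text \<open>The squared norm of a product is the length of a sum of three plane vectors: two whose
  lengths are the squared norms of the factors, and the mixed vector
  \<open>(2 * ?g, ?w / 2)\<close>. The Hermitian inequality bounds the latter by
  \<open>2 * (hnorm a * hnorm b)\<close>, which completes the square; the normalisation of the group
  law leaves slack, as \<open>?w ^ 2 / 4 \<le> 4 * ?w ^ 2\<close>.\<close>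

lemma hnorm_triangle: "hnorm (hmult a b) \<le> hnorm a + hnorm b"
proof -
  obtain x y \<tau> where a: "a = (x, y, \<tau>)" by (cases a)
  obtain x' y' \<tau>' where b: "b = (x', y', \<tau>')" by (cases b)
  let ?na = "norm x ^ 2 + norm y ^ 2" and ?nb = "norm x' ^ 2 + norm y' ^ 2"
  let ?g = "x \<bullet> x' + y \<bullet> y'" and ?w = "x \<bullet> y' - y \<bullet> x'"
  have sq: "norm (x + x') ^ 2 + norm (y + y') ^ 2 = ?na + ?nb + 2 * ?g"
    by (simp add: power2_norm_eq_inner inner_add_left inner_add_right inner_commute algebra_simps)
  have "hnorm (hmult a b) ^ 2 = norm (norm (x + x') ^ 2 + norm (y + y') ^ 2, \<tau> + \<tau>' + ?w / 2)"
    unfolding a b hmult_Pair hnorm_square ..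
  also have "\<dots> = norm ((?na, \<tau>) + (?nb, \<tau>') + (2 * ?g, ?w / 2))" unfolding sq by (simp add: add.assoc)
  also have "\<dots> \<le> norm (?na, \<tau>) + norm (?nb, \<tau>') + norm (2 * ?g, ?w / 2)"
    by (intro norm_triangle_le add_right_mono norm_triangle_ineq)
  also have "norm (2 * ?g, ?w / 2) \<le> 2 * (hnorm a * hnorm b)"
  proof (rule power2_le_imp_le)
    have "norm (2 * g', w' / 2) ^ 2 = 4 * g' ^ 2 + w' ^ 2 / 4" for g' w' :: real
      by (simp add: norm_Pair power_divide power_mult_distrib)
    then have "norm (2 * ?g, ?w / 2) ^ 2 = 4 * ?g ^ 2 + ?w ^ 2 / 4" .
    also have "\<dots> \<le> 4 * (?g ^ 2 + ?w ^ 2)" by simp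
    also have "\<dots> \<le> 4 * (?na * ?nb)" using hermitian_cauchy_schwarz[of x x' y y'] by simp
    also have "\<dots> \<le> 4 * (norm (?na, \<tau>) * norm (?nb, \<tau>'))"
    proof -
      have "?na \<le> norm (?na, \<tau>)" "?nb \<le> norm (?nb, \<tau>')"
        using norm_fst_le[of ?na \<tau>] norm_fst_le[of ?nb \<tau>'] by auto
      then show ?thesis by (intro mult_left_mono mult_mono) auto
    qed
    also have "\<dots> = (2 * (hnorm a * hnorm b)) ^ 2"
      unfolding a b hnorm_square[symmetric] by (simp add: power_mult_distrib)
    finally show "norm (2 * ?g, ?w / 2) ^ 2 \<le> (2 * (hnorm a * hnorm b)) ^ 2" .
  qed (simp add: hnorm_nonneg)
  also have "norm (?na, \<tau>) = hnorm a ^ 2" unfolding a hnorm_square ..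
  also have "norm (?nb, \<tau>') = hnorm b ^ 2" unfolding b hnorm_square ..
  finally have "hnorm (hmult a b) ^ 2 \<le> (hnorm a + hnorm b) ^ 2"
    by (simp add: power2_sum algebra_simps)
  then show ?thesis by (rule power2_le_imp_le) (simp add: hnorm_nonneg)
qed

section \<open>The left-invariant metric and the Euclidean topology\<close>

lemma hd_nonneg: "0 \<le> hd a b" by (simp add: hd_def hnorm_nonneg)
lemma hd_refl: "hd a a = 0" by (simp add: hd_def hinv_left hnorm_zero)
lemma hd_sym: "hd a b = hd b a" unfolding hd_def by (metis hinv_diff hnorm_inv)

lemma hd_triangle: "hd a c \<le> hd a b + hd b c"
proof -
  have "hmult (hinv c) a = hmult (hmult (hinv c) b) (hmult (hinv b) a)"
    by (simp add: hmult_assoc hmult_inv_cancel)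
  then show ?thesis unfolding hd_def using hnorm_triangle by (metis add.commute)
qed

lemma hd_zero_iff: "hd a b = 0 \<Longrightarrow> a = b"
proof -
  assume "hd a b = 0"
  obtain x y \<tau> where z: "hmult (hinv b) a = (x, y, \<tau>)" by (cases "hmult (hinv b) a")
  have "hnorm (x, y, \<tau>) ^ 2 = 0" using \<open>hd a b = 0\<close> z by (simp add: hd_def)
  then have "norm x ^ 2 + norm y ^ 2 = 0" "\<tau> = 0" unfolding hnorm_square by (auto simp: zero_prod_def)
  then have "hmult (hinv b) a = 0" using z by (simp add: add_nonneg_eq_0_iff zero_prod_def)
  then have "hmult b 0 = a" using hmult_inv_cancel[of b a] by simp
  then show "a = b" by (cases b) (simp add: hmult_def zero_prod_def)
qed

lemma hnorm_eq_hd: "hnorm a = hd a 0"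
  by (cases a) (simp add: hd_def hinv_def hmult_def zero_prod_def)

lemma continuous_hd: "continuous_on UNIV (\<lambda>z :: 'n::finite heis \<times> 'n heis. hd (fst z) (snd z))"
proof -
  \<comment> \<open>Two square roots replace the power \<open>1 / 4\<close>, as their continuity
    carries no side condition at 0.\<close>
  have "(\<lambda>z :: 'n heis \<times> 'n heis. hd (fst z) (snd z)) = (\<lambda>z.
     sqrt (sqrt ((norm (fst (fst z) - fst (snd z)) ^ 2 + norm (fst (snd (fst z)) - fst (snd (snd z))) ^ 2) ^ 2
       + (snd (snd (fst z)) - snd (snd (snd z)) + (fst (snd (snd z)) \<bullet> fst (fst z) - fst (snd z) \<bullet> fst (snd (fst z))) / 2) ^ 2)))"
  proof
    fix z :: "'n heis \<times> 'n heis"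
    obtain x y \<tau> x' y' \<tau>' where z: "z = ((x, y, \<tau>), (x', y', \<tau>'))" by (metis prod.exhaust)
    have s: "sqrt (sqrt r) = r powr (1 / 4)" if "0 \<le> r" for r :: real
      using that by (simp add: powr_half_sqrt[symmetric] powr_powr)
    show "hd (fst z) (snd z) = sqrt (sqrt ((norm (fst (fst z) - fst (snd z)) ^ 2 + norm (fst (snd (fst z)) - fst (snd (snd z))) ^ 2) ^ 2
       + (snd (snd (fst z)) - snd (snd (snd z)) + (fst (snd (snd z)) \<bullet> fst (fst z) - fst (snd z) \<bullet> fst (snd (fst z))) / 2) ^ 2))"
      unfolding z by (subst s) (simp_all add: hd_def hnorm_def hinv_Pair hmult_Pair)
  qed
  moreover have "continuous_on UNIV \<dots>" by (intro continuous_intros) auto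
  ultimately show ?thesis by (rule ssubst[where P="continuous_on UNIV"])
qed

lemma continuous_hd_right: "continuous_on UNIV (hd x)"
  using continuous_on_compose2[OF continuous_hd, of UNIV "\<lambda>y. (x, y)"] by (simp add: continuous_intros)

lemma continuous_hnorm: "continuous_on UNIV (hnorm :: 'n::finite heis \<Rightarrow> real)"
proof -
  have "hnorm = (\<lambda>y :: 'n heis. hd 0 y)" by (rule ext, subst hd_sym, rule hnorm_eq_hd)
  then show ?thesis using continuous_hd_right[of "0 :: 'n heis"] by simp
qed

lemma open_hd_ball: "open {y. hd x y < r}"
  using open_Collect_less[OF continuous_hd_right continuous_on_const] .

text \<open>Writing \<open>y\<close> as \<open>x\<close> times \<open>(a, b, c)\<close>, the
  horizontal parts are at most \<open>h\<close> and the vertical part at most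
  \<open>h ^ 2 \<le> h\<close>. The twist \<open>x1 \<bullet> b - x2 \<bullet> a\<close> costs the
  factor \<open>norm x\<close>, so the comparison is uniform on bounded sets.\<close>

lemma dist_le_hd:
  assumes "hd x y \<le> 1"
  shows "dist x y \<le> (3 + norm x) * hd x y"
proof -
  obtain a b c where z: "hmult (hinv x) y = (a, b, c)" by (cases "hmult (hinv x) y")
  obtain x1 x2 x3 where x: "x = (x1, x2, x3)" by (cases x)
  have y: "y = hmult x (a, b, c)" using hmult_inv_cancel[of x y] z by simp
  define h where "h = hd x y"
  have h: "h = hnorm (a, b, c)" using hd_sym[of x y] z by (simp add: h_def hd_def)
  have h0: "0 \<le> h" "h \<le> 1" using hnorm_nonneg assms by (auto simp: h h_def[symmetric])
  have h2: "norm (norm a ^ 2 + norm b ^ 2, c) = h ^ 2" by (simp add: h hnorm_square)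
  have "norm a ^ 2 + norm b ^ 2 \<le> h ^ 2" "\<bar>c\<bar> \<le> h ^ 2"
    using norm_fst_le[of "norm a ^ 2 + norm b ^ 2" c] norm_snd_le[of c "norm a ^ 2 + norm b ^ 2"] h2 by auto
  moreover have "h ^ 2 \<le> h * 1" unfolding power2_eq_square using h0 by (intro mult_left_mono) auto
  ultimately have abc2: "norm a ^ 2 \<le> h ^ 2" "norm b ^ 2 \<le> h ^ 2" and c: "\<bar>c\<bar> \<le> h"
    using zero_le_power2[of "norm a"] zero_le_power2[of "norm b"] by linarith+
  have abc: "norm a \<le> h" "norm b \<le> h" "\<bar>c\<bar> \<le> h"
    using power2_le_imp_le[OF abc2(1) h0(1)] power2_le_imp_le[OF abc2(2) h0(1)] c by auto
  have nx: "norm x1 \<le> norm x" "norm x2 \<le> norm x"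
    unfolding x using norm_fst_le[of x1 "(x2, x3)"] norm_snd_le[of "(x2, x3)" x1] norm_fst_le[of x2 x3] by auto
  have "\<bar>x1 \<bullet> b\<bar> \<le> norm x * h" "\<bar>x2 \<bullet> a\<bar> \<le> norm x * h"
    using Cauchy_Schwarz_ineq2[of x1 b] Cauchy_Schwarz_ineq2[of x2 a] mult_mono[OF nx(1) abc(2)] mult_mono[OF nx(2) abc(1)]
    by auto
  moreover have "\<bar>c + (v - w) / 2\<bar> \<le> h + N" if "\<bar>v\<bar> \<le> N" "\<bar>w\<bar> \<le> N" for v w N
    using that abc(3) by (simp add: abs_le_iff field_simps)
  ultimately have c': "\<bar>c + (x1 \<bullet> b - x2 \<bullet> a) / 2\<bar> \<le> h + norm x * h" by blast
  have "dist x y = norm (a, b, c + (x1 \<bullet> b - x2 \<bullet> a) / 2)"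
  proof -
    have "y - x = (a, b, c + (x1 \<bullet> b - x2 \<bullet> a) / 2)" unfolding y x hmult_Pair by simp
    moreover have "dist x y = norm (y - x)" unfolding dist_norm by (rule norm_minus_commute)
    ultimately show ?thesis by simp
  qed
  also have "\<dots> \<le> norm a + (norm b + \<bar>c + (x1 \<bullet> b - x2 \<bullet> a) / 2\<bar>)"
    using norm_Pair_le[of a "(b, c + (x1 \<bullet> b - x2 \<bullet> a) / 2)"] norm_Pair_le[of b "c + (x1 \<bullet> b - x2 \<bullet> a) / 2"] by simp
  also have "\<dots> \<le> (3 + norm x) * h" using abc c' by (simp add: algebra_simps)
  finally show ?thesis by (simp add: h_def)
qed

lemma hd_ball_in_open:
  fixes K S :: "'n::finite heis set"
  assumes K: "compact K" and S: "open S" "K \<subseteq> S"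
  obtains \<rho> where "0 < \<rho>" "\<And>x. x \<in> K \<Longrightarrow> {y. hd x y < \<rho>} \<subseteq> S"
proof -
  obtain e where e: "0 < e" "(\<Union>x\<in>K. ball x e) \<subseteq> S"
    using compact_subset_open_imp_ball_epsilon_subset[OF K S] by blast
  obtain B where B: "0 < B" "\<And>x. x \<in> K \<Longrightarrow> norm x \<le> B"
    using compact_imp_bounded[OF K] bounded_pos by blast
  define \<rho> where "\<rho> = min 1 (e / (3 + B))"
  show ?thesis
  proof
    show "0 < \<rho>" using e B by (simp add: \<rho>_def)
    fix x assume x: "x \<in> K"
    show "{y. hd x y < \<rho>} \<subseteq> S"
    proof
      fix y assume "y \<in> {y. hd x y < \<rho>}"
      then have y: "hd x y < 1" "hd x y < e / (3 + B)" by (auto simp: \<rho>_def)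
      have "dist x y \<le> (3 + norm x) * hd x y" by (rule dist_le_hd) (use y in simp)
      also have "\<dots> \<le> (3 + B) * hd x y" using B(2)[OF x] hd_nonneg[of x y] by (intro mult_right_mono) auto
      also have "\<dots> < e" using y B by (simp add: field_simps)
      finally have "y \<in> ball x e" by simp
      then show "y \<in> S" using e(2) x by blast
    qed
  qed
qed

section \<open>Lebesgue measure under translations and dilations\<close>

lemma nn_integral_lborel_translate:
  fixes f :: "'a::euclidean_space \<Rightarrow> ennreal"
  assumes "f \<in> borel_measurable borel"
  shows "(\<integral>\<^sup>+ x. f (k + x) \<partial>lborel) = (\<integral>\<^sup>+ x. f x \<partial>lborel)"
proof -
  have "(\<integral>\<^sup>+ x. f x \<partial>lborel) = (\<integral>\<^sup>+ x. f x \<partial>(distr lborel borel ((+) k)))" by (simp add: lborel_distr_plus)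
  also have "\<dots> = (\<integral>\<^sup>+ x. f (k + x) \<partial>lborel)" using assms by (subst nn_integral_distr) auto
  finally show ?thesis ..
qed

lemma nn_integral_lborel_triple:
  fixes f :: "('a::euclidean_space \<times> 'b::euclidean_space \<times> 'c::euclidean_space) \<Rightarrow> ennreal"
  assumes [measurable]: "f \<in> borel_measurable borel"
  shows "(\<integral>\<^sup>+ z. f z \<partial>lborel) = (\<integral>\<^sup>+ x. \<integral>\<^sup>+ y. \<integral>\<^sup>+ t. f (x, y, t) \<partial>lborel \<partial>lborel \<partial>lborel)"
proof -
  have f1: "f \<in> borel_measurable (lborel \<Otimes>\<^sub>M (lborel :: ('b \<times> 'c) measure))" by (simp add: lborel_prod)
  have "(\<integral>\<^sup>+ z. f z \<partial>lborel) = (\<integral>\<^sup>+ z. f z \<partial>(lborel \<Otimes>\<^sub>M (lborel :: ('b \<times> 'c) measure)))" by (simp add: lborel_prod)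
  also have "\<dots> = (\<integral>\<^sup>+ x. \<integral>\<^sup>+ w. f (x, w) \<partial>lborel \<partial>lborel)" by (rule lborel.nn_integral_fst[OF f1, symmetric])
  also have "\<dots> = (\<integral>\<^sup>+ x. \<integral>\<^sup>+ y. \<integral>\<^sup>+ t. f (x, y, t) \<partial>lborel \<partial>lborel \<partial>lborel)"
  proof (rule nn_integral_cong)
    fix x
    have f2: "(\<lambda>w. f (x, w)) \<in> borel_measurable ((lborel :: 'b measure) \<Otimes>\<^sub>M (lborel :: 'c measure))"
      by (simp add: lborel_prod)
    have "(\<integral>\<^sup>+ w. f (x, w) \<partial>lborel) = (\<integral>\<^sup>+ w. f (x, w) \<partial>((lborel :: 'b measure) \<Otimes>\<^sub>M (lborel :: 'c measure)))"
      by (simp add: lborel_prod)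
    also have "\<dots> = (\<integral>\<^sup>+ y. \<integral>\<^sup>+ t. f (x, y, t) \<partial>lborel \<partial>lborel)" by (rule lborel.nn_integral_fst[OF f2, symmetric])
    finally show "(\<integral>\<^sup>+ w. f (x, w) \<partial>lborel) = (\<integral>\<^sup>+ y. \<integral>\<^sup>+ t. f (x, y, t) \<partial>lborel \<partial>lborel)" .
  qed
  finally show ?thesis .
qed

lemma hmult_measurable: "hmult a \<in> borel \<rightarrow>\<^sub>M borel"
proof -
  have "hmult a = (\<lambda>b. (fst a + fst b, fst (snd a) + fst (snd b), snd (snd a) + snd (snd b) + (fst a \<bullet> fst (snd b) - fst (snd a) \<bullet> fst b) / 2))"
    by (auto simp: hmult_def split: prod.split)
  moreover have "continuous_on UNIV \<dots>" by (intro continuous_intros) auto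
  ultimately show ?thesis using borel_measurable_continuous_onI by metis
qed

text \<open>For fixed horizontal coordinates, left translation shifts the vertical coordinate by a
  constant. Integrating that variable innermost removes the shear, and a Euclidean translation
  remains.\<close>

lemma nn_integral_left_translate:
  fixes f :: "'n::finite heis \<Rightarrow> ennreal"
  assumes f [measurable]: "f \<in> borel_measurable borel"
  shows "(\<integral>\<^sup>+ z. f (hmult a z) \<partial>lborel) = (\<integral>\<^sup>+ z. f z \<partial>lborel)"
proof -
  obtain x0 y0 t0 where a: "a = (x0, y0, t0)" by (cases a)
  have m: "(\<lambda>z. f (hmult a z)) \<in> borel_measurable borel"
    using measurable_compose[OF hmult_measurable f] .
  have "(\<integral>\<^sup>+ z. f (hmult a z) \<partial>lborel) = (\<integral>\<^sup>+ x. \<integral>\<^sup>+ y. \<integral>\<^sup>+ t. f (hmult a (x, y, t)) \<partial>lborel \<partial>lborel \<partial>lborel)"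
    by (rule nn_integral_lborel_triple[OF m])
  also have "\<dots> = (\<integral>\<^sup>+ x. \<integral>\<^sup>+ y. \<integral>\<^sup>+ t. f (x0 + x, y0 + y, t) \<partial>lborel \<partial>lborel \<partial>lborel)"
  proof (rule nn_integral_cong, rule nn_integral_cong)
    fix x y
    have "(\<integral>\<^sup>+ t. f (hmult a (x, y, t)) \<partial>lborel) = (\<integral>\<^sup>+ t. f (x0 + x, y0 + y, (t0 + (x0 \<bullet> y - y0 \<bullet> x) / 2) + t) \<partial>lborel)"
      by (simp add: a hmult_Pair algebra_simps)
    also have "\<dots> = (\<integral>\<^sup>+ t. f (x0 + x, y0 + y, t) \<partial>lborel)"
      by (rule nn_integral_lborel_translate) measurable
    finally show "(\<integral>\<^sup>+ t. f (hmult a (x, y, t)) \<partial>lborel) = (\<integral>\<^sup>+ t. f (x0 + x, y0 + y, t) \<partial>lborel)" .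
  qed
  also have "\<dots> = (\<integral>\<^sup>+ z. f ((x0, y0, 0) + z) \<partial>lborel)"
  proof -
    have "(\<lambda>z. f ((x0, y0, 0) + z)) \<in> borel_measurable borel" by measurable
    from nn_integral_lborel_triple[OF this] show ?thesis by (simp add: plus_prod_def)
  qed
  also have "\<dots> = (\<integral>\<^sup>+ z. f z \<partial>lborel)" by (rule nn_integral_lborel_translate[OF f])
  finally show ?thesis .
qed

text \<open>The vertical coordinate has degree 2, which makes \<open>hnorm\<close> homogeneous of
  degree 1 and raises the homogeneous dimension by one above the topological one.\<close>

definition hdil :: "real \<Rightarrow> 'n::finite heis \<Rightarrow> 'n heis" where
  "hdil r z = (r *\<^sub>R fst z, r *\<^sub>R fst (snd z), r ^ 2 * snd (snd z))"

lemma hnorm_hdil: "0 < r \<Longrightarrow> hnorm (hdil r z) = r * hnorm z"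
proof -
  assume r: "0 < r"
  obtain x y t where z: "z = (x, y, t)" by (cases z)
  have e: "((r * a) ^ 2 + (r * b) ^ 2) ^ 2 + (r ^ 2 * t) ^ 2 = (r ^ 2) ^ 2 * ((a ^ 2 + b ^ 2) ^ 2 + t ^ 2)" for a b :: real
    by algebra
  have "(r ^ 2) ^ 2 = r powr 4" using r by (simp add: powr_numeral)
  then have "((r ^ 2) ^ 2) powr (1 / 4) = (r powr 4) powr (1 / 4)" by (rule arg_cong)
  also have "\<dots> = r" unfolding powr_powr using r by simp
  finally have r4: "((r ^ 2) ^ 2) powr (1 / 4) = r" .
  have "hnorm (hdil r z) = (((r * norm x) ^ 2 + (r * norm y) ^ 2) ^ 2 + (r ^ 2 * t) ^ 2) powr (1 / 4)"
    unfolding z hdil_def hnorm_def using r by simp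
  also have "\<dots> = r * hnorm z"
    unfolding e powr_mult r4 z hnorm_def by simp
  finally show ?thesis .
qed

lemma emeasure_hnorm_ball:
  assumes r: "0 < r"
  shows "emeasure lborel {z :: 'n::finite heis. hnorm z < r} = ennreal (r powr homdim TYPE('n)) * emeasure lborel {z :: 'n heis. hnorm z < 1}"
proof -
  \<comment> \<open>The eigenvalue of the dilation on a basis vector; the vertical one is recognised
    by its nonzero last coordinate.\<close>
  define w :: "'n heis \<Rightarrow> real" where "w j = (if snd (snd j) = 0 then r else r ^ 2)" for j
  let ?T = "\<lambda>x :: 'n heis. 0 + (\<Sum>j\<in>Basis. (w j * (x \<bullet> j)) *\<^sub>R j)"
  have w: "w j \<noteq> 0" for j using r by (simp add: w_def)
  have T: "?T = hdil r"
  proof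
    fix x :: "'n heis"
    show "?T x = hdil r x"
    proof (rule euclidean_eqI)
      fix b :: "'n heis" assume b: "b \<in> Basis"
      have "?T x \<bullet> b = w b * (x \<bullet> b)" using b by (simp add: inner_sum_left inner_Basis if_distrib cong: if_cong)
      also have "\<dots> = hdil r x \<bullet> b"
        using b by (auto simp: Basis_prod_def w_def hdil_def inner_prod_def)
      finally show "?T x \<bullet> b = hdil r x \<bullet> b" .
    qed
  qed
  have wp: "(\<Prod>j\<in>Basis. \<bar>w j\<bar>) = r powr homdim TYPE('n)"
  proof -
    have inj: "inj_on (\<lambda>u. (u, 0)) A" "inj_on (\<lambda>u. (0, u)) B" for A :: "'p set" and B :: "'q set"
      by (auto simp: inj_on_def)
    let ?B1 = "(\<lambda>u :: real^'n. (u, 0 :: (real^'n) \<times> real)) ` Basis"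
    let ?B2 = "(\<lambda>u. (0 :: real^'n, u)) ` ((\<lambda>u :: real^'n. (u, 0 :: real)) ` Basis)"
    let ?B3 = "(\<lambda>u. (0 :: real^'n, u)) ` ((\<lambda>u :: real. (0 :: real^'n, u)) ` Basis)"
    have B: "(Basis :: 'n heis set) = ?B1 \<union> (?B2 \<union> ?B3)"
      unfolding Basis_prod_def by auto
    have fin: "finite ?B1" "finite ?B2" "finite ?B3" by auto
    have disj: "?B1 \<inter> (?B2 \<union> ?B3) = {}" "?B2 \<inter> ?B3 = {}" by auto
    have "(\<Prod>j\<in>Basis. \<bar>w j\<bar>) = (\<Prod>j\<in>?B1. \<bar>w j\<bar>) * ((\<Prod>j\<in>?B2. \<bar>w j\<bar>) * (\<Prod>j\<in>?B3. \<bar>w j\<bar>))"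
      unfolding B using fin disj by (simp only: prod.union_disjoint finite_UnI)
    also have "(\<Prod>j\<in>?B1. \<bar>w j\<bar>) = r ^ CARD('n)"
      using r by (subst prod.reindex) (auto simp: inj_on_def w_def)
    also have "(\<Prod>j\<in>?B2. \<bar>w j\<bar>) = r ^ CARD('n)"
      unfolding image_image using r by (subst prod.reindex) (auto simp: inj_on_def w_def)
    also have "(\<Prod>j\<in>?B3. \<bar>w j\<bar>) = r ^ 2"
      unfolding image_image using r by (subst prod.reindex) (auto simp: inj_on_def w_def)
    also have "r ^ CARD('n) * (r ^ CARD('n) * r ^ 2) = r ^ (2 * CARD('n) + 2)"
      by (simp add: power_add[symmetric] mult_2)
    also have "\<dots> = r powr homdim TYPE('n)"
      unfolding homdim_def powr_realpow[OF r, symmetric] by (simp add: add.commute)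
    finally show ?thesis .
  qed
  have open1: "{z :: 'n heis. hnorm z < b} \<in> sets borel" for b
    by (rule borel_open[OF open_Collect_less[OF continuous_hnorm continuous_on_const]])
  have Tm: "hdil r \<in> (borel :: 'n heis measure) \<rightarrow>\<^sub>M borel"
    unfolding T[symmetric] by measurable
  have "lborel = density (distr lborel borel (hdil r)) (\<lambda>_ :: 'n heis. ennreal (r powr homdim TYPE('n)))"
    using lborel_affine_euclidean[of w 0] w unfolding T wp by simp
  then have "emeasure lborel {z :: 'n heis. hnorm z < r}
     = emeasure (density (distr lborel borel (hdil r)) (\<lambda>_ :: 'n heis. ennreal (r powr homdim TYPE('n)))) {z. hnorm z < r}"
    by simp
  also have "\<dots> = ennreal (r powr homdim TYPE('n)) * emeasure (distr lborel borel (hdil r)) {z :: 'n heis. hnorm z < r}"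
    using open1 by (subst emeasure_density_const) auto
  also have "emeasure (distr lborel borel (hdil r)) {z :: 'n heis. hnorm z < r} = emeasure lborel (hdil r -` {z :: 'n heis. hnorm z < r})"
    using open1 Tm by (subst emeasure_distr) auto
  also have "hdil r -` {z :: 'n heis. hnorm z < r} = {z. hnorm z < 1}"
    using r by (auto simp: hnorm_hdil)
  finally show ?thesis .
qed

text \<open>Left invariance moves the ball to the origin and a dilation brings it to radius 1, so
  \<open>c\<close> is the volume of the unit ball: finite inside a Euclidean ball of radius 3,
  positive because the unit ball is open and nonempty.\<close>

lemma emeasure_hd_ball:
  obtains c where "0 < c" "\<And>x r. 0 < r \<Longrightarrow>
    emeasure lebesgue {y :: 'n::finite heis. hd x y < r} = ennreal (c * r powr homdim TYPE('n))"
proof -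
  let ?U = "{z :: 'n heis. hnorm z < 1}"
  have oU: "open {z :: 'n heis. hnorm z < r}" for r by (rule open_Collect_less[OF continuous_hnorm continuous_on_const])
  have "?U \<subseteq> cball 0 3"
  proof
    fix z assume "z \<in> ?U"
    then have z: "hd 0 z \<le> 1" "hd 0 z < 1" using hnorm_eq_hd[of z] hd_sym[of z 0] by auto
    then have "dist 0 z \<le> 3 * hd 0 z" using dist_le_hd[of 0 z] by simp
    then show "z \<in> cball 0 3" using z by simp
  qed
  then have "bounded ?U" using bounded_subset bounded_cball by blast
  then have fin: "emeasure lborel ?U < \<infinity>" by (rule emeasure_bounded_finite)
  have "0 \<in> ?U" by (simp add: hnorm_zero)
  then have "\<not> negligible ?U" using open_not_negligible[OF oU[of 1]] by blast
  then have pos: "emeasure lborel ?U \<noteq> 0"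
    using oU[of 1] by (auto simp: negligible_iff_null_sets null_sets_completion_iff null_sets_def)
  define c where "c = enn2real (emeasure lborel ?U)"
  have c: "emeasure lborel ?U = ennreal c" "0 < c"
    using fin pos by (auto simp: c_def enn2real_positive_iff less_top zero_less_iff_neq_zero)
  show ?thesis
  proof
    show "0 < c" by (rule c)
    fix x :: "'n heis" and r :: real assume r: "0 < r"
    have bs: "{z :: 'n heis. hnorm z < r} \<in> sets borel" using oU[of r] by (rule borel_open)
    have bx: "{y. hd x y < r} \<in> sets borel" using open_hd_ball[of x r] by (rule borel_open)
    have "emeasure lebesgue {y. hd x y < r} = emeasure lborel {y. hd x y < r}" using bx by simp
    also have "\<dots> = (\<integral>\<^sup>+ y. indicator {y. hd x y < r} y \<partial>lborel)" using bx by simp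
    also have "\<dots> = (\<integral>\<^sup>+ y. indicator {z :: 'n heis. hnorm z < r} (hmult (hinv x) y) \<partial>lborel)"
    proof -
      have "hd x y = hnorm (hmult (hinv x) y)" for y unfolding hd_sym[of x y] by (simp add: hd_def)
      then show ?thesis by (simp add: indicator_def)
    qed
    also have "\<dots> = (\<integral>\<^sup>+ y. indicator {z :: 'n heis. hnorm z < r} y \<partial>lborel)"
      using bs by (intro nn_integral_left_translate) auto
    also have "\<dots> = emeasure lborel {z :: 'n heis. hnorm z < r}" using bs by simp
    also have "\<dots> = ennreal (c * r powr homdim TYPE('n))"
      unfolding emeasure_hnorm_ball[OF r] c(1) using c(2) by (simp add: ennreal_mult[symmetric] mult.commute)
    finally show "emeasure lebesgue {y. hd x y < r} = ennreal (c * r powr homdim TYPE('n))" .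
  qed
qed

section \<open>Transfer to the Heisenberg group\<close>

lemma sigma_finite_lebesgue: "sigma_finite_measure (lebesgue :: 'a::euclidean_space measure)"
proof
  obtain F :: "'a set set" where F: "countable F" "F \<subseteq> sets lborel" "\<Union>F = space lborel" "\<forall>a\<in>F. emeasure lborel a \<noteq> \<infinity>"
    using lborel.sigma_finite_countable by blast
  show "\<exists>A :: 'a set set. countable A \<and> A \<subseteq> sets lebesgue \<and> \<Union>A = space lebesgue \<and> (\<forall>a\<in>A. emeasure lebesgue a \<noteq> \<infinity>)"
  proof (intro exI[of _ F] conjI ballI)
    show "F \<subseteq> sets lebesgue" using F(2) by auto
    fix a assume "a \<in> F"
    then show "emeasure lebesgue a \<noteq> \<infinity>" using F(2,4) by (subst emeasure_completion) auto
  qed (use F in auto)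
qed

lemma measurable_hd: "(\<lambda>z :: 'n::finite heis \<times> 'n heis. hd (fst z) (snd z)) \<in> borel_measurable (lebesgue \<Otimes>\<^sub>M lebesgue)"
proof -
  have id: "(\<lambda>x. x) \<in> (lebesgue :: 'n heis measure) \<rightarrow>\<^sub>M borel" by (rule measurable_completion) simp
  have "(\<lambda>z :: 'n heis \<times> 'n heis. (fst z, snd z)) \<in> lebesgue \<Otimes>\<^sub>M lebesgue \<rightarrow>\<^sub>M borel \<Otimes>\<^sub>M borel"
    by (intro measurable_Pair measurable_compose[OF measurable_fst id] measurable_compose[OF measurable_snd id])
  then have "(\<lambda>z. z) \<in> (lebesgue :: 'n heis measure) \<Otimes>\<^sub>M (lebesgue :: 'n heis measure) \<rightarrow>\<^sub>M borel" by (simp add: borel_prod)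
  from measurable_compose[OF this borel_measurable_continuous_onI[OF continuous_hd]] show ?thesis .
qed

lemma heis_ahlfors_space:
  obtains c where "ahlfors_space (lebesgue :: 'n::finite heis measure) hd (homdim TYPE('n)) c"
proof -
  obtain c where c: "0 < c" "\<And>x r. 0 < r \<Longrightarrow>
    emeasure lebesgue {y :: 'n heis. hd x y < r} = ennreal (c * r powr homdim TYPE('n))"
    using emeasure_hd_ball by blast
  interpret sigma_finite_measure "lebesgue :: 'n heis measure" by (rule sigma_finite_lebesgue)
  have "ahlfors_space (lebesgue :: 'n heis measure) hd (homdim TYPE('n)) c"
    by unfold_locales
      (auto simp: measurable_hd hd_nonneg hd_refl c homdim_def intro: hd_triangle intro!: hd_sym simp del: split_paired_All)
  then show thesis by (rule that)
qed

text \<open>The exponent precedes coefficient, domain and solution because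
  \<open>oscillation\<close> obtains it from the numerical data alone. The sets \<open>K n\<close>
  exhaust \<open>\<Omega>'\<close>, and every compact subset of \<open>\<Omega>'\<close> lies in one
  of them, so a constant for each \<open>K n\<close> gives the local estimate.\<close>

lemma heis_holder:
  fixes p q s t \<alpha> A L M :: real
  assumes par: "1 < p" "p \<le> q" "0 < s" "s \<le> t" "t < 1" "0 < \<alpha>" "\<alpha> \<le> 1" "t * q \<le> s * p + \<alpha>"
  shows "\<exists>\<beta>. 0 < \<beta> \<and> \<beta> < s * p / (q - 1) \<and> (\<forall>(a :: 'n::finite heis \<Rightarrow> 'n heis \<Rightarrow> real) \<Omega> u \<Omega>'.
      open \<Omega> \<and> (\<lambda>z. a (fst z) (snd z)) \<in> borel_measurable (lebesgue \<Otimes>\<^sub>M lebesgue) \<and>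
      (\<forall>\<xi> \<eta>. 0 \<le> a \<xi> \<eta> \<and> a \<xi> \<eta> = a \<eta> \<xi> \<and> a \<xi> \<eta> \<le> L) \<and>
      (\<forall>\<xi> \<eta> \<xi>' \<eta>'. \<bar>a \<xi> \<eta> - a \<xi>' \<eta>'\<bar> \<le> A * (hd \<xi> \<xi>' + hd \<eta> \<eta>') powr \<alpha>) \<and>
      weak_solution p q s t a \<Omega> u \<and> tail_space q s p u \<and>
      open \<Omega>' \<and> closure \<Omega>' \<subseteq> \<Omega> \<and>
      (AE x in lebesgue. x \<in> \<Omega>' \<longrightarrow> \<bar>u x\<bar> \<le> M)
      \<longrightarrow> (\<exists>v. (AE x in lebesgue. x \<in> \<Omega>' \<longrightarrow> v x = u x) \<and> loc_holder_on \<beta> \<Omega>' v))"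
proof -
  obtain c where "ahlfors_space (lebesgue :: 'n heis measure) hd (homdim TYPE('n)) c"
    by (rule heis_ahlfors_space)
  \<comment> \<open>The bounds are arbitrary reals, while the locale asks for \<open>A\<close>,
    \<open>L\<close> nonnegative and \<open>M\<close> positive; enlarging them preserves every
    hypothesis.\<close>
  then interpret double_phase "lebesgue :: 'n heis measure" hd "homdim TYPE('n)" c p q s t \<alpha> "max A 0" "max L 0" "max M 1"
    by (rule double_phase.intro) (unfold_locales, use par in auto)
  have energy_density_eq: "energy_density a h x y = Hfun p q s t a x y h / hd x y powr homdim TYPE('n)" for a h and x y :: "'n heis"
    unfolding energy_density_def ker_def Hfun_def powr_minus_divide powr_add by (simp add: add_divide_distrib mult_ac)
  have flux_eq: "flux a h e x y = Jpow p h * e / hd x y powr (homdim TYPE('n) + s * p)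
      + a x y * Jpow q h * e / hd x y powr (homdim TYPE('n) + t * q)" for a h e and x y :: "'n heis"
    unfolding flux_def ker_def powr_minus_divide by (simp add: mult.assoc)
  have finite_energy_eq: "finite_energy a \<Omega> u \<longleftrightarrow> admissible p q s t a \<Omega> u" for a and \<Omega> :: "'n heis set" and u
    unfolding finite_energy_def admissible_def energy_density_eq Cset_def ..
  have weak_sol: "weak_sol a \<Omega> u" if "weak_solution p q s t a \<Omega> u" "open \<Omega>" for a and \<Omega> :: "'n heis set" and u
    using that unfolding weak_sol_def weak_solution_def finite_energy_eq flux_eq Cset_def by auto
  obtain \<beta> where \<beta>: "0 < \<beta>" "\<beta> < s * p / (q - 1)" and osc: "\<And>a \<Omega> u (z :: 'n heis) H \<rho> W.
    \<lbrakk>modulating a; weak_sol a \<Omega> u; 0 < \<rho>; 0 \<le> H;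
     (\<integral>\<^sup>+ y. ennreal (\<bar>u y\<bar> powr (q - 1) * (1 + hd z y) powr (- (homdim TYPE('n) + s * p))) \<partial>lebesgue) < \<infinity>;
     AE y in lebesgue. y \<in> W \<longrightarrow> \<bar>u y\<bar> \<le> max M 1\<rbrakk> \<Longrightarrow>
    \<exists>C R0. 0 < C \<and> 0 < R0 \<and> (\<forall>x0 r. hd z x0 \<le> H \<and> {y. hd x0 y < \<rho>} \<subseteq> W \<inter> \<Omega> \<and> 0 < r \<and> r \<le> R0 \<longrightarrow>
      (\<exists>S. AE y in lebesgue. hd x0 y < r \<longrightarrow> \<bar>u y - S\<bar> \<le> C * r powr \<beta>))"
    using oscillation by blast
  show ?thesis
  proof (intro exI[of _ \<beta>] conjI \<beta> allI impI; elim conjE)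
    fix a :: "'n heis \<Rightarrow> 'n heis \<Rightarrow> real" and \<Omega> u \<Omega>'
    assume \<Omega>: "open \<Omega>" and am: "(\<lambda>z. a (fst z) (snd z)) \<in> borel_measurable (lebesgue \<Otimes>\<^sub>M lebesgue)"
      and A1: "\<forall>\<xi> \<eta>. 0 \<le> a \<xi> \<eta> \<and> a \<xi> \<eta> = a \<eta> \<xi> \<and> a \<xi> \<eta> \<le> L"
      and A2: "\<forall>\<xi> \<eta> \<xi>' \<eta>'. \<bar>a \<xi> \<eta> - a \<xi>' \<eta>'\<bar> \<le> A * (hd \<xi> \<xi>' + hd \<eta> \<eta>') powr \<alpha>"
      and sol: "weak_solution p q s t a \<Omega> u" and tail: "tail_space q s p u"
      and \<Omega>': "open \<Omega>'" "closure \<Omega>' \<subseteq> \<Omega>" and uM: "AE x in lebesgue. x \<in> \<Omega>' \<longrightarrow> \<bar>u x\<bar> \<le> M"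
    have mod: "modulating a"
      unfolding modulating_def
    proof (intro conjI am allI)
      fix x y x' y'
      show "0 \<le> a x y" "a x y = a y x" using A1 by blast+
      have "a x y \<le> L" using A1 by blast
      then show "a x y \<le> max L 0" by simp
      have "A * (hd x x' + hd y y') powr \<alpha> \<le> max A 0 * (hd x x' + hd y y') powr \<alpha>"
        by (intro mult_right_mono) auto
      then show "\<bar>a x y - a x' y'\<bar> \<le> max A 0 * (hd x x' + hd y y') powr \<alpha>"
        using A2[rule_format, of x y x' y'] by (rule order_trans[rotated])
    qed
    have uM': "AE x in lebesgue. x \<in> \<Omega>' \<longrightarrow> \<bar>u x\<bar> \<le> max M 1"
      using uM by eventually_elim auto
    have hn: "hnorm x = hd 0 x" for x :: "'n heis" by (subst hd_sym) (rule hnorm_eq_hd)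
    have tail': "(\<integral>\<^sup>+ y. ennreal (\<bar>u y\<bar> powr (q - 1) * (1 + hd 0 y) powr (- (homdim TYPE('n) + s * p))) \<partial>lebesgue) < \<infinity>"
      using tail unfolding tail_space_def hn by simp
    \<comment> \<open>The radius \<open>1 / (real n + 1)\<close> and the bound on
      \<open>hd 0 x\<close> are the \<open>\<rho>\<close> and \<open>H\<close> of
      \<open>oscillation\<close>, with \<open>z = 0\<close> and
      \<open>W = \<Omega>'\<close>.\<close>
    define K where "K n = {x \<in> \<Omega>'. hd 0 x \<le> real n \<and> {y. hd x y < 1 / (real n + 1)} \<subseteq> \<Omega>'}" for n
    have sub: "\<Omega>' \<subseteq> \<Omega>" using \<Omega>'(2) closure_subset by blast
    have compK: "\<exists>n. X \<subseteq> K n" if X: "compact X" "X \<subseteq> \<Omega>'" for X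
    proof -
      obtain \<rho> where \<rho>: "0 < \<rho>" "\<And>x. x \<in> X \<Longrightarrow> {y. hd x y < \<rho>} \<subseteq> \<Omega>'"
        using hd_ball_in_open[OF X(1) \<Omega>'(1) X(2)] by blast
      have "bounded (hd 0 ` X)"
        using X(1) by (intro compact_imp_bounded compact_continuous_image continuous_on_subset[OF continuous_hd_right]) auto
      then obtain B where B: "\<And>x. x \<in> X \<Longrightarrow> hd 0 x \<le> B"
        unfolding bounded_iff by (auto simp: abs_le_iff)
      obtain n1 where n1: "B \<le> real n1" using real_arch_simple by blast
      obtain n2 where n2: "inverse (real (Suc n2)) < \<rho>" using reals_Archimedean[OF \<rho>(1)] by blast
      define n where "n = max n1 n2"
      have "1 / (real n + 1) \<le> 1 / (real n2 + 1)" by (intro divide_left_mono) (auto simp: n_def)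
      also have "\<dots> < \<rho>" using n2 by (simp add: inverse_eq_divide add.commute)
      finally have n\<rho>: "1 / (real n + 1) < \<rho>" .
      have "X \<subseteq> K n"
      proof
        fix x assume x: "x \<in> X"
        have "{y. hd x y < 1 / (real n + 1)} \<subseteq> {y. hd x y < \<rho>}" using n\<rho> by (intro Collect_mono) linarith
        then have "{y. hd x y < 1 / (real n + 1)} \<subseteq> \<Omega>'" using \<rho>(2)[OF x] by (rule order_trans)
        moreover have "hd 0 x \<le> real n" using B[OF x] n1 by (simp add: n_def)
        ultimately show "x \<in> K n" using x X(2) unfolding K_def by blast
      qed
      then show ?thesis by blast
    qed
    have UK: "(\<Union>n. K n) = \<Omega>'"
    proof
      show "\<Omega>' \<subseteq> (\<Union>n. K n)"
      proof
        fix x assume "x \<in> \<Omega>'"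
        then obtain n where "{x} \<subseteq> K n" using compK[of "{x}"] by auto
        then show "x \<in> (\<Union>n. K n)" by blast
      qed
    qed (auto simp: K_def)
    obtain Z :: "'n heis set" where Z: "countable Z" "\<And>X. open X \<Longrightarrow> X \<noteq> {} \<Longrightarrow> \<exists>z\<in>Z. z \<in> X"
      using countable_dense_setE by blast
    obtain v where v: "AE x in lebesgue. x \<in> (\<Union>n. K n) \<longrightarrow> v x = u x"
      "\<And>n. \<exists>C. \<forall>x\<in>K n. \<forall>y\<in>K n. \<bar>v x - v y\<bar> \<le> C * hd x y powr \<beta>"
    proof (rule holder_representative[OF Z(1) _ hd_zero_iff \<beta>(1), of K u "max M 1"])
      fix x :: "'n heis" and e :: real assume e: "0 < e"
      have "x \<in> {y. hd x y < e}" using e by (simp add: hd_refl)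
      then show "\<exists>z\<in>Z. hd x z < e" using Z(2)[OF open_hd_ball[of x e]] by blast
    next
      fix n
      have H: "0 < 1 / (real n + 1)" "0 \<le> real n" by auto
      obtain C R0 where "0 < C" "0 < R0" and CR: "\<forall>x0 r. hd 0 x0 \<le> real n \<and> {y. hd x0 y < 1 / (real n + 1)} \<subseteq> \<Omega>' \<inter> \<Omega> \<and> 0 < r \<and> r \<le> R0 \<longrightarrow>
        (\<exists>S. AE y in lebesgue. hd x0 y < r \<longrightarrow> \<bar>u y - S\<bar> \<le> C * r powr \<beta>)"
        using osc[OF mod weak_sol[OF sol \<Omega>] H tail' uM'] by blast
      moreover have "\<forall>x0 r. x0 \<in> K n \<and> 0 < r \<and> r \<le> R0 \<longrightarrow>
        (\<exists>S. AE y in lebesgue. hd x0 y < r \<longrightarrow> \<bar>u y - S\<bar> \<le> C * r powr \<beta>)"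
      proof (intro allI impI)
        fix x0 r assume "x0 \<in> K n \<and> 0 < r \<and> r \<le> R0"
        then have "hd 0 x0 \<le> real n \<and> {y. hd x0 y < 1 / (real n + 1)} \<subseteq> \<Omega>' \<inter> \<Omega> \<and> 0 < r \<and> r \<le> R0"
          using sub unfolding K_def by blast
        then show "\<exists>S. AE y in lebesgue. hd x0 y < r \<longrightarrow> \<bar>u y - S\<bar> \<le> C * r powr \<beta>"
          by (rule CR[rule_format])
      qed
      ultimately show "\<exists>C R0. 0 < C \<and> 0 < R0 \<and> (\<forall>x0 r. x0 \<in> K n \<and> 0 < r \<and> r \<le> R0 \<longrightarrow>
        (\<exists>S. AE y in lebesgue. hd x0 y < r \<longrightarrow> \<bar>u y - S\<bar> \<le> C * r powr \<beta>))"
        by blast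
    next
      fix n
      \<comment> \<open>Half the margin of \<open>K n\<close>: a point at distance below
        \<open>e\<close> from \<open>K n\<close> keeps the margin
        \<open>e = 1 / (2 * n + 2)\<close>, which is that of \<open>K (2 * n + 1)\<close>.\<close>
      define e where "e = 1 / (real (2 * n + 1) + 1)"
      have e: "0 < e" "2 * e = 1 / (real n + 1)" "e \<le> 1" by (auto simp: e_def field_simps)
      have "\<forall>x y. x \<in> K n \<and> hd x y < e \<longrightarrow> y \<in> K (2 * n + 1)"
      proof (intro allI impI)
        fix x y assume xy: "x \<in> K n \<and> hd x y < e"
        have sub': "{y. hd x y < 2 * e} \<subseteq> \<Omega>'" using xy unfolding K_def e(2) by blast
        have "hd x y < 2 * e" using xy e by linarith
        then have "y \<in> \<Omega>'" using sub' by blast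
        moreover have "hd 0 y \<le> real (2 * n + 1)"
        proof -
          have "hd 0 x \<le> real n" using xy unfolding K_def by blast
          then show ?thesis using hd_triangle[of 0 y x] xy e(3) by simp
        qed
        moreover have "{w. hd y w < e} \<subseteq> \<Omega>'"
        proof
          fix w assume "w \<in> {w. hd y w < e}"
          then have "hd x w < 2 * e" using hd_triangle[of x w y] xy by simp
          then show "w \<in> \<Omega>'" using sub' by blast
        qed
        ultimately show "y \<in> K (2 * n + 1)" unfolding K_def e_def by blast
      qed
      then show "\<exists>m e. 0 < e \<and> (\<forall>x y. x \<in> K n \<and> hd x y < e \<longrightarrow> y \<in> K m)"
        using e(1) by blast
    next
      show "AE y in lebesgue. y \<in> (\<Union>n. K n) \<longrightarrow> \<bar>u y\<bar> \<le> max M 1" unfolding UK by (rule uM')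
    qed auto
    show "\<exists>v. (AE x in lebesgue. x \<in> \<Omega>' \<longrightarrow> v x = u x) \<and> loc_holder_on \<beta> \<Omega>' v"
    proof (intro exI conjI)
      show "AE x in lebesgue. x \<in> \<Omega>' \<longrightarrow> v x = u x" using v(1) unfolding UK .
      show "loc_holder_on \<beta> \<Omega>' v"
        unfolding loc_holder_on_def
      proof (intro allI impI)
        fix X assume "compact X \<and> X \<subseteq> \<Omega>'"
        then obtain n where "X \<subseteq> K n" using compK by blast
        moreover obtain C where "\<forall>x\<in>K n. \<forall>y\<in>K n. \<bar>v x - v y\<bar> \<le> C * hd x y powr \<beta>" using v(2)[of n] by blast
        ultimately show "\<exists>C. \<forall>\<xi>\<in>X. \<forall>\<eta>\<in>X. \<bar>v \<xi> - v \<eta>\<bar> \<le> C * hd \<xi> \<eta> powr \<beta>" by blast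
      qed
    qed
  qed
qed

theorem theorem1p2:
  shows "\<exists>B :: real \<Rightarrow> real \<Rightarrow> real \<Rightarrow> real \<Rightarrow> real \<Rightarrow> real \<Rightarrow> real \<Rightarrow> real \<Rightarrow> real.
    \<forall>p q s t \<alpha> A L M (a :: 'n::finite heis \<Rightarrow> 'n heis \<Rightarrow> real) \<Omega> u \<Omega>'.
      open \<Omega> \<and> bounded \<Omega> \<and>
      1 < p \<and> p \<le> q \<and> 0 < s \<and> s \<le> t \<and> t < 1 \<and> 0 < \<alpha> \<and> \<alpha> \<le> 1 \<and>
      t * q \<le> s * p + \<alpha> \<and>
      (\<lambda>z. a (fst z) (snd z)) \<in> borel_measurable (lebesgue \<Otimes>\<^sub>M lebesgue) \<and>
      (\<forall>\<xi> \<eta>. 0 \<le> a \<xi> \<eta> \<and> a \<xi> \<eta> = a \<eta> \<xi> \<and> a \<xi> \<eta> \<le> L) \<and>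
      (\<forall>\<xi> \<eta> \<xi>' \<eta>'. \<bar>a \<xi> \<eta> - a \<xi>' \<eta>'\<bar> \<le> A * (hd \<xi> \<xi>' + hd \<eta> \<eta>') powr \<alpha>) \<and>
      weak_solution p q s t a \<Omega> u \<and> tail_space q s p u \<and> locally_bounded_in \<Omega> u \<and>
      open \<Omega>' \<and> compact (closure \<Omega>') \<and> closure \<Omega>' \<subseteq> \<Omega> \<and>
      (AE x in lebesgue. x \<in> \<Omega>' \<longrightarrow> \<bar>u x\<bar> \<le> M)
      \<longrightarrow> 0 < B p q s t \<alpha> A L M \<and> B p q s t \<alpha> A L M < s * p / (q - 1) \<and>
          (\<exists>v. (AE x in lebesgue. x \<in> \<Omega>' \<longrightarrow> v x = u x) \<and>
               loc_holder_on (B p q s t \<alpha> A L M) \<Omega>' v)"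
proof -
  \<comment> \<open>\<open>R\<close> bundles all that is asked of an exponent for given numbers,
    with coefficient, domain and solution quantified inside, so that choosing \<open>\<beta>\<close>
    yields a function of the eight numbers alone; the dimension is fixed by the type.\<close>
  define R where "R p q s t \<alpha> A L M \<beta> \<longleftrightarrow> 0 < \<beta> \<and> \<beta> < s * p / (q - 1) \<and> (\<forall>(a :: 'n heis \<Rightarrow> 'n heis \<Rightarrow> real) \<Omega> u \<Omega>'.
      open \<Omega> \<and> (\<lambda>z. a (fst z) (snd z)) \<in> borel_measurable (lebesgue \<Otimes>\<^sub>M lebesgue) \<and>
      (\<forall>\<xi> \<eta>. 0 \<le> a \<xi> \<eta> \<and> a \<xi> \<eta> = a \<eta> \<xi> \<and> a \<xi> \<eta> \<le> L) \<and>
      (\<forall>\<xi> \<eta> \<xi>' \<eta>'. \<bar>a \<xi> \<eta> - a \<xi>' \<eta>'\<bar> \<le> A * (hd \<xi> \<xi>' + hd \<eta> \<eta>') powr \<alpha>) \<and>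
      weak_solution p q s t a \<Omega> u \<and> tail_space q s p u \<and>
      open \<Omega>' \<and> closure \<Omega>' \<subseteq> \<Omega> \<and>
      (AE x in lebesgue. x \<in> \<Omega>' \<longrightarrow> \<bar>u x\<bar> \<le> M)
      \<longrightarrow> (\<exists>v. (AE x in lebesgue. x \<in> \<Omega>' \<longrightarrow> v x = u x) \<and> loc_holder_on \<beta> \<Omega>' v))"
    for p q s t \<alpha> A L M \<beta> :: real
  \<comment> \<open>Where the constraints on the parameters fail, the chosen value is
    arbitrary.\<close>
  have R: "R p q s t \<alpha> A L M (SOME \<beta>. R p q s t \<alpha> A L M \<beta>)"
    if "1 < p" "p \<le> q" "0 < s" "s \<le> t" "t < 1" "0 < \<alpha>" "\<alpha> \<le> 1" "t * q \<le> s * p + \<alpha>" for p q s t \<alpha> A L M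
    by (rule someI_ex) (unfold R_def, rule heis_holder[OF that])
  show ?thesis
  proof (intro exI[of _ "\<lambda>p q s t \<alpha> A L M. SOME \<beta>. R p q s t \<alpha> A L M \<beta>"] allI impI, elim conjE)
    fix p q s t \<alpha> A L M and a :: "'n heis \<Rightarrow> 'n heis \<Rightarrow> real" and \<Omega> u \<Omega>'
    assume h: "open \<Omega>" "1 < p" "p \<le> q" "0 < s" "s \<le> t" "t < 1" "0 < \<alpha>" "\<alpha> \<le> 1" "t * q \<le> s * p + \<alpha>"
      "(\<lambda>z. a (fst z) (snd z)) \<in> borel_measurable (lebesgue \<Otimes>\<^sub>M lebesgue)"
      "\<forall>\<xi> \<eta>. 0 \<le> a \<xi> \<eta> \<and> a \<xi> \<eta> = a \<eta> \<xi> \<and> a \<xi> \<eta> \<le> L"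
      "\<forall>\<xi> \<eta> \<xi>' \<eta>'. \<bar>a \<xi> \<eta> - a \<xi>' \<eta>'\<bar> \<le> A * (hd \<xi> \<xi>' + hd \<eta> \<eta>') powr \<alpha>"
      "weak_solution p q s t a \<Omega> u" "tail_space q s p u" "open \<Omega>'" "closure \<Omega>' \<subseteq> \<Omega>"
      "AE x in lebesgue. x \<in> \<Omega>' \<longrightarrow> \<bar>u x\<bar> \<le> M"
    let ?\<beta> = "SOME \<beta>. R p q s t \<alpha> A L M \<beta>"
    from R[OF h(2-9), of A L M, unfolded R_def[of p q s t \<alpha> A L M ?\<beta>]]
    have "0 < ?\<beta> \<and> ?\<beta> < s * p / (q - 1) \<and> (\<exists>v. (AE x in lebesgue. x \<in> \<Omega>' \<longrightarrow> v x = u x) \<and> loc_holder_on ?\<beta> \<Omega>' v)"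
      using h by blast
    then show "0 < ?\<beta> \<and> ?\<beta> < s * p / (q - 1) \<and> (\<exists>v. (AE x in lebesgue. x \<in> \<Omega>' \<longrightarrow> v x = u x) \<and> loc_holder_on ?\<beta> \<Omega>' v)" .
  qed
qed

end
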